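(* Let $n\ge 1$ be an integer, and let $A_n$, $W_n$, $\mathrm{JT}_n$, $\sigma_f$, $\xi$, $\zeta$ be as defined in the context. Then the following hold. (1) The Jacobi conjecture is equivalent to the Witt algebra's conjecture. That is, the statement "for every Jacobi tuple $(f_1,\dots,f_n)$ of $A_n$ one has $A_n=\mathbb{C}[f_1,\dots,f_n]$" holds if and only if the statement "every nonzero Lie algebra endomorphism of $W_n$ is an automorphism of $W_n$" holds. (2) The map $\xi:\mathrm{JT}_n\to \mathrm{End}\,W_n\setminus\{0\}$, $f\mapsto\sigma_f$, is an isomorphism of semigroups. (3) The map $\zeta:\mathrm{Aut}\,A_n\to\mathrm{End}\,W_n\setminus\{0\}$, $\tau\mapsto \sigma_{f_\tau}$ with $f_\tau=(\tau(x_1),\dots,\tau(x_n))$, induces a group isomorphism $\mathrm{Aut}\,A_n\cong\mathrm{Aut}\,W_n$ (i.e. $\zeta$ has image $\mathrm{Aut}\,W_n$ and is a group isomorphism onto it). (4) The group $\mathrm{Aut}\,W_2$ is generated by the elements $s$, $\tau_a$ ($a\in\mathbb{C}^\times$) and $\psi_p$ ($p\in\mathbb{Z}^{\ge0}$), which are the linear maps on $W_2$ given, for all $i,j,k,l\in\mathbb{Z}^{\ge0}$, by $$s(x_1^ix_2^j\partial_1)=x_2^ix_1^j\partial_2,\qquad s(x_1^kx_2^l\partial_2)=x_2^kx_1^l\partial_1,$$ $$\tau_a(x_1^ix_2^j\partial_1)=a^{i-1}x_1^ix_2^j\partial_1,\qquad \tau_a(x_1^kx_2^l\partial_2)=a^kx_1^kx_2^l\partial_2,$$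 $$\psi_p(x_1^ix_2^j\partial_1)=x_1^i(x_2+x_1^p)^j(\partial_1-p\,x_1^{p-1}\partial_2),\qquad \psi_p(x_1^kx_2^l\partial_2)=x_1^k(x_2+x_1^p)^l\partial_2$$ (where $p\,x_1^{p-1}$ is read as $0$ when $p=0$).
   Context: $\mathbb{Z}^{\ge0}$ is the set of nonnegative integers and $\mathbb{C}^\times=\mathbb{C}\setminus\{0\}$. $A_n=\mathbb{C}[x_1,\dots,x_n]$ is the polynomial algebra, and $W_n=\mathrm{Der}\,A_n=\bigoplus_{i=1}^n A_n\partial_i$, with $\partial_i=\partial/\partial x_i$, is the Lie algebra over $\mathbb{C}$ of $\mathbb{C}$-derivations of $A_n$ (the rank $n$ Witt algebra), with bracket the commutator. $\mathrm{Aut}\,A_n$ is the group of $\mathbb{C}$-algebra automorphisms of $A_n$; $\mathrm{Aut}\,W_n$ is the group of Lie algebra automorphisms of $W_n$; $\mathrm{End}\,W_n\setminus\{0\}$ is the set of nonzero Lie algebra endomorphisms of $W_n$, a semigroup under composition (nonzero endomorphisms are injective since $W_n$ is simple). Jacobi tuples: a tuple $f=(f_1,\dots,f_n)\in A_n^n$ is a Jacobi tuple if its Jacobi determinant $J(f_1,\dots,f_n)=\det\big(\frac{\partial f_i}{\partial x_j}\big)_{1\le i,j\le n}$ lies in $\mathbb{C}^\times$. $\mathrm{JT}_n$ denotes the set of all Jacobi tuples of $A_n$, which is a semigroup under the product $f\cdot g=h$, where $h=(h_1,\dots,h_n)$ with $h_i=g_i(f_1,\dots,f_n)$ (substituting $x_k\mapsto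 f_k$ for all $k$ in $g_i$). For $f=(f_1,\dots,f_n)\in \mathrm{JT}_n$ with $J(f_1,\dots,f_n)=c\in\mathbb{C}^\times$, the linear map $\sigma_f:W_n\to W_n$ is defined by $$\sigma_f(x_1^{k_1}\cdots x_n^{k_n}\partial_j)=f_1^{k_1}\cdots f_n^{k_n}\theta_j,\qquad \theta_j=\frac1c\sum_{l=1}^n M_{jl}\,\partial_l ,$$ for $k_i\in\mathbb{Z}^{\ge0}$, $1\le j\le n$, where $M_{jl}$ is the $(j,l)$-cofactor (signed minor obtained by deleting row $j$ and column $l$) of the Jacobi matrix $M=\big(\frac{\partial f_i}{\partial x_j}\big)_{1\le i,j\le n}$; thus $\theta_j(f_i)=\delta_{i,j}$ for all $i,j$. The map $\sigma_f$ is a nonzero Lie algebra endomorphism of $W_n$, and $\xi:\mathrm{JT}_n\to\mathrm{End}\,W_n\setminus\{0\}$, $f\mapsto\sigma_f$, is a semigroup homomorphism. For $\tau\in\mathrm{Aut}\,A_n$, the tuple $f_\tau=(\tau(x_1),\dots,\tau(x_n))$ is a Jacobi tuple, and $\zeta:\mathrm{Aut}\,A_n\to\mathrm{End}\,W_n\setminus\{0\}$, $\tau\mapsto\sigma_{f_\tau}$, is a semigroup homomorphism. *)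

theory Defs
  imports
    "HOL-Library.Poly_Mapping"
    "HOL-Library.Numeral_Type"
    "HOL-Analysis.Determinants"
    "HOL-Algebra.Generated_Groups"
begin

section \<open>The polynomial algebra\<close>

text \<open>The type \<open>'n\<close> indexes the variables \<open>x\<^sub>1, \<dots>, x\<^sub>n\<close>, so that \<open>n = CARD('n) \<ge> 1\<close>.\<close>

type_synonym 'n cpoly = "('n \<Rightarrow>\<^sub>0 nat) \<Rightarrow>\<^sub>0 complex"

definition Const :: "complex \<Rightarrow> 'n cpoly"
  where "Const c = Poly_Mapping.single 0 c"

definition Var :: "'n \<Rightarrow> 'n cpoly"
  where "Var i = Poly_Mapping.single (Poly_Mapping.single i 1) 1"

definition pscale :: "complex \<Rightarrow> 'n cpoly \<Rightarrow> 'n cpoly"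
  where "pscale c p = Const c * p"

text \<open>The power product \<open>f\<^sub>1^k\<^sub>1 \<cdots> f\<^sub>n^k\<^sub>n\<close> of a tuple.\<close>

definition mpow :: "('n::finite \<Rightarrow> 'n cpoly) \<Rightarrow> ('n \<Rightarrow>\<^sub>0 nat) \<Rightarrow> 'n cpoly"
  where "mpow f k = (\<Prod>i\<in>UNIV. f i ^ Poly_Mapping.lookup k i)"

text \<open>The substitution \<open>x\<^sub>i \<mapsto> f\<^sub>i\<close>.\<close>

definition poly_subst :: "('n::finite \<Rightarrow> 'n cpoly) \<Rightarrow> 'n cpoly \<Rightarrow> 'n cpoly"
  where "poly_subst f p = (\<Sum>k\<in>Poly_Mapping.keys p. Const (Poly_Mapping.lookup p k) * mpow f k)"

text \<open>In the summands with \<open>k\<^sub>i = 0\<close> the truncated exponent is irrelevant, as the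
  coefficient vanishes.\<close>

definition part_deriv :: "'n \<Rightarrow> 'n cpoly \<Rightarrow> 'n cpoly"
  where "part_deriv i p = (\<Sum>k\<in>Poly_Mapping.keys p.
    Poly_Mapping.single (k - Poly_Mapping.single i 1)
      (of_nat (Poly_Mapping.lookup k i) * Poly_Mapping.lookup p k))"

definition subalgebra :: "'n cpoly set \<Rightarrow> bool"
  where "subalgebra S \<longleftrightarrow> range Const \<subseteq> S \<and> (\<forall>p\<in>S. \<forall>q\<in>S. p + q \<in> S \<and> p * q \<in> S)"

definition alg_auts :: "('n cpoly \<Rightarrow> 'n cpoly) set"
  where "alg_auts = {\<tau>. bij \<tau> \<and> (\<forall>c. \<tau> (Const c) = Const c) \<and>
    (\<forall>p q. \<tau> (p + q) = \<tau> p + \<tau> q \<and> \<tau> (p * q) = \<tau> p * \<tau> q)}"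

definition Aut_A :: "('n cpoly \<Rightarrow> 'n cpoly) monoid"
  where "Aut_A = \<lparr>carrier = alg_auts, mult = (\<circ>), one = id\<rparr>"

lemma vector_space_pscale: "vector_space (pscale :: complex \<Rightarrow> 'n cpoly \<Rightarrow> 'n cpoly)"
  by unfold_locales
    (simp_all add: pscale_def Const_def algebra_simps single_add mult_single flip: mult.assoc)

lemma cpoly_induct [case_names zero add]:
  fixes p :: "'n cpoly"
  assumes "P 0" "\<And>p k a. P p \<Longrightarrow> P (p + Poly_Mapping.single k a)"
  shows "P p"
proof (induction p rule: Poly_Mapping.update_induct)
  case const
  show ?case by fact
next
  case (update f a b)
  have "Poly_Mapping.update a b f = f + Poly_Mapping.single a b"
    using update(1)
    by (intro poly_mapping_eqI)
      (auto simp: lookup_update lookup_add lookup_single in_keys_iff when_def)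
  then show ?case using assms(2)[OF update(3)] by simp
qed

lemma part_deriv_add: "part_deriv i (p + q) = part_deriv i p + part_deriv i q"
  unfolding part_deriv_def
  by (rule setsum_keys_plus_distrib[where f = "\<lambda>k a. Poly_Mapping.single (k - Poly_Mapping.single i 1)
      (of_nat (Poly_Mapping.lookup k i) * a)"]) (simp_all add: single_add algebra_simps)

lemma part_deriv_single: "part_deriv i (Poly_Mapping.single k a) =
    Poly_Mapping.single (k - Poly_Mapping.single i 1) (of_nat (Poly_Mapping.lookup k i) * a)"
  by (cases "a = 0") (simp_all add: part_deriv_def)

lemma part_deriv_0: "part_deriv i 0 = 0"
  by (simp add: part_deriv_def)

lemma single_shift:
  fixes k l :: "'n \<Rightarrow>\<^sub>0 nat"
  assumes "Poly_Mapping.lookup k i \<noteq> 0"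
  shows "k + l - Poly_Mapping.single i 1 = k - Poly_Mapping.single i 1 + l"
  using assms
  by (intro poly_mapping_eqI) (auto simp: lookup_add lookup_minus lookup_single when_def)

lemma part_deriv_single_mult:
  fixes k l :: "'n \<Rightarrow>\<^sub>0 nat" and a b :: complex
  shows "part_deriv i (Poly_Mapping.single k a * Poly_Mapping.single l b) =
    part_deriv i (Poly_Mapping.single k a) * Poly_Mapping.single l b +
    Poly_Mapping.single k a * part_deriv i (Poly_Mapping.single l b)"
proof -
  let ?e = "Poly_Mapping.single i 1 :: 'n \<Rightarrow>\<^sub>0 nat"
  have 1: "Poly_Mapping.single (k - ?e + l) (of_nat (Poly_Mapping.lookup k i) * a * b) =
      Poly_Mapping.single (k + l - ?e) (of_nat (Poly_Mapping.lookup k i) * a * b)"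
    by (cases "Poly_Mapping.lookup k i = 0") (simp_all add: single_shift del: One_nat_def)
  have 2: "Poly_Mapping.single (k + (l - ?e)) (a * (of_nat (Poly_Mapping.lookup l i) * b)) =
      Poly_Mapping.single (k + l - ?e) (a * (of_nat (Poly_Mapping.lookup l i) * b))"
    using single_shift[of l i k]
    by (cases "Poly_Mapping.lookup l i = 0") (simp_all add: add.commute del: One_nat_def)
  show ?thesis
    by (simp only: part_deriv_single mult_single 1 2 flip: single_add)
      (simp add: lookup_add algebra_simps)
qed

lemma part_deriv_mult: "part_deriv i (p * q) = part_deriv i p * q + p * part_deriv i q"
proof (induction p rule: cpoly_induct)
  case zero
  show ?case by (simp add: part_deriv_0)
next
  case (add p k a)
  have "part_deriv i (Poly_Mapping.single k a * q) =
      part_deriv i (Poly_Mapping.single k a) * q + Poly_Mapping.single k a * part_deriv i q"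
    by (induction q rule: cpoly_induct)
      (simp_all add: part_deriv_0 part_deriv_add part_deriv_single_mult algebra_simps)
  with add show ?case by (simp add: part_deriv_add algebra_simps)
qed

lemma part_deriv_Const: "part_deriv i (Const c) = 0"
  by (simp add: Const_def part_deriv_single)

lemma part_deriv_Var: "part_deriv i (Var j) = (if i = j then 1 else 0)"
  by (simp add: Var_def part_deriv_single lookup_single when_def)

lemma single_eq_mpow_Var:
  fixes k :: "'n::finite \<Rightarrow>\<^sub>0 nat"
  shows "Poly_Mapping.single k a = Const a * mpow Var k"
proof -
  have pow: "Var i ^ m = Poly_Mapping.single (Poly_Mapping.single i m) 1" for i :: 'n and m
    by (induction m) (simp_all add: Var_def mult_single flip: single_add)
  have "(\<Prod>i\<in>I. Var i ^ Poly_Mapping.lookup k i) =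
      Poly_Mapping.single (\<Sum>i\<in>I. Poly_Mapping.single i (Poly_Mapping.lookup k i)) 1"
    if "finite I" for I :: "'n set"
    using that by induction (simp_all add: pow mult_single)
  moreover have "(\<Sum>i\<in>UNIV. Poly_Mapping.single i (Poly_Mapping.lookup k i)) = k"
    by (intro poly_mapping_eqI) (simp add: lookup_sum lookup_single when_def)
  ultimately show ?thesis
    by (simp add: mpow_def Const_def mult_single)
qed


section \<open>The Witt algebra\<close>

definition derivation :: "('n cpoly \<Rightarrow> 'n cpoly) \<Rightarrow> bool"
  where "derivation D \<longleftrightarrow> Vector_Spaces.linear pscale pscale D \<and>
    (\<forall>p q. D (p * q) = D p * q + p * D q)"

lemma derivation_iff:
  "derivation D \<longleftrightarrow> (\<forall>p q. D (p + q) = D p + D q) \<and> (\<forall>c. D (Const c) = 0) \<and>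
    (\<forall>p q. D (p * q) = D p * q + p * D q)"
proof -
  have "(\<forall>c p. D (Const c * p) = Const c * D p) \<longleftrightarrow> (\<forall>c. D (Const c) = 0)"
    if leibniz: "\<And>p q. D (p * q) = D p * q + p * D q"
  proof -
    have "D 1 = 0" using leibniz[of 1 1] by simp
    show ?thesis
    proof (intro iffI allI)
      fix c assume "\<forall>c p. D (Const c * p) = Const c * D p"
      from this[rule_format, of c 1] \<open>D 1 = 0\<close> show "D (Const c) = 0" by simp
    qed (simp add: leibniz)
  qed
  then show ?thesis
    using vector_space_pscale
    by (auto simp: derivation_def linear_iff_module_hom module_hom_def module_hom_axioms_def
        module_iff_vector_space pscale_def)
qed

lemma derivation_0: "derivation D \<Longrightarrow> D 0 = 0"
  by (metis add_cancel_right_right derivation_iff)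

typedef (overloaded) ('n::finite) witt = "{D :: 'n cpoly \<Rightarrow> 'n cpoly. derivation D}"
  morphisms der Abs_witt
  by (rule exI[of _ "\<lambda>_. 0"]) (simp add: derivation_iff)

setup_lifting type_definition_witt

text \<open>Otherwise lifting would unfold polynomials to functions as well.\<close>

lifting_forget poly_mapping.lifting

instantiation witt :: (finite) ab_group_add
begin

lift_definition zero_witt :: "'a witt" is "\<lambda>_. 0"
  by (simp add: derivation_iff)

lift_definition plus_witt :: "'a witt \<Rightarrow> 'a witt \<Rightarrow> 'a witt" is "\<lambda>D E p. D p + E p"
  by (simp add: derivation_iff algebra_simps)

lift_definition minus_witt :: "'a witt \<Rightarrow> 'a witt \<Rightarrow> 'a witt" is "\<lambda>D E p. D p - E p"
  by (simp add: derivation_iff algebra_simps)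

lift_definition uminus_witt :: "'a witt \<Rightarrow> 'a witt" is "\<lambda>D p. - D p"
  by (simp add: derivation_iff algebra_simps)

instance
  by standard (transfer; simp add: fun_eq_iff)+

end

lift_definition amult :: "'n::finite cpoly \<Rightarrow> 'n witt \<Rightarrow> 'n witt" (infixr \<open>\<cdot>\<^sub>A\<close> 75)
  is "\<lambda>a D p. a * D p"
  by (simp add: derivation_iff algebra_simps)

lift_definition partial :: "'n::finite \<Rightarrow> 'n witt" is part_deriv
  by (simp add: derivation_iff part_deriv_add part_deriv_mult part_deriv_Const)

lift_definition lie_bracket :: "'n::finite witt \<Rightarrow> 'n witt \<Rightarrow> 'n witt"
  is "\<lambda>D E p. D (E p) - E (D p)"
  subgoal for D E
    using derivation_0[of D] derivation_0[of E] by (simp add: derivation_iff algebra_simps)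
  done

definition wscale :: "complex \<Rightarrow> 'n::finite witt \<Rightarrow> 'n witt"
  where "wscale c D = Const c \<cdot>\<^sub>A D"

definition lie_ends :: "('n::finite witt \<Rightarrow> 'n witt) set"
  where "lie_ends = {\<phi>. Vector_Spaces.linear wscale wscale \<phi> \<and>
    (\<forall>D E. \<phi> (lie_bracket D E) = lie_bracket (\<phi> D) (\<phi> E))}"

definition lie_auts :: "('n::finite witt \<Rightarrow> 'n witt) set"
  where "lie_auts = {\<phi> \<in> lie_ends. bij \<phi>}"

definition End_W_nonzero :: "('n::finite witt \<Rightarrow> 'n witt) monoid"
  where "End_W_nonzero = \<lparr>carrier = lie_ends - {\<lambda>_. 0}, mult = (\<circ>), one = id\<rparr>"

definition Aut_W :: "('n::finite witt \<Rightarrow> 'n witt) monoid"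
  where "Aut_W = \<lparr>carrier = lie_auts, mult = (\<circ>), one = id\<rparr>"

text \<open>The linear map on the Witt algebra with \<open>x^k \<partial>\<^sub>j \<mapsto> g k j\<close> for all \<open>k\<close> and \<open>j\<close>;
  the coefficient of \<open>x^k \<partial>\<^sub>j\<close> in \<open>D\<close> is that of \<open>x^k\<close> in \<open>D(x\<^sub>j)\<close>.\<close>

definition lin_ext :: "(('n \<Rightarrow>\<^sub>0 nat) \<Rightarrow> 'n \<Rightarrow> 'n witt) \<Rightarrow> 'n::finite witt \<Rightarrow> 'n witt"
  where "lin_ext g D = (\<Sum>j\<in>UNIV. \<Sum>k\<in>Poly_Mapping.keys (der D (Var j)).
    wscale (Poly_Mapping.lookup (der D (Var j)) k) (g k j))"

lemma vector_space_wscale: "vector_space (wscale :: complex \<Rightarrow> 'n::finite witt \<Rightarrow> 'n witt)"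
  unfolding wscale_def
  by unfold_locales
    (transfer; simp add: Const_def fun_eq_iff algebra_simps single_add mult_single flip: mult.assoc)+

lemma linear_wscale_iff:
  fixes \<phi> :: "'n::finite witt \<Rightarrow> 'n witt"
  shows "Vector_Spaces.linear wscale wscale \<phi> \<longleftrightarrow>
    (\<forall>D E. \<phi> (D + E) = \<phi> D + \<phi> E) \<and> (\<forall>c D. \<phi> (wscale c D) = wscale c (\<phi> D))"
  using vector_space_wscale
  by (auto simp: linear_iff_module_hom module_hom_def module_hom_axioms_def
      module_iff_vector_space)

lemma der_add: "der (D + E) p = der D p + der E p"
  by transfer simp

lemma der_wscale: "der (wscale c D) p = Const c * der D p"
  unfolding wscale_def by transfer simp

lemma der_amult: "der (a \<cdot>\<^sub>A D) p = a * der D p"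
  by transfer simp

lemma der_partial: "der (partial i) = part_deriv i"
  by transfer simp

lemma der_0: "der 0 p = 0"
  by transfer simp

lemma der_sum: "der (\<Sum>i\<in>I. D i) p = (\<Sum>i\<in>I. der (D i) p)"
  by (induction I rule: infinite_finite_induct) (simp_all add: der_add der_0)

lemma der_mult: "der D (p * q) = der D p * q + p * der D q"
  by transfer (simp add: derivation_iff)

lemma der_poly_add: "der D (p + q) = der D p + der D q"
  by transfer (simp add: derivation_iff)

lemma der_Const_mult: "der D (Const c * p) = Const c * der D p"
  by transfer (simp add: derivation_iff)

lemma der_poly_0: "der D 0 = 0"
  using der_poly_add[of D 0 0] by simp

lemma der_1: "der D 1 = 0"
  using der_mult[of D 1 1] by simp

lemma der_eqI:
  assumes "\<And>j. der D (Var j) = der E (Var j)"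
  shows "D = E"
proof -
  have pow: "der D (Var j ^ m) = der E (Var j ^ m)" for j m
    by (induction m) (simp_all add: der_1 der_mult assms)
  have "der D (\<Prod>i\<in>I. Var i ^ k i) = der E (\<Prod>i\<in>I. Var i ^ k i)" if "finite I" for I k
    using that by induction (simp_all add: der_1 der_mult pow)
  then have "der D (mpow Var k) = der E (mpow Var k)" for k
    by (simp add: mpow_def)
  then have "der D p = der E p" for p
    by (induction p rule: cpoly_induct)
      (simp_all add: der_poly_0 der_poly_add single_eq_mpow_Var der_Const_mult)
  then show ?thesis by (auto simp: der_inject[symmetric])
qed

lemma witt_expand: "D = (\<Sum>j\<in>UNIV. der D (Var j) \<cdot>\<^sub>A partial j)"
  by (rule der_eqI) (simp add: der_sum der_amult der_partial part_deriv_Var if_distrib sum.delta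
      cong: if_cong)

lemma linear_lin_ext: "Vector_Spaces.linear wscale wscale (lin_ext g)"
proof -
  interpret vector_space "wscale :: complex \<Rightarrow> 'a witt \<Rightarrow> 'a witt" by (rule vector_space_wscale)
  have "lin_ext g (D + E) = lin_ext g D + lin_ext g E" for D E
    unfolding lin_ext_def der_add sum.distrib[symmetric]
    by (intro sum.cong refl setsum_keys_plus_distrib[where f = "\<lambda>k a. wscale a (g k _)"])
      (simp_all add: scale_left_distrib)
  moreover have "lin_ext g (wscale c D) = wscale c (lin_ext g D)" for c D
  proof (cases "c = 0")
    case True
    then show ?thesis
      by (simp add: lin_ext_def der_0)
  next
    case False
    have l: "Poly_Mapping.lookup (Const c * p) k = c * Poly_Mapping.lookup p k"
      for p :: "'a cpoly" and k
      unfolding Const_def mult_map_scale_conv_mult[symmetric]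
      by (simp add: Poly_Mapping.map.rep_eq when_def)
    have "Poly_Mapping.keys (Const c * p) = Poly_Mapping.keys p" for p :: "'a cpoly"
      using False by (auto simp: in_keys_iff l)
    then show ?thesis
      by (simp add: lin_ext_def der_wscale l scale_sum_right)
  qed
  ultimately show ?thesis by (simp add: linear_wscale_iff)
qed

lemma lin_ext_basis: "lin_ext g (mpow Var k \<cdot>\<^sub>A partial j) = g k j"
proof -
  interpret vector_space "wscale :: complex \<Rightarrow> 'a witt \<Rightarrow> 'a witt" by (rule vector_space_wscale)
  have m: "mpow Var k = (Poly_Mapping.single k 1 :: 'a cpoly)"
    using single_eq_mpow_Var[of k 1] by (simp add: Const_def)
  have "lin_ext g (mpow Var k \<cdot>\<^sub>A partial j) = (\<Sum>i\<in>UNIV. if j = i then g k i else 0)"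
    unfolding lin_ext_def
    by (intro sum.cong refl)
      (simp add: der_amult der_partial part_deriv_Var m)
  then show ?thesis by simp
qed

lemma lin_ext_unique:
  assumes "Vector_Spaces.linear wscale wscale \<phi>"
    and "\<And>k j. \<phi> (mpow Var k \<cdot>\<^sub>A partial j) = g k j"
  shows "\<phi> = lin_ext g"
proof
  fix D :: "'a witt"
  let ?\<psi> = "lin_ext g"
  have add: "\<phi> (D + E) = \<phi> D + \<phi> E" "?\<psi> (D + E) = ?\<psi> D + ?\<psi> E"
    and scale: "\<phi> (wscale c D) = wscale c (\<phi> D)" "?\<psi> (wscale c D) = wscale c (?\<psi> D)" for c D E
    using assms(1) linear_lin_ext[of g] unfolding linear_wscale_iff by blast+
  have zero: "\<phi> 0 = 0" "?\<psi> 0 = 0"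
    using add(1)[of 0 0] add(2)[of 0 0] by simp_all
  have "\<phi> (p \<cdot>\<^sub>A partial j) = ?\<psi> (p \<cdot>\<^sub>A partial j)" for p j
  proof (induction p rule: cpoly_induct)
    case zero
    have "0 \<cdot>\<^sub>A partial j = 0" by transfer simp
    then show ?case by (simp add: \<open>\<phi> 0 = 0\<close> \<open>?\<psi> 0 = 0\<close>)
  next
    case (add p k a)
    have "(p + Poly_Mapping.single k a) \<cdot>\<^sub>A partial j =
        p \<cdot>\<^sub>A partial j + wscale a (mpow Var k \<cdot>\<^sub>A partial j)"
      unfolding wscale_def single_eq_mpow_Var by transfer (simp add: algebra_simps)
    then show ?case
      using add by (simp add: \<open>\<And>D E. \<phi> (D + E) = \<phi> D + \<phi> E\<close> \<open>\<And>D E. ?\<psi> (D + E) = ?\<psi> D + ?\<psi> E\<close>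
          scale assms(2) lin_ext_basis)
  qed
  moreover have "\<phi> (\<Sum>i\<in>I. F i) = (\<Sum>i\<in>I. \<phi> (F i))" "?\<psi> (\<Sum>i\<in>I. F i) = (\<Sum>i\<in>I. ?\<psi> (F i))"
    for I and F :: "'a \<Rightarrow> 'a witt"
    by (induction I rule: infinite_finite_induct) (simp_all add: add zero)
  ultimately show "\<phi> D = ?\<psi> D"
    by (subst (1 2) witt_expand) simp
qed

lemma group_Aut_A: "group (Aut_A :: ('n cpoly \<Rightarrow> 'n cpoly) monoid)"
proof (rule groupI)
  fix \<tau> :: "'n cpoly \<Rightarrow> 'n cpoly"
  assume "\<tau> \<in> carrier Aut_A"
  then have \<tau>: "bij \<tau>" "\<And>c. \<tau> (Const c) = Const c"
    "\<And>p q. \<tau> (p + q) = \<tau> p + \<tau> q" "\<And>p q. \<tau> (p * q) = \<tau> p * \<tau> q"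
    by (auto simp: Aut_A_def alg_auts_def)
  note inv = inv_f_eq[OF bij_is_inj[OF \<open>bij \<tau>\<close>]] surj_f_inv_f[OF bij_is_surj[OF \<open>bij \<tau>\<close>]]
  have "Hilbert_Choice.inv \<tau> \<in> alg_auts"
    unfolding alg_auts_def using \<tau> by (auto simp: bij_imp_bij_inv inv(2) intro!: inv(1))
  moreover have "Hilbert_Choice.inv \<tau> \<circ> \<tau> = id"
    using \<tau>(1) by (simp add: bij_is_inj)
  ultimately show "\<exists>\<sigma>\<in>carrier Aut_A. \<sigma> \<otimes>\<^bsub>Aut_A\<^esub> \<tau> = \<one>\<^bsub>Aut_A\<^esub>"
    by (auto simp: Aut_A_def)
qed (auto simp: Aut_A_def alg_auts_def bij_comp)

lemma group_Aut_W: "group (Aut_W :: ('n::finite witt \<Rightarrow> 'n witt) monoid)"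
proof (rule groupI)
  fix \<phi> :: "'n witt \<Rightarrow> 'n witt"
  assume "\<phi> \<in> carrier Aut_W"
  then have \<phi>: "bij \<phi>" "\<And>D E. \<phi> (D + E) = \<phi> D + \<phi> E"
    "\<And>c D. \<phi> (wscale c D) = wscale c (\<phi> D)"
    "\<And>D E. \<phi> (lie_bracket D E) = lie_bracket (\<phi> D) (\<phi> E)"
    by (auto simp: Aut_W_def lie_auts_def lie_ends_def linear_wscale_iff)
  note inv = inv_f_eq[OF bij_is_inj[OF \<open>bij \<phi>\<close>]] surj_f_inv_f[OF bij_is_surj[OF \<open>bij \<phi>\<close>]]
  have "Hilbert_Choice.inv \<phi> \<in> lie_auts"
    unfolding lie_auts_def lie_ends_def linear_wscale_iff
    using \<phi> by (auto simp: bij_imp_bij_inv inv(2) intro!: inv(1))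
  moreover have "Hilbert_Choice.inv \<phi> \<circ> \<phi> = id"
    using \<phi>(1) by (simp add: bij_is_inj)
  ultimately show "\<exists>\<psi>\<in>carrier Aut_W. \<psi> \<otimes>\<^bsub>Aut_W\<^esub> \<phi> = \<one>\<^bsub>Aut_W\<^esub>"
    by (auto simp: Aut_W_def)
qed (auto simp: Aut_W_def lie_auts_def lie_ends_def linear_wscale_iff bij_comp)


section \<open>Jacobi tuples and their endomorphisms\<close>

definition jacobi_matrix :: "('n::finite \<Rightarrow> 'n cpoly) \<Rightarrow> 'n cpoly ^ 'n ^ 'n"
  where "jacobi_matrix f = (\<chi> i j. part_deriv j (f i))"

definition jacobian :: "('n::finite \<Rightarrow> 'n cpoly) \<Rightarrow> 'n cpoly"
  where "jacobian f = det (jacobi_matrix f)"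

definition jacobi_tuples :: "('n::finite \<Rightarrow> 'n cpoly) set"
  where "jacobi_tuples = {f. \<exists>c. c \<noteq> 0 \<and> jacobian f = Const c}"

definition JT :: "('n::finite \<Rightarrow> 'n cpoly) monoid"
  where "JT = \<lparr>carrier = jacobi_tuples, mult = (\<lambda>f g i. poly_subst f (g i)), one = Var\<rparr>"

text \<open>The index type carries no order, so row \<open>i\<close> and column \<open>j\<close> are deleted by overwriting them
  with zeros around a one in position \<open>(i, j)\<close>. Moving that one to the top left corner takes
  \<open>i + j - 2\<close> transpositions of adjacent rows and columns, so the determinant is the minor
  with the sign \<open>(-1)^(i + j)\<close> included, in every enumeration of the index type.\<close>

definition cofactor :: "'a::comm_ring_1 ^ 'n ^ 'n \<Rightarrow> 'n \<Rightarrow> 'n::finite \<Rightarrow> 'a"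
  where "cofactor M i j = det (\<chi> r s. if r = i \<and> s = j then 1
    else if r = i \<or> s = j then 0 else M $ r $ s)"

text \<open>For a Jacobi tuple, the constant coefficient of the Jacobi determinant is the
  determinant \<open>c\<close> itself.\<close>

definition theta :: "('n::finite \<Rightarrow> 'n cpoly) \<Rightarrow> 'n \<Rightarrow> 'n witt"
  where "theta f j = wscale (1 / Poly_Mapping.lookup (jacobian f) 0)
    (\<Sum>l\<in>UNIV. cofactor (jacobi_matrix f) j l \<cdot>\<^sub>A partial l)"

definition sigma :: "('n::finite \<Rightarrow> 'n cpoly) \<Rightarrow> 'n witt \<Rightarrow> 'n witt"
  where "sigma f = lin_ext (\<lambda>k j. mpow f k \<cdot>\<^sub>A theta f j)"

definition zeta :: "('n::finite cpoly \<Rightarrow> 'n cpoly) \<Rightarrow> 'n witt \<Rightarrow> 'n witt"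
  where "zeta \<tau> = sigma (\<lambda>i. \<tau> (Var i))"

lemma cofactor_row_unit:
  "cofactor M i j = det (\<chi> r. if r = i then axis j 1 else M $ r)"
proof -
  let ?A = "\<chi> r. if r = i then axis j 1 else M $ r"
  let ?v = "\<lambda>r. if r = i then 0 else - (M $ r $ j)"
  have "cofactor M i j = (\<Sum>p | p permutes UNIV. of_int (sign p) *
      (\<Prod>r\<in>UNIV. if r = i \<and> p r = j then 1 else if r = i \<or> p r = j then 0 else M $ r $ p r))"
    by (simp add: cofactor_def det_def)
  also have "\<dots> = (\<Sum>p | p permutes UNIV. of_int (sign p) * (\<Prod>r\<in>UNIV. ?A $ r $ p r))"
  proof (intro sum.cong refl arg_cong2[where f = "(*)"])
    fix p assume "p \<in> {p. p permutes (UNIV :: 'b set)}"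
    then have inj: "inj p" by (simp add: permutes_inj)
    show "(\<Prod>r\<in>UNIV. if r = i \<and> p r = j then 1 else if r = i \<or> p r = j then 0 else M $ r $ p r) =
        (\<Prod>r\<in>UNIV. ?A $ r $ p r)"
    proof (cases "p i = j")
      case True
      then have "p r = j \<longleftrightarrow> r = i" for r using inj by (auto dest: injD)
      then show ?thesis by (intro prod.cong refl) (auto simp: axis_def)
    next
      case False
      then show ?thesis
        by (intro trans[OF prod_zero prod_zero[symmetric]]) (auto simp: axis_def intro!: exI[of _ i])
    qed
  qed
  finally show ?thesis by (simp add: det_def)
qed

lemma cofactor_adjugate:
  "(\<Sum>l\<in>UNIV. cofactor M j l * M $ i $ l) = (if i = j then det M else 0)"
proof -
  have "(\<Sum>l\<in>UNIV. cofactor M j l * M $ i $ l) =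
      (\<Sum>l\<in>UNIV. det (\<chi> r. if r = j then M $ i $ l *s axis l 1 else M $ r))"
    by (simp add: cofactor_row_unit det_row_mul[of j] mult.commute)
  also have "\<dots> = det (\<chi> r. if r = j then (\<Sum>l\<in>UNIV. M $ i $ l *s axis l 1) else M $ r)"
    by (rule det_linear_row_sum[symmetric]) simp
  also have "(\<Sum>l\<in>UNIV. M $ i $ l *s axis l 1) = M $ i"
    by (simp add: vec_eq_iff axis_def if_distrib cong: if_cong)
  also have "det (\<chi> r. if r = j then M $ i else M $ r) = (if i = j then det M else 0)"
  proof (cases "i = j")
    case True
    then have "(\<chi> r. if r = j then M $ i else M $ r) = M" by (simp add: vec_eq_iff)
    with True show ?thesis by simp
  next
    case False
    then show ?thesis by (auto intro!: det_identical_rows[of i j] simp: row_def)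
  qed
  finally show ?thesis .
qed

lemma theta_tuple:
  assumes "f \<in> jacobi_tuples"
  shows "der (theta f j) (f i) = (if i = j then 1 else 0)"
proof -
  from assms obtain c where c: "c \<noteq> 0" "jacobian f = Const c"
    by (auto simp: jacobi_tuples_def)
  have "der (theta f j) (f i) =
      Const (1 / c) * (\<Sum>l\<in>UNIV. cofactor (jacobi_matrix f) j l * jacobi_matrix f $ i $ l)"
    by (simp add: theta_def der_wscale der_sum der_amult der_partial jacobi_matrix_def c Const_def)
  also have "\<dots> = (if i = j then Const (1 / c) * Const c else 0)"
    using c(2) by (simp add: cofactor_adjugate jacobian_def)
  also have "Const (1 / c) * Const c = 1"
    using c(1) by (simp add: Const_def mult_single)
  finally show ?thesis .
qed


section \<open>Generators in rank two\<close>

text \<open>The index type \<open>2\<close> has exactly the elements \<open>1\<close> and \<open>2\<close> (the latter being \<open>0\<close>).\<close>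

definition s_map :: "2 witt \<Rightarrow> 2 witt"
  where "s_map = lin_ext (\<lambda>k m. let i = Poly_Mapping.lookup k 1; j = Poly_Mapping.lookup k 2 in
    if m = 1 then (Var 2 ^ i * Var 1 ^ j) \<cdot>\<^sub>A partial 2
    else (Var 2 ^ i * Var 1 ^ j) \<cdot>\<^sub>A partial 1)"

definition tau_map :: "complex \<Rightarrow> 2 witt \<Rightarrow> 2 witt"
  where "tau_map a = lin_ext (\<lambda>k m. let i = Poly_Mapping.lookup k 1; j = Poly_Mapping.lookup k 2 in
    if m = 1 then wscale (a powi (int i - 1)) ((Var 1 ^ i * Var 2 ^ j) \<cdot>\<^sub>A partial 1)
    else wscale (a ^ i) ((Var 1 ^ i * Var 2 ^ j) \<cdot>\<^sub>A partial 2))"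

definition psi_map :: "nat \<Rightarrow> 2 witt \<Rightarrow> 2 witt"
  where "psi_map p = lin_ext (\<lambda>k m. let i = Poly_Mapping.lookup k 1; j = Poly_Mapping.lookup k 2 in
    if m = 1 then (Var 1 ^ i * (Var 2 + Var 1 ^ p) ^ j) \<cdot>\<^sub>A
      (partial 1 - (of_nat p * Var 1 ^ (p - 1)) \<cdot>\<^sub>A partial 2)
    else (Var 1 ^ i * (Var 2 + Var 1 ^ p) ^ j) \<cdot>\<^sub>A partial 2)"

end

theory Submission
  imports Defs "HOL-Computational_Algebra.Primes"
begin

text \<open>
  The theorem rests on two results: every nonzero endomorphism of the Witt algebra is \<open>\<sigma>\<^sub>f\<close> for some
  Jacobi tuple \<open>f\<close> (\<open>eq_sigma\<close>), and every automorphism of the polynomial algebra in two variables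
  is tame (\<open>alg_aut_tame\<close>, the theorem of Jung). The latter gives the generators of the
  automorphism group in rank two; the other claims follow from the former. Indeed, the
  substitution \<open>x\<^sub>i \<mapsto> f\<^sub>i\<close> intertwines \<open>D\<close> and \<open>\<sigma>\<^sub>f D\<close>, and this determines \<open>\<sigma>\<^sub>f D\<close>
  (\<open>sigma_intertwines\<close>), so \<open>\<sigma>\<close> respects brackets and products of tuples. The substitution by a Jacobi
  tuple is always injective, and \<open>\<sigma>\<^sub>f\<close> is bijective if and only if the substitution is surjective, that
  is, if the \<open>f\<^sub>i\<close> generate the polynomial algebra (\<open>bij_sigma_iff\<close>).

  Let \<open>\<phi>\<close> be a nonzero endomorphism. The images \<open>D\<^sub>i\<close> of the partial derivatives commute, and they are
  linearly independent over the polynomials: a shortest relation between them, bracketed with the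
  images of \<open>\<partial>\<^sub>i\<close>, \<open>x\<^sub>m \<partial>\<^sub>j\<close> and \<open>x\<^sub>m\<^sup>2 \<partial>\<^sub>j\<close>, leads to \<open>D\<^sub>j = 0\<close> (\<open>independent\<close>). So every derivation is a
  combination of the \<open>D\<^sub>i\<close> with rational functions as coefficients. If \<open>f\<^sub>l\<close> are the coefficients of
  the image \<open>E\<close> of the Euler derivation, then \<open>D\<^sub>i(f\<^sub>l) = \<delta>\<^sub>i\<^sub>l\<close>, and induction on \<open>|k|\<close> yields
  \<open>\<phi>(x^k \<partial>\<^sub>j) = f^k D\<^sub>j\<close>: the difference of both sides commutes with all \<open>D\<^sub>i\<close>, so it has constant coefficients,
  and it vanishes because such a combination has the wrong eigenvalue under the bracket with \<open>E\<close>
  (\<open>exists_fraction_tuple\<close>). Now all powers of \<open>f\<^sub>i\<close> times a fixed nonzero polynomial are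
  polynomials, so \<open>f\<^sub>i\<close> is one (\<open>dvd_if_powers_dvd\<close>). Rational functions appear in the proofs with an
  explicit common denominator \<open>d\<close>.

  For Jung's theorem, let \<open>n\<close> and \<open>m\<close> be the degrees in \<open>x\<^sub>2\<close> of the images \<open>X\<close> and \<open>Y\<close> of the variables under
  an automorphism. If \<open>n\<close> is zero, the automorphism is triangular. If \<open>n\<close> is positive and divides \<open>m\<close>,
  the constant Jacobi determinant makes the leading form of \<open>Y\<close> proportional to a power of that of \<open>X\<close>, and an
  elementary automorphism lowers \<open>m\<close> (\<open>lower_degree_step\<close>). That one of two positive degrees
  always divides the other is the heart of the matter (\<open>degrees_dvd\<close>); there, operators
  \<open>x\<^sub>2 \<partial>\<^sub>2 - b\<close> bound the cancellation that is possible between the leading forms.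
\<close>

section \<open>Polynomials and substitutions\<close>

lemma Const_0 [simp]: "Const 0 = 0" by (simp add: Const_def)
lemma Const_1 [simp]: "Const 1 = 1" by (simp add: Const_def)
lemma Const_add: "Const (a + b) = Const a + Const b" by (simp add: Const_def single_add)
lemma Const_mult: "Const (a * b) = Const a * Const b" by (simp add: Const_def mult_single)
lemma Const_minus: "Const (- a) = - Const a" by (simp add: Const_def single_uminus)
lemma Const_diff: "Const (a - b) = Const a - Const b"
  by (simp add: Const_def single_diff)
lemma Const_power: "Const (a ^ n) = Const a ^ n" by (induction n) (simp_all add: Const_mult)
lemma Const_of_nat: "Const (of_nat n) = of_nat n" by (simp add: Const_def)

lemma lookup_Const_mult [simp]: "Poly_Mapping.lookup (Const c * p) k = c * Poly_Mapping.lookup p k"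
  unfolding Const_def mult_map_scale_conv_mult[symmetric]
  by (simp add: Poly_Mapping.map.rep_eq when_def)

lemma lookup_Const_0 [simp]: "Poly_Mapping.lookup (Const c) 0 = c"
  by (simp add: Const_def)

lemma Const_eq_iff [simp]: "Const a = Const b \<longleftrightarrow> a = b"
  by (metis lookup_Const_0)

lemma Const_eq_0_iff [simp]: "Const a = 0 \<longleftrightarrow> a = 0"
  by (metis Const_0 Const_eq_iff)

lemma cpoly_alg_induct [case_names Const Var add mult]:
  fixes p :: "'n::finite cpoly"
  assumes C: "\<And>c. P (Const c)" and V: "\<And>i. P (Var i)"
    and A: "\<And>p q. P p \<Longrightarrow> P q \<Longrightarrow> P (p + q)" and M: "\<And>p q. P p \<Longrightarrow> P q \<Longrightarrow> P (p * q)"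
  shows "P p"
proof -
  have one: "P 1" using C[of 1] by simp
  have pow: "P (Var i ^ m)" for i m by (induction m) (auto intro: one V M)
  have "P (\<Prod>i\<in>I. Var i ^ k i)" if "finite I" for I k
    using that by induction (auto intro: one pow M)
  then have "P (mpow Var k)" for k by (simp add: mpow_def)
  then have s: "P (Poly_Mapping.single k a)" for k a by (simp add: single_eq_mpow_Var C M)
  have "P 0" using C[of 0] by simp
  then show ?thesis by (induction p rule: cpoly_induct) (auto intro: A s)
qed

lemma mpow_0 [simp]: "mpow f 0 = 1" by (simp add: mpow_def)

lemma mpow_add: "mpow f (k + l) = mpow f k * mpow f l"
  by (simp add: mpow_def lookup_add power_add prod.distrib)

lemma mpow_single: "mpow f (Poly_Mapping.single i m) = f i ^ m"
proof -
  have "mpow f (Poly_Mapping.single i m) = (\<Prod>j\<in>UNIV. if j = i then f i ^ m else 1)"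
    unfolding mpow_def by (intro prod.cong) (auto simp: lookup_single when_def)
  then show ?thesis by simp
qed

lemma poly_subst_single: "poly_subst f (Poly_Mapping.single k a) = Const a * mpow f k"
  by (cases "a = 0") (simp_all add: poly_subst_def)

lemma poly_subst_add: "poly_subst f (p + q) = poly_subst f p + poly_subst f q"
  unfolding poly_subst_def
  by (rule setsum_keys_plus_distrib[where f = "\<lambda>k a. Const a * mpow f k"])
    (simp_all add: Const_add algebra_simps)

lemma poly_subst_0 [simp]: "poly_subst f 0 = 0" by (simp add: poly_subst_def)

lemma poly_subst_Const [simp]: "poly_subst f (Const c) = Const c"
  unfolding Const_def[of c] poly_subst_single by (simp add: Const_def)

lemma poly_subst_1 [simp]: "poly_subst f 1 = 1"
  using poly_subst_Const[of f 1] by simp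

lemma poly_subst_Var [simp]: "poly_subst f (Var i) = f i"
  by (simp add: Var_def poly_subst_single mpow_single)

lemma poly_subst_mult: "poly_subst f (p * q) = poly_subst f p * poly_subst f q"
proof (induction p rule: cpoly_induct)
  case (add p k a)
  have "poly_subst f (Poly_Mapping.single k a * q) =
      poly_subst f (Poly_Mapping.single k a) * poly_subst f q"
    by (induction q rule: cpoly_induct)
      (simp_all add: poly_subst_add poly_subst_single mult_single Const_mult mpow_add algebra_simps)
  with add show ?case by (simp add: poly_subst_add algebra_simps)
qed simp

lemma poly_subst_diff: "poly_subst f (p - q) = poly_subst f p - poly_subst f q"
  using poly_subst_add[of f "p - q" q] by simp

lemma poly_subst_power: "poly_subst f (p ^ n) = poly_subst f p ^ n"
  by (induction n) (simp_all add: poly_subst_mult)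

lemma poly_subst_prod: "poly_subst f (\<Prod>i\<in>I. p i) = (\<Prod>i\<in>I. poly_subst f (p i))"
  by (induction I rule: infinite_finite_induct) (simp_all add: poly_subst_mult)

lemma poly_subst_sum: "poly_subst f (\<Sum>i\<in>I. p i) = (\<Sum>i\<in>I. poly_subst f (p i))"
  by (induction I rule: infinite_finite_induct) (simp_all add: poly_subst_add)

lemma poly_subst_mpow: "poly_subst f (mpow g k) = mpow (\<lambda>i. poly_subst f (g i)) k"
  by (simp add: mpow_def poly_subst_prod poly_subst_power)

lemma poly_subst_unique:
  assumes "\<And>c. h (Const c) = Const c" "\<And>p q. h (p + q) = h p + h q" "\<And>p q. h (p * q) = h p * h q"
  shows "h p = poly_subst (\<lambda>i. h (Var i)) p"
  by (induction p rule: cpoly_alg_induct) (simp_all add: assms poly_subst_add poly_subst_mult)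

lemma poly_subst_poly_subst: "poly_subst f (poly_subst g p) = poly_subst (\<lambda>i. poly_subst f (g i)) p"
  by (induction p rule: cpoly_alg_induct) (simp_all add: poly_subst_add poly_subst_mult)

lemma poly_subst_Var_id [simp]: "poly_subst Var p = p"
  by (induction p rule: cpoly_alg_induct) (simp_all add: poly_subst_add poly_subst_mult)

lemma der_Const: "der D (Const c) = 0"
  using der_Const_mult[of D c 1] by (simp add: der_1)

lemma der_diff: "der D (p - q) = der D p - der D q"
  using der_poly_add[of D "p - q" q] by simp

lemma part_deriv_diff: "part_deriv (i :: 'n::finite) (p - q) = part_deriv i p - part_deriv i q"
  using der_diff[of "partial i" p q] by (simp only: der_partial)

lemma der_poly_sum: "der D (\<Sum>i\<in>I. p i) = (\<Sum>i\<in>I. der D (p i))"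
  by (induction I rule: infinite_finite_induct) (simp_all add: der_poly_add der_poly_0)

lemma der_bracket: "der (lie_bracket D E) p = der D (der E p) - der E (der D p)"
  by transfer simp

lemma der_minus: "der (D - E) p = der D p - der E p"
  by transfer simp

lemma der_poly_subst:
  "der D (poly_subst f p) = (\<Sum>i\<in>UNIV. poly_subst f (part_deriv i p) * der D (f i))"
proof (induction p rule: cpoly_alg_induct)
  case (Var j)
  have "(\<Sum>i\<in>UNIV. poly_subst f (part_deriv i (Var j)) * der D (f i)) =
      (\<Sum>i\<in>UNIV. if i = j then der D (f i) else 0)"
    by (intro sum.cong) (auto simp: part_deriv_Var)
  then show ?case by simp
qed (simp_all add: der_Const part_deriv_Const der_poly_add part_deriv_add poly_subst_add der_mult
    part_deriv_mult poly_subst_mult algebra_simps sum.distrib sum_distrib_left)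

lemma der_expand: "der D p = (\<Sum>i\<in>UNIV. part_deriv i p * der D (Var i))"
  using der_poly_subst[of D Var p] by simp

text \<open>Monomials are eigenvectors of \<open>x\<^sub>i \<partial>\<^sub>i\<close>. This operator also preserves all weights below, so
  derivatives are often multiplied by \<open>x\<^sub>i\<close> in what follows.\<close>

lemma lookup_Var_part_deriv:
  "Poly_Mapping.lookup (Var i * part_deriv i p) k = of_nat (Poly_Mapping.lookup k i) * Poly_Mapping.lookup p k"
proof (induction p rule: cpoly_induct)
  case (add p l a)
  have "Poly_Mapping.single i 1 + (l - Poly_Mapping.single i 1) = l" if "Poly_Mapping.lookup l i \<noteq> 0"
    using that by (intro poly_mapping_eqI) (auto simp: lookup_add lookup_minus lookup_single when_def)
  then have "Var i * part_deriv i (Poly_Mapping.single l a) =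
      Poly_Mapping.single l (of_nat (Poly_Mapping.lookup l i) * a)"
    by (cases "Poly_Mapping.lookup l i = 0") (simp_all add: part_deriv_single Var_def mult_single)
  with add show ?case
    by (auto simp: part_deriv_add distrib_left lookup_add lookup_single when_def)
qed (simp add: part_deriv_0)

lemma all_part_deriv_0_imp_Const:
  assumes "\<And>i. part_deriv i p = 0"
  shows "p = Const (Poly_Mapping.lookup p 0)"
proof (rule poly_mapping_eqI)
  fix k
  show "Poly_Mapping.lookup p k = Poly_Mapping.lookup (Const (Poly_Mapping.lookup p 0)) k"
  proof (cases "k = 0")
    case False
    then obtain i where "Poly_Mapping.lookup k i \<noteq> 0"
      by (metis lookup_zero poly_mapping_eqI)
    moreover have "of_nat (Poly_Mapping.lookup k i) * Poly_Mapping.lookup p k = 0"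
      using lookup_Var_part_deriv[of i p k] assms by simp
    ultimately show ?thesis using False by (simp add: Const_def lookup_single)
  qed simp
qed

section \<open>Weights, leading monomials and divisibility\<close>

text \<open>Natural weights serve as degrees, real weights as a monomial order.\<close>

definition wt :: "('n::finite \<Rightarrow> 'o::linordered_semidom) \<Rightarrow> ('n \<Rightarrow>\<^sub>0 nat) \<Rightarrow> 'o"
  where "wt w k = (\<Sum>i\<in>UNIV. of_nat (Poly_Mapping.lookup k i) * w i)"

definition weight_le :: "('n::finite \<Rightarrow> 'o::linordered_semidom) \<Rightarrow> 'o \<Rightarrow> 'n cpoly \<Rightarrow> bool"
  where "weight_le w d p \<longleftrightarrow> (\<forall>k\<in>Poly_Mapping.keys p. wt w k \<le> d)"

definition weight_part :: "('n::finite \<Rightarrow> 'o::linordered_semidom) \<Rightarrow> 'o \<Rightarrow> 'n cpoly \<Rightarrow> 'n cpoly"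
  where "weight_part w d p = (\<Sum>k | k \<in> Poly_Mapping.keys p \<and> wt w k = d.
    Poly_Mapping.single k (Poly_Mapping.lookup p k))"

lemma wt_add: "wt w (k + l) = wt w k + wt w l"
  by (simp add: wt_def lookup_add distrib_right sum.distrib)

lemma wt_0 [simp]: "wt w 0 = 0" by (simp add: wt_def)

lemma wt_single: "wt w (Poly_Mapping.single i m) = of_nat m * w i"
proof -
  have "wt w (Poly_Mapping.single i m) = (\<Sum>j\<in>UNIV. if j = i then of_nat m * w i else 0)"
    unfolding wt_def by (intro sum.cong) (auto simp: lookup_single when_def)
  then show ?thesis by simp
qed

lemma lookup_weight_part: "Poly_Mapping.lookup (weight_part w d p) k = (if wt w k = d then Poly_Mapping.lookup p k else 0)"
proof -
  have "Poly_Mapping.lookup (weight_part w d p) k = (\<Sum>l | l \<in> Poly_Mapping.keys p \<and> wt w l = d.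
      if l = k then Poly_Mapping.lookup p k else 0)"
    unfolding weight_part_def lookup_sum by (intro sum.cong) (auto simp: lookup_single when_def)
  then show ?thesis by (simp add: in_keys_iff)
qed

lemma weight_part_add: "weight_part w d (p + q) = weight_part w d p + weight_part w d q"
  by (intro poly_mapping_eqI) (simp add: lookup_weight_part lookup_add)

lemma weight_part_0 [simp]: "weight_part w d 0 = 0"
  by (intro poly_mapping_eqI) (simp add: lookup_weight_part)

lemma weight_part_diff: "weight_part w d (p - q) = weight_part w d p - weight_part w d q"
  by (intro poly_mapping_eqI) (simp add: lookup_weight_part lookup_minus)

lemma weight_part_Const_mult: "weight_part w d (Const c * p) = Const c * weight_part w d p"
  by (intro poly_mapping_eqI) (simp add: lookup_weight_part)

lemma weight_part_sum: "weight_part w d (\<Sum>i\<in>I. p i) = (\<Sum>i\<in>I. weight_part w d (p i))"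
  by (induction I rule: infinite_finite_induct) (simp_all add: weight_part_add)

lemma weight_part_Var_part_deriv: "weight_part w d (Var i * part_deriv i p) = Var i * part_deriv i (weight_part w d p)"
  by (intro poly_mapping_eqI) (simp add: lookup_weight_part lookup_Var_part_deriv)

lemma weight_le_0 [simp]: "weight_le w d 0" by (simp add: weight_le_def)

lemma weight_le_diff: "weight_le w d p \<Longrightarrow> weight_le w d q \<Longrightarrow> weight_le w d (p - q)"
  using keys_diff[of p q] by (auto simp: weight_le_def)

lemma weight_le_mult: "weight_le w d p \<Longrightarrow> weight_le w e q \<Longrightarrow> weight_le w (d + e) (p * q)"
  using keys_mult[of p q] by (fastforce simp: weight_le_def wt_add intro: add_mono)

lemma weight_le_Const: "0 \<le> d \<Longrightarrow> weight_le w d (Const c)"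
  by (auto simp: weight_le_def Const_def)

lemma weight_le_Const_mult: "weight_le w d p \<Longrightarrow> weight_le w d (Const c * p)"
  using weight_le_mult[OF weight_le_Const[of 0 w c], of d p] by simp

lemma weight_le_power: "weight_le w d p \<Longrightarrow> weight_le w (of_nat n * d) (p ^ n)"
proof (induction n)
  case 0
  then show ?case using weight_le_Const[of 0 w 1] by simp
next
  case (Suc n)
  then show ?case using weight_le_mult[of w d p "of_nat n * d" "p ^ n"] by (simp add: algebra_simps)
qed

lemma weight_le_mono: "weight_le w d p \<Longrightarrow> d \<le> e \<Longrightarrow> weight_le w e p"
  by (auto simp: weight_le_def)

lemma weight_part_above: "weight_le w d p \<Longrightarrow> d < e \<Longrightarrow> weight_part w e p = 0"
proof (rule poly_mapping_eqI)
  fix k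
  assume "weight_le w d p" "d < e"
  then show "Poly_Mapping.lookup (weight_part w e p) k = Poly_Mapping.lookup 0 k"
    by (cases "k \<in> Poly_Mapping.keys p") (auto simp: lookup_weight_part weight_le_def in_keys_iff not_less[symmetric])
qed

text \<open>Only the parts of maximal weight of the factors reach the maximal weight of a product.\<close>

lemma weight_part_mult:
  fixes w :: "'n::finite \<Rightarrow> 'o::linordered_semidom"
  assumes "weight_le w d p" "weight_le w e q"
  shows "weight_part w (d + e) (p * q) = weight_part w d p * weight_part w e q"
proof -
  define p' q' where "p' = p - weight_part w d p" and "q' = q - weight_part w e q"
  have keys: "wt w a = d" if "a \<in> Poly_Mapping.keys (weight_part w d p)" for a
    using that by (auto simp: in_keys_iff lookup_weight_part split: if_splits)
  have keys2: "wt w a = e" if "a \<in> Poly_Mapping.keys (weight_part w e q)" for a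
    using that by (auto simp: in_keys_iff lookup_weight_part split: if_splits)
  have p': "wt w a < d" if "a \<in> Poly_Mapping.keys p'" for a
    using that assms(1)
    by (auto simp: p'_def in_keys_iff lookup_minus lookup_weight_part weight_le_def less_le split: if_splits)
  have q': "wt w a < e" if "a \<in> Poly_Mapping.keys q'" for a
    using that assms(2)
    by (auto simp: q'_def in_keys_iff lookup_minus lookup_weight_part weight_le_def less_le split: if_splits)
  have zero: "weight_part w (d + e) (a * b) = 0"
    if less: "\<And>k l. k \<in> Poly_Mapping.keys a \<Longrightarrow> l \<in> Poly_Mapping.keys b \<Longrightarrow> wt w k + wt w l < d + e" for a b
  proof (rule poly_mapping_eqI)
    fix k
    have "wt w k \<noteq> d + e" if kk: "k \<in> Poly_Mapping.keys (a * b)"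
    proof -
      obtain x y where "k = x + y" "x \<in> Poly_Mapping.keys a" "y \<in> Poly_Mapping.keys b"
        using keys_mult[of a b] kk by blast
      then show ?thesis using less[of x y] by (auto simp: wt_add)
    qed
    then show "Poly_Mapping.lookup (weight_part w (d + e) (a * b)) k = Poly_Mapping.lookup 0 k"
      by (auto simp: lookup_weight_part in_keys_iff)
  qed
  have "weight_part w (d + e) (weight_part w d p * weight_part w e q) = weight_part w d p * weight_part w e q"
  proof (rule poly_mapping_eqI)
    fix k
    have "wt w k = d + e" if kk: "k \<in> Poly_Mapping.keys (weight_part w d p * weight_part w e q)"
    proof -
      obtain x y where "k = x + y" "x \<in> Poly_Mapping.keys (weight_part w d p)" "y \<in> Poly_Mapping.keys (weight_part w e q)"
        using keys_mult[of "weight_part w d p" "weight_part w e q"] kk by blast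
      then show ?thesis by (simp add: wt_add keys keys2)
    qed
    then show "Poly_Mapping.lookup (weight_part w (d + e) (weight_part w d p * weight_part w e q)) k =
        Poly_Mapping.lookup (weight_part w d p * weight_part w e q) k"
      by (auto simp: lookup_weight_part in_keys_iff)
  qed
  moreover have "p * q = weight_part w d p * weight_part w e q + (weight_part w d p * q' + (p' * weight_part w e q + p' * q'))"
    by (simp add: p'_def q'_def algebra_simps)
  moreover have "weight_part w (d + e) (weight_part w d p * q') = 0" "weight_part w (d + e) (p' * weight_part w e q) = 0"
    "weight_part w (d + e) (p' * q') = 0"
    by (rule zero, simp add: keys keys2 p' q' add_strict_mono)+
  ultimately show ?thesis by (simp add: weight_part_add)
qed

lemma exists_leading_exponent:
  assumes "p \<noteq> 0"
  obtains k where "k \<in> Poly_Mapping.keys p" "weight_le w (wt w k) p"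
proof -
  have ne: "Poly_Mapping.keys p \<noteq> {}" using assms by simp
  then have "Max (wt w ` Poly_Mapping.keys p) \<in> wt w ` Poly_Mapping.keys p" by (intro Max_in) auto
  then obtain k where "k \<in> Poly_Mapping.keys p" "Max (wt w ` Poly_Mapping.keys p) = wt w k" by blast
  moreover have "wt w l \<le> Max (wt w ` Poly_Mapping.keys p)" if "l \<in> Poly_Mapping.keys p" for l
    using that by (intro Max_ge) auto
  ultimately show ?thesis using that[of k] by (auto simp: weight_le_def)
qed

text \<open>Take \<open>w\<^sub>i = ln q\<^sub>i\<close> for distinct primes \<open>q\<^sub>i\<close>. By unique factorization different exponents have
  different weights, so a nonzero polynomial has exactly one leading monomial. The numbers
  \<open>N k = \<Prod>q\<^sub>i ^ k\<^sub>i\<close> show that the order is a well-order.\<close>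

lemma monomial_order:
  "\<exists>(w :: 'n::finite \<Rightarrow> real) (N :: ('n \<Rightarrow>\<^sub>0 nat) \<Rightarrow> nat).
    inj (wt w) \<and> (\<forall>k l. wt w k < wt w l \<longleftrightarrow> N k < N l) \<and> (\<forall>i. w i > 0)"
proof -
  obtain e :: "'n \<Rightarrow> nat" where e: "inj e"
    using finite_imp_inj_to_nat_seg[of "UNIV :: 'n set"] by auto
  have "infinite {p::nat. prime p}" by (rule primes_infinite)
  then have P: "prime (enumerate {p::nat. prime p} i)" for i
    using enumerate_in_set by blast
  define q where "q i = enumerate {p::nat. prime p} (e i)" for i
  have q: "prime (q i)" for i by (simp add: q_def P)
  have injq: "inj q"
    using e \<open>infinite {p::nat. prime p}\<close>
    by (auto simp: q_def inj_def dest: strict_mono_enumerate[THEN strict_mono_eq, THEN iffD1])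
  define N where "N k = (\<Prod>i\<in>UNIV. q i ^ Poly_Mapping.lookup k i)" for k :: "'n \<Rightarrow>\<^sub>0 nat"
  define w where "w i = ln (real (q i))" for i
  have q1: "q i > 1" for i using q prime_gt_1_nat by blast
  then have q0: "q i > 0" for i using less_trans zero_less_one by blast
  then have N0: "N k > 0" for k by (simp add: N_def prod_pos)
  have wN: "wt w k = ln (real (N k))" for k
    using q0 by (simp add: wt_def N_def w_def ln_prod ln_realpow of_nat_prod)
  have mult: "multiplicity (q i) (N k) = Poly_Mapping.lookup k i" for i k
  proof -
    have "N k = (\<Prod>p\<in>range q. p ^ Poly_Mapping.lookup k (the_inv q p))"
      unfolding N_def using injq by (subst prod.reindex) (auto simp: the_inv_f_f)
    then have "multiplicity (q i) (N k) =
        multiplicity (q i) (\<Prod>p\<in>range q. p ^ Poly_Mapping.lookup k (the_inv q p))" by simp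
    also have "\<dots> = Poly_Mapping.lookup k i"
      by (subst multiplicity_prod_prime_powers) (use q injq in \<open>auto simp: the_inv_f_f\<close>)
    finally show ?thesis .
  qed
  have "inj N" by (rule injI, rule poly_mapping_eqI) (metis mult)
  then have "inj (wt w)"
    using N0 by (auto simp: wN inj_def)
  moreover have "w i > 0" for i using q1[of i] by (simp add: w_def)
  moreover have "wt w k < wt w l \<longleftrightarrow> N k < N l" for k l using N0 by (simp add: wN)
  ultimately show ?thesis by blast
qed

lemma weight_part_inj: "inj (wt w) \<Longrightarrow> weight_part w (wt w k) p = Poly_Mapping.single k (Poly_Mapping.lookup p k)"
  by (intro poly_mapping_eqI) (auto simp: lookup_weight_part lookup_single when_def inj_eq)

lemma lookup_mult_top:
  assumes "inj (wt w)" "weight_le w (wt w k) p" "weight_le w (wt w l) q"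
  shows "Poly_Mapping.lookup (p * q) (k + l) = Poly_Mapping.lookup p k * Poly_Mapping.lookup q l"
  using weight_part_mult[OF assms(2,3)] unfolding weight_part_inj[OF assms(1)] wt_add[symmetric] mult_single
  by (metis lookup_single_eq)

text \<open>The leading terms of two nonzero factors have a nonzero product, which is not cancelled.\<close>

lemma cpoly_mult_eq_0_iff [simp]:
  fixes p q :: "'n::finite cpoly"
  shows "p * q = 0 \<longleftrightarrow> p = 0 \<or> q = 0"
proof -
  have "p * q \<noteq> 0" if ne: "p \<noteq> 0" "q \<noteq> 0"
  proof -
    obtain w :: "'n \<Rightarrow> real" where w: "inj (wt w)" using monomial_order[where 'n = 'n] by blast
    obtain k where k: "k \<in> Poly_Mapping.keys p" "weight_le w (wt w k) p" by (rule exists_leading_exponent[OF ne(1)])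
    obtain l where l: "l \<in> Poly_Mapping.keys q" "weight_le w (wt w l) q" by (rule exists_leading_exponent[OF ne(2)])
    have "Poly_Mapping.lookup (p * q) (k + l) \<noteq> 0"
      using lookup_mult_top[OF w k(2) l(2)] k(1) l(1) by (simp add: in_keys_iff)
    then show ?thesis by auto
  qed
  then show ?thesis by auto
qed

lemma cpoly_power_eq_0_iff [simp]: "(p :: 'n::finite cpoly) ^ m = 0 \<longleftrightarrow> p = 0 \<and> m > 0"
  by (induction m) auto

lemma cpoly_mult_left_cancel:
  fixes p q r :: "'n::finite cpoly"
  assumes "p * q = p * r" "p \<noteq> 0"
  shows "q = r"
proof -
  have "p * (q - r) = 0" using assms by (simp add: algebra_simps)
  then show ?thesis using assms(2) by simp
qed

text \<open>The leading exponents of two mutually inverse polynomials add up to zero.\<close>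

lemma cpoly_unit_imp_Const:
  fixes p q :: "'n::finite cpoly"
  assumes "p * q = 1"
  shows "\<exists>c. c \<noteq> 0 \<and> p = Const c"
proof -
  obtain w :: "'n \<Rightarrow> real" and N where w: "inj (wt w)" "\<And>i. w i > 0" using monomial_order[where 'n = 'n] by blast
  have ne: "p \<noteq> 0" "q \<noteq> 0" using assms by auto
  obtain k where k: "k \<in> Poly_Mapping.keys p" "weight_le w (wt w k) p" by (rule exists_leading_exponent[OF ne(1)])
  obtain l where l: "l \<in> Poly_Mapping.keys q" "weight_le w (wt w l) q" by (rule exists_leading_exponent[OF ne(2)])
  have "Poly_Mapping.lookup (1 :: 'n cpoly) (k + l) \<noteq> 0"
    using lookup_mult_top[OF w(1) k(2) l(2)] k(1) l(1) assms by (simp add: in_keys_iff)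
  then have "k + l = 0" by (auto simp: lookup_one when_def split: if_splits)
  then have "k = 0" using lookup_add[of k l] by (intro poly_mapping_eqI) (metis add_is_0 lookup_zero)
  have nonneg: "wt w a \<ge> 0" for a unfolding wt_def using w(2) by (intro sum_nonneg) (simp add: less_imp_le)
  have "a = 0" if "a \<in> Poly_Mapping.keys p" for a
  proof -
    have "wt w a \<le> 0" using k(2) that \<open>k = 0\<close> by (auto simp: weight_le_def)
    then have "wt w a = wt w 0" using nonneg[of a] by simp
    then show ?thesis using w(1) by (meson injD)
  qed
  then have "p = Const (Poly_Mapping.lookup p 0)"
    by (intro poly_mapping_eqI) (auto simp: Const_def lookup_single when_def in_keys_iff)
  then show ?thesis using ne(1) by (metis Const_0)
qed

text \<open>A fraction \<open>g / e\<close> with vanishing derivatives is constant. Comparing the leading coefficients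
  in \<open>e (x\<^sub>i \<partial>\<^sub>i g) = g (x\<^sub>i \<partial>\<^sub>i e)\<close> shows that \<open>g\<close>, if nonzero, has the leading exponent of \<open>e\<close>.
  With \<open>c\<close> the quotient of the leading coefficients, \<open>g - c e\<close> satisfies the same relation without
  having this leading exponent, so it is zero.\<close>

lemma proportional_if_wronskian_0:
  fixes g e :: "'n::finite cpoly"
  assumes "e \<noteq> 0" and wr: "\<And>i. e * part_deriv i g = g * part_deriv i e"
  shows "\<exists>c. g = Const c * e"
proof -
  obtain w :: "'n \<Rightarrow> real" where w: "inj (wt w)" using monomial_order[where 'n = 'n] by blast
  obtain l where l: "l \<in> Poly_Mapping.keys e" "weight_le w (wt w l) e" by (rule exists_leading_exponent[OF assms(1)])
  have same: "weight_le w (wt w l) h \<and> Poly_Mapping.lookup h l \<noteq> 0"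
    if ne: "h \<noteq> 0" and wr: "\<And>i. e * part_deriv i h = h * part_deriv i e" for h
  proof -
    obtain k where k: "k \<in> Poly_Mapping.keys h" "weight_le w (wt w k) h" by (rule exists_leading_exponent[OF ne])
    have b: "weight_le w d (Var i * part_deriv i p)" if "weight_le w d p" for d i p
      using that by (auto simp: weight_le_def in_keys_iff lookup_Var_part_deriv)
    have "Poly_Mapping.lookup k i = Poly_Mapping.lookup l i" for i
    proof -
      have "e * (Var i * part_deriv i h) = (Var i * part_deriv i e) * h"
        using arg_cong[OF wr[of i], of "\<lambda>q. Var i * q"] by (simp add: mult_ac)
      then have "Poly_Mapping.lookup (e * (Var i * part_deriv i h)) (l + k) =
        Poly_Mapping.lookup ((Var i * part_deriv i e) * h) (l + k)" by simp
      then show ?thesis using k(1) l(1)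
        by (simp add: lookup_mult_top[OF w l(2) b[OF k(2)]] lookup_mult_top[OF w b[OF l(2)] k(2)]
            lookup_Var_part_deriv in_keys_iff)
    qed
    then have "k = l" by (rule poly_mapping_eqI)
    then show ?thesis using k by (simp add: in_keys_iff)
  qed
  define c where "c = Poly_Mapping.lookup g l / Poly_Mapping.lookup e l"
  define h where "h = g - Const c * e"
  have "e * part_deriv i h = h * part_deriv i e" for i
    using wr[of i]
    by (simp add: h_def part_deriv_diff part_deriv_mult part_deriv_Const right_diff_distrib
        left_diff_distrib mult_ac)
  moreover have "Poly_Mapping.lookup h l = 0"
    using l(1) by (simp add: h_def c_def lookup_minus in_keys_iff)
  ultimately have "h = 0" using same by blast
  then show ?thesis by (auto simp: h_def)
qed

text \<open>The polynomial ring is completely integrally closed: a fraction \<open>g / d\<close> is a polynomial if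
  all of its powers have a common denominator \<open>a\<close>. The leading exponents satisfy
  \<open>m lead(d) \<le> lead(a) + m lead(g)\<close> for all \<open>m\<close>, hence \<open>lead(d) \<le> lead(g)\<close>. So the leading term
  of \<open>g\<close> can be cancelled by a multiple \<open>q d\<close>, and by the binomial theorem \<open>g - q d\<close> inherits
  the hypothesis.\<close>

lemma dvd_if_powers_dvd:
  fixes a d g :: "'n::finite cpoly"
  assumes "a \<noteq> 0" "d \<noteq> 0" "\<And>m. d ^ m dvd a * g ^ m"
  shows "d dvd g"
proof -
  obtain w :: "'n \<Rightarrow> real" and N where w: "inj (wt w)" "\<And>k l. wt w k < wt w l \<longleftrightarrow> N k < (N l :: nat)"
    using monomial_order[where 'n = 'n] by blast
  obtain ka where ka: "ka \<in> Poly_Mapping.keys a" "weight_le w (wt w ka) a" by (rule exists_leading_exponent[OF assms(1)])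
  obtain kd where kd: "kd \<in> Poly_Mapping.keys d" "weight_le w (wt w kd) d" by (rule exists_leading_exponent[OF assms(2)])
  define lead where "lead k p \<longleftrightarrow> k \<in> Poly_Mapping.keys p \<and> weight_le w (wt w k) p" for k and p :: "'n cpoly"
  have lead_mult: "lead (k + l) (p * q)" if "lead k p" "lead l q" for k l p q
    using that lookup_mult_top[OF w(1), of k p l q] weight_le_mult[of w "wt w k" p "wt w l" q]
    by (auto simp: lead_def in_keys_iff wt_add)
  have lead_unique: "k = l" if "lead k p" "lead l p" for k l p
    using that w(1) by (auto simp: lead_def weight_le_def intro!: injD[OF w(1)] order_antisym)
  have lead_power: "\<exists>l. lead l (p ^ m) \<and> (\<forall>i. Poly_Mapping.lookup l i = m * Poly_Mapping.lookup k i)"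
    if "lead k p" for k p m
  proof (induction m)
    case 0
    show ?case by (rule exI[of _ 0]) (auto simp: lead_def weight_le_def simp flip: single_one)
  next
    case (Suc m)
    then obtain l where "lead l (p ^ m)" "\<forall>i. Poly_Mapping.lookup l i = m * Poly_Mapping.lookup k i" by blast
    with lead_mult[OF that this(1)] show ?case
      by (intro exI[of _ "k + l"]) (simp add: lookup_add)
  qed
  have "d dvd g" if "g = 0 \<or> lead k g" "\<And>m. d ^ m dvd a * g ^ m" for g k
    using that
  proof (induction "N k" arbitrary: g k rule: less_induct)
    case less
    show ?case
    proof (cases "g = 0")
      case False
      then have k: "lead k g" using less.prems(1) by blast
      have le: "Poly_Mapping.lookup kd i \<le> Poly_Mapping.lookup k i" for i
      proof (rule ccontr)
        assume "\<not> ?thesis"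
        then have lt: "Poly_Mapping.lookup k i + 1 \<le> Poly_Mapping.lookup kd i" by simp
        \<comment> \<open>With this \<open>m\<close> the \<open>i\<close>-th exponent of \<open>a\<close> is too small to make up for a deficit of \<open>m\<close>.\<close>
        define m where "m = Poly_Mapping.lookup ka i + 1"
        obtain h where h: "a * g ^ m = d ^ m * h" using less.prems(2)[of m] by (auto elim: dvdE)
        have "h \<noteq> 0" using h False assms(1) by auto
        then obtain kh where kh: "lead kh h" unfolding lead_def by (metis exists_leading_exponent)
        obtain l1 where l1: "lead l1 (g ^ m)" "\<And>i. Poly_Mapping.lookup l1 i = m * Poly_Mapping.lookup k i"
          using lead_power[OF k, of m] by blast
        obtain l2 where l2: "lead l2 (d ^ m)" "\<And>i. Poly_Mapping.lookup l2 i = m * Poly_Mapping.lookup kd i"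
          using lead_power[of kd d m] kd by (auto simp: lead_def)
        have "lead (ka + l1) (a * g ^ m)" "lead (l2 + kh) (d ^ m * h)"
          using lead_mult ka l1(1) l2(1) kh by (auto simp: lead_def)
        then have "ka + l1 = l2 + kh" using lead_unique h by metis
        then have "Poly_Mapping.lookup (ka + l1) i = Poly_Mapping.lookup (l2 + kh) i" by simp
        then have "Poly_Mapping.lookup ka i + m * Poly_Mapping.lookup k i \<ge> m * Poly_Mapping.lookup kd i"
          by (simp add: lookup_add l1(2) l2(2))
        moreover have "m * Poly_Mapping.lookup kd i \<ge> m * (Poly_Mapping.lookup k i + 1)"
          using lt by (rule mult_le_mono2)
        ultimately show False by (simp add: m_def)
      qed
      define q where "q = Poly_Mapping.single (k - kd) (Poly_Mapping.lookup g k / Poly_Mapping.lookup d kd)"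
      have kkd: "k - kd + kd = k"
        using le by (intro poly_mapping_eqI) (simp add: lookup_add lookup_minus)
      have q: "weight_le w (wt w (k - kd)) q" by (simp add: q_def weight_le_def)
      define g' where "g' = g - q * d"
      have qd: "weight_le w (wt w k) (q * d)"
        using weight_le_mult[OF q kd(2)] by (simp add: kkd flip: wt_add)
      have "Poly_Mapping.lookup (q * d) k = Poly_Mapping.lookup g k"
        using lookup_mult_top[OF w(1) q kd(2)] kd(1) by (simp add: kkd q_def in_keys_iff)
      then have "Poly_Mapping.lookup g' k = 0" by (simp add: g'_def lookup_minus)
      have "weight_le w (wt w k) g'"
        unfolding g'_def using k qd by (intro weight_le_diff) (auto simp: lead_def)
      have small: "N l < N k" if "l \<in> Poly_Mapping.keys g'" for l
      proof -
        have "wt w l \<le> wt w k" "l \<noteq> k" using that \<open>weight_le w (wt w k) g'\<close>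
            \<open>Poly_Mapping.lookup g' k = 0\<close> by (auto simp: weight_le_def in_keys_iff)
        then have "wt w l < wt w k" using w(1) by (simp add: less_le inj_eq)
        then show ?thesis by (simp add: w(2))
      qed
      have pow: "d ^ m dvd a * g' ^ m" for m
      proof -
        have "a * g' ^ m = (\<Sum>j\<le>m. of_nat (m choose j) * (a * g ^ j) * (- (q * d)) ^ (m - j))"
          using binomial_ring[of g "- (q * d)" m] by (simp add: g'_def sum_distrib_left mult_ac)
        moreover have "d ^ m dvd of_nat (m choose j) * (a * g ^ j) * (- (q * d)) ^ (m - j)" if "j \<le> m" for j
        proof -
          have "d ^ j * d ^ (m - j) dvd (a * g ^ j) * (- (q * d)) ^ (m - j)"
            using less.prems(2)[of j] by (intro mult_dvd_mono dvd_power_same) auto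
          then show ?thesis using that by (simp add: mult.assoc flip: power_add)
        qed
        ultimately show ?thesis by (auto intro!: dvd_sum)
      qed
      have "d dvd g'"
      proof (cases "g' = 0")
        case False
        then obtain l where l: "lead l g'" unfolding lead_def by (metis exists_leading_exponent)
        then have "N l < N k" using small by (simp add: lead_def)
        then show ?thesis using less.hyps[of l g'] l pow by blast
      qed simp
      then have "d dvd g' + q * d" by (intro dvd_add) auto
      then show ?thesis by (simp add: g'_def)
    qed simp
  qed
  moreover have "\<exists>k. g = 0 \<or> lead k g" unfolding lead_def by (metis exists_leading_exponent)
  ultimately show ?thesis using assms(3) by blast
qed

text \<open>Fraction-free Gaussian elimination: a pivot row \<open>i0\<close> clears the column \<open>j\<close>, and a relation
  between the remaining rows determines the coefficient of the pivot row.\<close>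

lemma exists_linear_relation:
  fixes v :: "'i \<Rightarrow> 'j \<Rightarrow> 'n::finite cpoly"
  assumes "finite J" "finite I" "card J < card I"
  shows "\<exists>x. (\<exists>i\<in>I. x i \<noteq> 0) \<and> (\<forall>j\<in>J. (\<Sum>i\<in>I. x i * v i j) = 0)"
  using assms
proof (induction J arbitrary: I v rule: finite_induct)
  case empty
  then have "I \<noteq> {}" by auto
  then show ?case by (intro exI[of _ "\<lambda>_. 1"]) auto
next
  case (insert j J)
  show ?case
  proof (cases "\<forall>i\<in>I. v i j = 0")
    case True
    have "\<exists>x. (\<exists>i\<in>I. x i \<noteq> 0) \<and> (\<forall>j\<in>J. (\<Sum>i\<in>I. x i * v i j) = 0)"
      using insert by (intro insert.IH) auto
    then show ?thesis using True by auto
  next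
    case False
    then obtain i0 where i0: "i0 \<in> I" "v i0 j \<noteq> 0" by blast
    define I' where "I' = I - {i0}"
    have I': "finite I'" "I = insert i0 I'" "i0 \<notin> I'" using i0(1) insert.prems by (auto simp: I'_def)
    define u where "u i t = v i0 j * v i t - v i j * v i0 t" for i t
    have "\<exists>x. (\<exists>i\<in>I'. x i \<noteq> 0) \<and> (\<forall>t\<in>J. (\<Sum>i\<in>I'. x i * u i t) = 0)"
      using insert I' by (intro insert.IH) auto
    then obtain x where x: "\<exists>i\<in>I'. x i \<noteq> 0" "\<And>t. t \<in> J \<Longrightarrow> (\<Sum>i\<in>I'. x i * u i t) = 0" by blast
    \<comment> \<open>The entry at the pivot row is forced, since each \<open>u i\<close> contains \<open>- v i j\<close> times this row.\<close>
    define y where "y i = (if i = i0 then - (\<Sum>l\<in>I'. x l * v l j) else x i * v i0 j)" for i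
    have sum: "(\<Sum>i\<in>I. y i * v i t) = (\<Sum>i\<in>I'. x i * u i t)" for t
    proof -
      have "(\<Sum>i\<in>I'. y i * v i t) = (\<Sum>i\<in>I'. x i * v i0 j * v i t)"
        using I'(3) by (intro sum.cong) (auto simp: y_def)
      then show ?thesis using I'
        by (simp add: y_def u_def algebra_simps sum_subtractf sum_distrib_left)
    qed
    have "(\<Sum>i\<in>I. y i * v i t) = 0" if "t \<in> insert j J" for t
      using that x(2) unfolding sum by (auto simp: u_def)
    moreover have "\<exists>i\<in>I. y i \<noteq> 0" using x(1) I' i0(2) by (auto simp: y_def)
    ultimately show ?thesis by blast
  qed
qed

section \<open>Jacobi tuples and their endomorphisms\<close>

lemma lookup_single_mult:
  fixes p :: "'n cpoly"
  shows "Poly_Mapping.lookup (Poly_Mapping.single k a * p) (k + l) = a * Poly_Mapping.lookup p l"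
  by (induction p rule: cpoly_induct)
    (simp_all add: distrib_left lookup_add mult_single lookup_single when_def)

text \<open>Together with \<open>cofactor_adjugate\<close> this makes the adjugate matrix a two-sided inverse up to the
  determinant.\<close>

lemma cofactor_adjugate_col:
  "(\<Sum>i\<in>UNIV. cofactor M i j * M $ i $ l) = (if l = j then det M else 0)"
proof -
  have "cofactor (transpose M) j i = cofactor M i j" for i
    unfolding cofactor_def
    by (subst det_transpose[symmetric]) (rule arg_cong[where f = det], auto simp: vec_eq_iff transpose_def)
  with cofactor_adjugate[of "transpose M" j l] show ?thesis
    by (simp add: transpose_def det_transpose[unfolded transpose_def])
qed

text \<open>The coordinates of a derivation that vanishes on all \<open>f\<^sub>i\<close> are in the kernel of the Jacobi
  matrix, which is invertible.\<close>

lemma jacobi_tuple_derivation_eqI: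
  fixes f :: "'n::finite \<Rightarrow> 'n cpoly"
  assumes f: "f \<in> jacobi_tuples" and eq: "\<And>i. der D (f i) = der E (f i)"
  shows "D = E"
proof (rule der_eqI)
  fix j
  let ?M = "jacobi_matrix f"
  obtain c where c: "c \<noteq> 0" "jacobian f = Const c" using f by (auto simp: jacobi_tuples_def)
  define v where "v l = der D (Var l) - der E (Var l)" for l
  have v: "(\<Sum>l\<in>UNIV. ?M $ i $ l * v l) = 0" for i
    using eq[of i] unfolding der_expand[of D "f i"] der_expand[of E "f i"]
    by (simp add: jacobi_matrix_def v_def right_diff_distrib sum_subtractf)
  have "0 = (\<Sum>i\<in>UNIV. cofactor ?M i j * (\<Sum>l\<in>UNIV. ?M $ i $ l * v l))" by (simp add: v)
  also have "\<dots> = (\<Sum>i\<in>UNIV. \<Sum>l\<in>UNIV. cofactor ?M i j * ?M $ i $ l * v l)"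
    by (simp add: sum_distrib_left mult.assoc)
  also have "\<dots> = (\<Sum>l\<in>UNIV. (\<Sum>i\<in>UNIV. cofactor ?M i j * ?M $ i $ l) * v l)"
    by (subst sum.swap) (simp add: sum_distrib_right)
  also have "\<dots> = (\<Sum>l\<in>UNIV. if l = j then jacobian f * v l else 0)"
    unfolding cofactor_adjugate_col by (intro sum.cong) (auto simp: jacobian_def)
  finally have "v j = 0" using c by simp
  then show "der D (Var j) = der E (Var j)" by (simp add: v_def)
qed

text \<open>Derivations dual to \<open>f\<close> form an inverse of the Jacobi matrix, so the Jacobi determinant is a
  unit of the polynomial ring, that is, a nonzero constant.\<close>

lemma jacobi_tupleI:
  fixes f :: "'n::finite \<Rightarrow> 'n cpoly"
  assumes "\<And>i j. der (D j) (f i) = (if i = j then 1 else 0)"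
  shows "f \<in> jacobi_tuples"
proof -
  define B where "B = (\<chi> l j. der (D j) (Var l))"
  have "jacobi_matrix f ** B = mat 1"
    by (simp add: vec_eq_iff matrix_matrix_mult_def jacobi_matrix_def B_def mat_def assms flip: der_expand)
  then have "jacobian f * det B = 1"
    using det_mul[of "jacobi_matrix f" B] by (simp add: jacobian_def)
  then show ?thesis using cpoly_unit_imp_Const by (auto simp: jacobi_tuples_def)
qed

lemma theta_eqI:
  assumes "f \<in> jacobi_tuples" "\<And>i. der D (f i) = (if i = j then 1 else 0)"
  shows "theta f j = D"
  by (rule jacobi_tuple_derivation_eqI[OF assms(1)]) (simp add: theta_tuple assms)

lemma theta_poly_subst:
  assumes "f \<in> jacobi_tuples"
  shows "der (theta f j) (poly_subst f p) = poly_subst f (part_deriv j p)"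
proof -
  have "der (theta f j) (poly_subst f p) = (\<Sum>i\<in>UNIV. if i = j then poly_subst f (part_deriv i p) else 0)"
    unfolding der_poly_subst by (intro sum.cong) (auto simp: theta_tuple assms)
  then show ?thesis by simp
qed

lemma sigma_eq: "sigma f D = (\<Sum>j\<in>UNIV. poly_subst f (der D (Var j)) \<cdot>\<^sub>A theta f j)"
  by (rule der_eqI) (simp add: sigma_def lin_ext_def der_sum der_amult der_wscale poly_subst_def
      sum_distrib_right mult.assoc)

lemma sigma_partial: "sigma f (p \<cdot>\<^sub>A partial j) = poly_subst f p \<cdot>\<^sub>A theta f j"
proof -
  have "sigma f (p \<cdot>\<^sub>A partial j) = (\<Sum>i\<in>UNIV. if i = j then poly_subst f p \<cdot>\<^sub>A theta f i else 0)"
    unfolding sigma_eq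
  proof (intro sum.cong refl)
    fix i
    have "0 \<cdot>\<^sub>A theta f i = 0" by (rule der_eqI) (simp add: der_amult der_0)
    then show "poly_subst f (der (p \<cdot>\<^sub>A partial j) (Var i)) \<cdot>\<^sub>A theta f i =
        (if i = j then poly_subst f p \<cdot>\<^sub>A theta f i else 0)"
      by (auto simp: der_amult der_partial part_deriv_Var)
  qed
  then show ?thesis by simp
qed

lemma one_amult [simp]: "1 \<cdot>\<^sub>A D = D" by transfer simp

text \<open>The substitution \<open>x\<^sub>i \<mapsto> f\<^sub>i\<close> intertwines \<open>D\<close> and \<open>\<sigma>\<^sub>f D\<close>. As derivations are determined by their
  values on a Jacobi tuple, this characterizes \<open>\<sigma>\<^sub>f D\<close>, and all identities for \<open>\<sigma>\<^sub>f\<close> follow from it.\<close>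

lemma sigma_intertwines:
  assumes "f \<in> jacobi_tuples"
  shows "der (sigma f D) (poly_subst f p) = poly_subst f (der D p)"
  by (simp add: sigma_eq der_sum der_amult theta_poly_subst assms der_expand[of D p] poly_subst_sum
      poly_subst_mult mult.commute)

lemma sigma_eqI:
  assumes "f \<in> jacobi_tuples" "\<And>i. der E (f i) = poly_subst f (der D (Var i))"
  shows "sigma f D = E"
  by (rule jacobi_tuple_derivation_eqI[OF assms(1)])
    (use sigma_intertwines[OF assms(1), of D "Var _"] in \<open>simp add: assms(2)\<close>)

lemma sigma_lie_end:
  assumes f: "f \<in> jacobi_tuples"
  shows "sigma f \<in> lie_ends"
proof -
  have "sigma f (lie_bracket D E) = lie_bracket (sigma f D) (sigma f E)" for D E
    by (rule sigma_eqI[OF f])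
      (use sigma_intertwines[OF f, of _ "Var _"] in
        \<open>simp add: der_bracket sigma_intertwines[OF f] poly_subst_diff\<close>)
  then show ?thesis by (simp add: lie_ends_def sigma_def linear_lin_ext)
qed

lemma theta_nonzero:
  assumes "f \<in> jacobi_tuples"
  shows "theta f j \<noteq> 0"
  using theta_tuple[OF assms, of j j] by (auto simp: der_0)

lemma sigma_nonzero:
  assumes f: "f \<in> jacobi_tuples"
  shows "sigma f \<noteq> (\<lambda>_. 0)"
proof
  assume "sigma f = (\<lambda>_. 0)"
  then show False using sigma_partial[of f 1 undefined] theta_nonzero[OF f, of undefined] by simp
qed

lemma sigma_comp:
  assumes f: "f \<in> jacobi_tuples" and g: "g \<in> jacobi_tuples"
  shows "(\<lambda>i. poly_subst f (g i)) \<in> jacobi_tuples"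
    and "sigma (\<lambda>i. poly_subst f (g i)) = sigma f \<circ> sigma g"
proof -
  show h: "(\<lambda>i. poly_subst f (g i)) \<in> jacobi_tuples"
    by (rule jacobi_tupleI[of "\<lambda>j. sigma f (theta g j)"])
      (simp add: sigma_intertwines f theta_tuple g)
  show "sigma (\<lambda>i. poly_subst f (g i)) = sigma f \<circ> sigma g"
  proof
    fix D
    show "sigma (\<lambda>i. poly_subst f (g i)) D = (sigma f \<circ> sigma g) D"
      by (rule sigma_eqI[OF h])
        (use sigma_intertwines[OF g, of _ "Var _"] in
          \<open>simp add: sigma_intertwines f flip: poly_subst_poly_subst\<close>)
  qed
qed

text \<open>The tuple can be read off: \<open>\<theta>\<^sub>j\<close> is the image of \<open>\<partial>\<^sub>j\<close>, and \<open>f\<^sub>j\<close> is its coefficient in the image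
  \<open>f\<^sub>j \<theta>\<^sub>j\<close> of \<open>x\<^sub>j \<partial>\<^sub>j\<close>.\<close>

lemma inj_on_sigma: "inj_on sigma jacobi_tuples"
proof (rule inj_onI)
  fix f g :: "'a \<Rightarrow> 'a cpoly"
  assume f: "f \<in> jacobi_tuples" and g: "g \<in> jacobi_tuples" and eq: "sigma f = sigma g"
  have theta: "theta f j = theta g j" for j
    using sigma_partial[of f 1 j] sigma_partial[of g 1 j] eq by simp
  have "f j \<cdot>\<^sub>A theta f j = g j \<cdot>\<^sub>A theta f j" for j
    using sigma_partial[of f "Var j" j] sigma_partial[of g "Var j" j] eq theta by simp
  then have "f j * der (theta f j) (f j) = g j * der (theta f j) (f j)" for j
    by (metis der_amult)
  then show "f = g" by (simp add: theta_tuple f fun_eq_iff)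
qed

text \<open>The kernel of a substitution by a Jacobi tuple is stable under the partial derivatives,
  so a nonzero element of it of least degree would be a nonzero constant.\<close>

lemma inj_poly_subst:
  fixes f :: "'n::finite \<Rightarrow> 'n cpoly"
  assumes f: "f \<in> jacobi_tuples"
  shows "inj (poly_subst f)"
proof -
  define w :: "'n \<Rightarrow> nat" where "w = (\<lambda>_. 1)"
  have "p = 0" if "weight_le w d p" "poly_subst f p = 0" for p d
    using that
  proof (induction d arbitrary: p)
    case (0 p)
    have "k = 0" if "k \<in> Poly_Mapping.keys p" for k
      using 0(1) that by (intro poly_mapping_eqI) (auto simp: weight_le_def wt_def w_def)
    then have "p = Const (Poly_Mapping.lookup p 0)"
      by (intro poly_mapping_eqI) (auto simp: Const_def lookup_single when_def in_keys_iff)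
    then show ?case using 0(2) by (metis poly_subst_Const)
  next
    case (Suc d p)
    have "part_deriv i p = 0" for i
    proof (rule Suc.IH)
      show "poly_subst f (part_deriv i p) = 0"
        using theta_poly_subst[OF f, of i p] Suc.prems(2) by (simp add: der_poly_0)
      show "weight_le w d (part_deriv i p)"
        unfolding weight_le_def
      proof
        fix k assume "k \<in> Poly_Mapping.keys (part_deriv i p)"
        moreover have "Poly_Mapping.lookup (Var i * part_deriv i p) (Poly_Mapping.single i 1 + k) =
            Poly_Mapping.lookup (part_deriv i p) k"
          unfolding Var_def lookup_single_mult by simp
        ultimately have "Poly_Mapping.single i 1 + k \<in> Poly_Mapping.keys p"
          by (auto simp: lookup_Var_part_deriv in_keys_iff)
        then have "wt w (Poly_Mapping.single i 1 + k) \<le> Suc d"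
          using Suc.prems(1) by (simp add: weight_le_def)
        then show "wt w k \<le> d" by (simp add: wt_add wt_single w_def)
      qed
    qed
    then have "p = Const (Poly_Mapping.lookup p 0)" by (rule all_part_deriv_0_imp_Const)
    then show ?case using Suc.prems(2) by (metis poly_subst_Const)
  qed
  moreover have "\<exists>d. weight_le w d p" for p
    using exists_leading_exponent[of p w] weight_le_0 by metis
  ultimately have "p = 0" if "poly_subst f p = 0" for p using that by blast
  then show ?thesis
    by (intro injI) (metis eq_iff_diff_eq_0 poly_subst_diff)
qed

text \<open>In the coordinates \<open>D x\<^sub>i\<close> of \<open>D\<close> and \<open>(\<sigma>\<^sub>f D) f\<^sub>i\<close> of the image, \<open>\<sigma>\<^sub>f\<close> is the substitution
  \<open>x\<^sub>i \<mapsto> f\<^sub>i\<close>, which is injective for every Jacobi tuple.\<close>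

lemma bij_sigma_iff:
  assumes f: "f \<in> jacobi_tuples"
  shows "bij (sigma f) \<longleftrightarrow> surj (poly_subst f)"
proof
  assume bij: "bij (sigma f)"
  show "surj (poly_subst f)"
    unfolding surj_def
  proof
    fix p
    obtain j :: 'a where True by blast
    obtain D where D: "p \<cdot>\<^sub>A theta f j = sigma f D" using bij by (metis bij_pointE)
    have "p = der (p \<cdot>\<^sub>A theta f j) (f j)" by (simp add: der_amult theta_tuple f)
    also have "\<dots> = poly_subst f (der D (Var j))"
      using sigma_intertwines[OF f, of D "Var j"] D by simp
    finally show "\<exists>q. p = poly_subst f q" by blast
  qed
next
  assume surj: "surj (poly_subst f)"
  have "inj (sigma f)"
  proof (rule injI)
    fix D E assume "sigma f D = sigma f E"
    then have "poly_subst f (der D (Var j)) = poly_subst f (der E (Var j))" for j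
      using sigma_intertwines[OF f, of _ "Var j"] by metis
    then show "D = E" by (intro der_eqI) (metis inj_poly_subst[OF f] injD)
  qed
  moreover have "\<exists>D. E = sigma f D" for E
  proof -
    have "\<exists>q. der E (f i) = poly_subst f q" for i using surj by (simp add: surj_def)
    then obtain q where q: "\<And>i. der E (f i) = poly_subst f (q i)" by metis
    define D where "D = (\<Sum>i\<in>UNIV. q i \<cdot>\<^sub>A partial i)"
    have "der D (Var i) = q i" for i
      by (simp add: D_def der_sum der_amult der_partial part_deriv_Var if_distrib cong: if_cong)
    then have "sigma f D = E" by (intro sigma_eqI[OF f]) (simp add: q)
    then show ?thesis by blast
  qed
  ultimately show "bij (sigma f)" unfolding bij_def surj_def by blast
qed

lemma subalgebra_hull_range: "subalgebra hull range f = range (poly_subst f)"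
proof (rule hull_unique)
  show "range f \<subseteq> range (poly_subst f)" by (metis image_subsetI poly_subst_Var rangeI)
  show "subalgebra (range (poly_subst f))"
    unfolding subalgebra_def
  proof (intro conjI)
    show "range Const \<subseteq> range (poly_subst f)" by (metis image_subsetI poly_subst_Const rangeI)
  qed (auto simp flip: poly_subst_add poly_subst_mult)
  fix S assume S: "range f \<subseteq> S" "subalgebra S"
  have "poly_subst f p \<in> S" for p
    by (induction p rule: cpoly_alg_induct)
      (use S in \<open>auto simp: subalgebra_def poly_subst_add poly_subst_mult\<close>)
  then show "range (poly_subst f) \<subseteq> S" by blast
qed

section \<open>Automorphisms of the polynomial algebra\<close>

lemma alg_aut_eq_poly_subst:
  assumes "\<tau> \<in> alg_auts"
  shows "\<tau> = poly_subst (\<lambda>i. \<tau> (Var i))"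
  by (rule ext, rule poly_subst_unique) (use assms in \<open>auto simp: alg_auts_def\<close>)

text \<open>The conjugates \<open>\<tau> \<circ> \<partial>\<^sub>j \<circ> \<tau>\<^sup>-\<^sup>1\<close> are derivations dual to the tuple.\<close>

lemma alg_aut_jacobi_tuple:
  fixes \<tau> :: "'n::finite cpoly \<Rightarrow> 'n cpoly"
  assumes "\<tau> \<in> alg_auts"
  shows "(\<lambda>i. \<tau> (Var i)) \<in> jacobi_tuples"
proof -
  let ?\<rho> = "Hilbert_Choice.inv \<tau>"
  have \<tau>: "bij \<tau>" "\<And>c. \<tau> (Const c) = Const c" "\<And>p q. \<tau> (p + q) = \<tau> p + \<tau> q"
    "\<And>p q. \<tau> (p * q) = \<tau> p * \<tau> q"
    using assms by (auto simp: alg_auts_def)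
  have inv: "?\<rho> (\<tau> p) = p" "\<tau> (?\<rho> p) = p" for p
    using \<tau>(1) by (simp_all add: bij_is_inj bij_is_surj surj_f_inv_f)
  have \<rho>: "?\<rho> (Const c) = Const c" "?\<rho> (p + q) = ?\<rho> p + ?\<rho> q" "?\<rho> (p * q) = ?\<rho> p * ?\<rho> q" for c p q
    by (metis inv \<tau>(2-4))+
  have "\<tau> 0 = 0" using \<tau>(2)[of 0] by simp
  have d: "derivation (\<tau> \<circ> part_deriv j \<circ> ?\<rho>)" for j
    by (simp add: derivation_iff \<rho> part_deriv_add part_deriv_mult part_deriv_Const \<tau> inv \<open>\<tau> 0 = 0\<close>)
  have "\<tau> 1 = 1" using \<tau>(2)[of 1] by simp
  show ?thesis
    by (rule jacobi_tupleI[of "\<lambda>j. Abs_witt (\<tau> \<circ> part_deriv j \<circ> ?\<rho>)"])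
      (simp add: Abs_witt_inverse d inv part_deriv_Var \<open>\<tau> 0 = 0\<close> \<open>\<tau> 1 = 1\<close>)
qed

lemma poly_subst_alg_aut:
  assumes "f \<in> jacobi_tuples" "surj (poly_subst f)"
  shows "poly_subst f \<in> alg_auts"
  using assms inj_poly_subst[OF assms(1)]
  by (simp add: alg_auts_def bij_def poly_subst_add poly_subst_mult)

lemma zeta_lie_aut:
  assumes "\<tau> \<in> alg_auts"
  shows "zeta \<tau> \<in> lie_auts"
proof -
  let ?f = "\<lambda>i. \<tau> (Var i)"
  have "surj (poly_subst ?f)"
    using assms alg_aut_eq_poly_subst[OF assms] by (auto simp: alg_auts_def bij_def)
  then show ?thesis
    using alg_aut_jacobi_tuple[OF assms] bij_sigma_iff sigma_lie_end
    by (auto simp: zeta_def lie_auts_def)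
qed

lemma zeta_comp:
  assumes "\<tau> \<in> alg_auts" "\<rho> \<in> alg_auts"
  shows "zeta (\<tau> \<circ> \<rho>) = zeta \<tau> \<circ> zeta \<rho>"
proof -
  have "\<tau> (\<rho> (Var i)) = poly_subst (\<lambda>i. \<tau> (Var i)) (\<rho> (Var i))" for i
    by (rule fun_cong[OF alg_aut_eq_poly_subst[OF assms(1)]])
  then show ?thesis
    using sigma_comp(2)[OF alg_aut_jacobi_tuple[OF assms(1)] alg_aut_jacobi_tuple[OF assms(2)]]
    by (simp add: zeta_def)
qed

lemma inj_on_zeta: "inj_on zeta alg_auts"
proof (rule inj_onI)
  fix \<tau> \<rho> :: "'a cpoly \<Rightarrow> 'a cpoly"
  assume \<tau>: "\<tau> \<in> alg_auts" and \<rho>: "\<rho> \<in> alg_auts" and "zeta \<tau> = zeta \<rho>"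
  then have "sigma (\<lambda>i. \<tau> (Var i)) = sigma (\<lambda>i. \<rho> (Var i))" by (simp add: zeta_def)
  then have eq: "(\<lambda>i. \<tau> (Var i)) = (\<lambda>i. \<rho> (Var i))"
    by (rule inj_onD[OF inj_on_sigma _ alg_aut_jacobi_tuple[OF \<tau>] alg_aut_jacobi_tuple[OF \<rho>]])
  show "\<tau> = \<rho>"
    by (rule trans[OF alg_aut_eq_poly_subst[OF \<tau>] trans[OF _ alg_aut_eq_poly_subst[OF \<rho>, symmetric]]])
      (simp only: eq)
qed

section \<open>Nonzero endomorphisms of the Witt algebra\<close>

definition mdeg :: "('n::finite \<Rightarrow>\<^sub>0 nat) \<Rightarrow> nat"
  where "mdeg k = (\<Sum>i\<in>UNIV. Poly_Mapping.lookup k i)"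

definition euler :: "'n::finite witt"
  where "euler = (\<Sum>i\<in>UNIV. Var i \<cdot>\<^sub>A partial i)"

lemma mpow_Var_eq_single: "mpow Var k = Poly_Mapping.single k 1"
  using single_eq_mpow_Var[of k 1] by simp

lemma part_deriv_mpow_Var: "part_deriv i (mpow Var k) =
    of_nat (Poly_Mapping.lookup k i) * mpow Var (k - Poly_Mapping.single i 1)"
  unfolding mpow_Var_eq_single part_deriv_single
  by (simp add: single_eq_mpow_Var[of _ "of_nat _"] Const_of_nat mpow_Var_eq_single)

lemma der_euler_Var: "der euler (Var i) = Var i"
  by (simp add: euler_def der_sum der_amult der_partial part_deriv_Var if_distrib cong: if_cong)

lemma der_euler_mpow_Var: "der euler (mpow Var k) = of_nat (mdeg k) * mpow Var k"
proof (rule poly_mapping_eqI)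
  fix l
  have "Poly_Mapping.lookup (of_nat (mdeg k) * mpow Var k) l = of_nat (mdeg k) * Poly_Mapping.lookup (mpow Var k) l"
    by (metis Const_of_nat lookup_Const_mult)
  then show "Poly_Mapping.lookup (der euler (mpow Var k)) l = Poly_Mapping.lookup (of_nat (mdeg k) * mpow Var k) l"
    by (cases "k = l")
      (simp_all add: euler_def der_sum der_amult der_partial lookup_sum lookup_Var_part_deriv mdeg_def
        mpow_Var_eq_single lookup_single)
qed

lemma bracket_partial_monomial: "lie_bracket (partial i) (mpow Var k \<cdot>\<^sub>A partial j) =
    wscale (of_nat (Poly_Mapping.lookup k i)) (mpow Var (k - Poly_Mapping.single i 1) \<cdot>\<^sub>A partial j)"
  by (rule der_eqI) (auto simp: der_bracket der_amult der_wscale der_partial part_deriv_Var der_1[of "partial _", unfolded der_partial]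
      part_deriv_0 part_deriv_mult part_deriv_mpow_Var Const_of_nat)

lemma bracket_euler_monomial: "lie_bracket euler (mpow Var k \<cdot>\<^sub>A partial j) =
    wscale (of_nat (mdeg k) - 1) (mpow Var k \<cdot>\<^sub>A partial j)"
proof (rule der_eqI)
  fix i
  show "der (lie_bracket euler (mpow Var k \<cdot>\<^sub>A partial j)) (Var i) =
      der (wscale (of_nat (mdeg k) - 1) (mpow Var k \<cdot>\<^sub>A partial j)) (Var i)"
    by (auto simp: der_bracket der_amult der_wscale der_partial part_deriv_Var der_euler_Var
        der_euler_mpow_Var der_poly_0 Const_diff Const_of_nat algebra_simps)
qed

lemma der_mpow: "der V (mpow g k) = (\<Sum>l\<in>UNIV. of_nat (Poly_Mapping.lookup k l) *
    mpow g (k - Poly_Mapping.single l 1) * der V (g l))"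
proof -
  have "mpow g k = poly_subst g (mpow Var k)" by (simp add: poly_subst_mpow)
  moreover have "poly_subst g (part_deriv l (mpow Var k)) =
      of_nat (Poly_Mapping.lookup k l) * mpow g (k - Poly_Mapping.single l 1)" for l
    by (simp add: part_deriv_mpow_Var poly_subst_mult poly_subst_mpow flip: Const_of_nat)
  ultimately show ?thesis by (simp add: der_poly_subst)
qed

lemma mpow_minus_single: "of_nat (Poly_Mapping.lookup k l) * mpow g (k - Poly_Mapping.single l 1) * g l =
    of_nat (Poly_Mapping.lookup k l) * mpow g k"
proof (cases "Poly_Mapping.lookup k l = 0")
  case False
  then have "k - Poly_Mapping.single l 1 + Poly_Mapping.single l 1 = k"
    by (intro poly_mapping_eqI) (auto simp: lookup_add lookup_minus lookup_single when_def)
  then have "mpow g k = mpow g (k - Poly_Mapping.single l 1) * g l"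
    using mpow_add[of g "k - Poly_Mapping.single l 1" "Poly_Mapping.single l 1"] by (simp only: mpow_single power_one_right)
  then show ?thesis by (simp add: mult.assoc)
qed simp

lemma mpow_scaled: "mpow (\<lambda>i. d * f i) k = d ^ mdeg k * mpow f k"
  by (simp add: mpow_def mdeg_def power_mult_distrib prod.distrib power_sum)

lemma der_power_Suc: "der V (d ^ Suc m) = of_nat (Suc m) * d ^ m * der V d"
proof (induction m)
  case (Suc m)
  then show ?case unfolding power_Suc[of d "Suc m"] der_mult by (simp add: algebra_simps)
qed simp

lemma der_power: "d * der V (d ^ m) = of_nat m * d ^ m * der V d"
  by (cases m) (simp_all add: der_1 der_power_Suc algebra_simps del: power_Suc of_nat_Suc, simp add: algebra_simps)

lemma mdeg_single: "mdeg (Poly_Mapping.single i m) = m"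
  using wt_single[of "\<lambda>_. 1 :: nat" i m] by (simp add: mdeg_def wt_def)

lemma mdeg_add: "mdeg (k + l) = mdeg k + mdeg l"
  by (simp add: mdeg_def lookup_add sum.distrib)

text \<open>Throughout, \<open>D\<^sub>i\<close>, \<open>X\<^sub>k\<^sub>j\<close> and \<open>E\<close> are the images of \<open>\<partial>\<^sub>i\<close>, of \<open>x^k \<partial>\<^sub>j\<close> and of the Euler derivation.
  Identities between derivations are evaluated at a polynomial \<open>q\<close>, which turns them into
  identities in a commutative ring.\<close>

locale nonzero_lie_end =
  fixes \<phi> :: "'n::finite witt \<Rightarrow> 'n witt"
  assumes lie_end: "\<phi> \<in> lie_ends" and nonzero: "\<phi> \<noteq> (\<lambda>_. 0)"
begin

lemma linear: "Vector_Spaces.linear wscale wscale \<phi>"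
  using lie_end by (simp add: lie_ends_def)

lemma \<phi>_scale: "\<phi> (wscale c V) = wscale c (\<phi> V)"
  using linear by (simp add: linear_wscale_iff)

lemma \<phi>_bracket: "\<phi> (lie_bracket V W) = lie_bracket (\<phi> V) (\<phi> W)"
  using lie_end by (simp add: lie_ends_def)

definition D :: "'n \<Rightarrow> 'n witt" where "D i = \<phi> (partial i)"

definition X :: "('n \<Rightarrow>\<^sub>0 nat) \<Rightarrow> 'n \<Rightarrow> 'n witt" where "X k j = \<phi> (mpow Var k \<cdot>\<^sub>A partial j)"

definition E :: "'n witt" where "E = \<phi> euler"

lemma X_0: "X 0 j = D j" by (simp add: X_def D_def)

lemma D_X: "der (D i) (der (X k j) q) = der (X k j) (der (D i) q) +
    of_nat (Poly_Mapping.lookup k i) * der (X (k - Poly_Mapping.single i 1) j) q"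
proof -
  have "lie_bracket (D i) (X k j) = wscale (of_nat (Poly_Mapping.lookup k i)) (X (k - Poly_Mapping.single i 1) j)"
    unfolding D_def X_def by (simp only: bracket_partial_monomial \<phi>_scale flip: \<phi>_bracket)
  from arg_cong[OF this, of "\<lambda>V. der V q"] show ?thesis
    by (simp add: der_bracket der_wscale Const_of_nat algebra_simps)
qed

lemma E_X: "der E (der (X k j) q) = der (X k j) (der E q) + (of_nat (mdeg k) - 1) * der (X k j) q"
proof -
  have "lie_bracket E (X k j) = wscale (of_nat (mdeg k) - 1) (X k j)"
    unfolding E_def X_def by (simp only: bracket_euler_monomial \<phi>_scale flip: \<phi>_bracket)
  from arg_cong[OF this, of "\<lambda>V. der V q"] show ?thesis
    by (simp add: der_bracket der_wscale Const_diff Const_of_nat algebra_simps)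
qed

lemma D_D: "der (D i) (der (D j) q) = der (D j) (der (D i) q)"
  using D_X[of i 0 j q] by (simp add: X_0)

lemma E_D: "der E (der (D j) q) = der (D j) (der E q) - der (D j) q"
  using E_X[of 0 j q] by (simp add: X_0 mdeg_def)

text \<open>The bracket \<open>[\<partial>\<^sub>l, x^(k + e\<^sub>l) \<partial>\<^sub>i]\<close> is a nonzero multiple of \<open>x^k \<partial>\<^sub>i\<close>, so an endomorphism that kills
  one \<open>\<partial>\<^sub>l\<close> kills everything.\<close>

lemma D_nonzero: "D j \<noteq> 0"
proof
  assume D0: "D j = 0"
  have bracket_0: "lie_bracket 0 V = 0" for V :: "'n witt"
    by (rule der_eqI) (simp add: der_bracket der_0 der_poly_0)
  have zero: "V = 0" if "wscale (of_nat (Suc m)) V = 0" for V :: "'n witt" and m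
  proof (rule der_eqI)
    fix i
    have "Const (of_nat (Suc m)) * der V (Var i) = 0" using that by (metis der_wscale der_0)
    then show "der V (Var i) = der 0 (Var i)" by (simp add: der_0 del: of_nat_Suc)
  qed
  have step: "X k i = 0" if "D l = 0" for k i l
  proof -
    have "lie_bracket (D l) (X (k + Poly_Mapping.single l 1) i) =
        wscale (of_nat (Suc (Poly_Mapping.lookup k l))) (X k i)"
      unfolding D_def X_def \<phi>_bracket[symmetric] bracket_partial_monomial \<phi>_scale
      by (simp add: lookup_add)
    then show ?thesis using that zero by (simp add: bracket_0 del: of_nat_Suc)
  qed
  have "\<phi> = lin_ext (\<lambda>_ _. 0)"
    by (rule lin_ext_unique[OF linear]) (use step[OF D0] in \<open>simp add: X_def\<close>)
  moreover have "(\<lambda>_. 0) = (lin_ext (\<lambda>_ _. 0) :: 'n witt \<Rightarrow> 'n witt)"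
  proof (rule lin_ext_unique)
    have "wscale c 0 = (0 :: 'n witt)" for c by (rule der_eqI) (simp add: der_wscale der_0)
    then show "Vector_Spaces.linear wscale wscale (\<lambda>_ :: 'n witt. 0 :: 'n witt)"
      by (simp add: linear_wscale_iff)
  qed simp
  ultimately show False using nonzero by simp
qed

text \<open>Consider a nontrivial relation \<open>\<Sum>p\<^sub>l D\<^sub>l = 0\<close> of minimal support and \<open>m\<close> in its support. Bracketing
  with \<open>D\<^sub>i\<close> and minimality give \<open>p\<^sub>m D\<^sub>i(p\<^sub>l) = p\<^sub>l D\<^sub>i(p\<^sub>m)\<close>. Bracketing with the image \<open>Z\<close> of
  \<open>x\<^sub>m\<^sup>2 \<partial>\<^sub>j\<close>, which commutes with \<open>D\<^sub>l\<close> for \<open>l \<noteq> m\<close>, expresses \<open>p\<^sub>m Y\<close> by the \<open>D\<^sub>l\<close>, where \<open>Y\<close> is the image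
  of \<open>x\<^sub>m \<partial>\<^sub>j\<close>. So \<open>p\<^sub>m Y(p\<^sub>l) = p\<^sub>l Y(p\<^sub>m)\<close> as well. But bracketing with \<open>Y\<close> expresses \<open>p\<^sub>m D\<^sub>j\<close> as
  \<open>\<Sum>Y(p\<^sub>l) D\<^sub>l\<close>, which is thus proportional to the relation and vanishes.\<close>

lemma independent:
  assumes "\<And>q. (\<Sum>l\<in>UNIV. p l * der (D l) q) = 0"
  shows "p = (\<lambda>_. 0)"
proof (rule ccontr)
  define rel where "rel p \<longleftrightarrow> (\<forall>q. (\<Sum>l\<in>UNIV. p l * der (D l) q) = 0)" for p
  assume "p \<noteq> (\<lambda>_. 0)"
  moreover have "rel p" using assms by (simp add: rel_def)
  ultimately obtain p where p: "rel p" "p \<noteq> (\<lambda>_. 0)"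
    and min: "\<And>r. rel r \<Longrightarrow> r \<noteq> (\<lambda>_. 0) \<Longrightarrow> card {l. p l \<noteq> 0} \<le> card {l. r l \<noteq> 0}"
    using ex_has_least_nat[of "\<lambda>p. rel p \<and> p \<noteq> (\<lambda>_. 0)" p "\<lambda>p. card {l. p l \<noteq> 0}"] by blast
  obtain m where m: "p m \<noteq> 0" using p(2) by auto
  have rel0: "(\<Sum>l\<in>UNIV. p l * der (D l) q) = 0" for q using p(1) by (simp add: rel_def)
  have bracket: "(\<Sum>l\<in>UNIV. p l * (der (D l) (der V q) - der V (der (D l) q))) =
      (\<Sum>l\<in>UNIV. der V (p l) * der (D l) q)" for V q
  proof -
    have "0 = der V (\<Sum>l\<in>UNIV. p l * der (D l) q)" by (simp add: rel0 der_poly_0)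
    also have "\<dots> = (\<Sum>l\<in>UNIV. der V (p l) * der (D l) q) + (\<Sum>l\<in>UNIV. p l * der V (der (D l) q))"
      by (simp add: der_poly_sum der_mult sum.distrib)
    finally have "(\<Sum>l\<in>UNIV. p l * der V (der (D l) q)) = - (\<Sum>l\<in>UNIV. der V (p l) * der (D l) q)"
      by (simp add: eq_neg_iff_add_eq_0 add.commute)
    then show ?thesis by (simp add: right_diff_distrib sum_subtractf rel0)
  qed
  have ratio: "p m * der (D i) (p l) = p l * der (D i) (p m)" for i l
  proof -
    \<comment> \<open>A relation of smaller support, because \<open>p\<^sub>m\<close> is eliminated.\<close>
    define r where "r l = p m * der (D i) (p l) - der (D i) (p m) * p l" for l
    have "rel r"
      unfolding rel_def
    proof
      fix q
      have "(\<Sum>l\<in>UNIV. der (D i) (p l) * der (D l) q) = 0"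
        using bracket[of "D i" q] by (simp add: D_D[of i])
      then have "p m * (\<Sum>l\<in>UNIV. der (D i) (p l) * der (D l) q) -
          der (D i) (p m) * (\<Sum>l\<in>UNIV. p l * der (D l) q) = 0" using rel0 by simp
      then show "(\<Sum>l\<in>UNIV. r l * der (D l) q) = 0"
        by (simp add: r_def left_diff_distrib sum_subtractf sum_distrib_left mult.assoc)
    qed
    moreover have "card {l. r l \<noteq> 0} < card {l. p l \<noteq> 0}"
    proof (rule psubset_card_mono)
      have "r m = 0" by (simp add: r_def)
      moreover have "r l = 0" if "p l = 0" for l using that by (simp add: r_def der_poly_0)
      ultimately show "{l. r l \<noteq> 0} \<subset> {l. p l \<noteq> 0}" using m by blast
    qed simp
    ultimately have "r = (\<lambda>_. 0)" using min[of r] by fastforce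
    then have "r l = 0" by simp
    then show ?thesis by (simp add: r_def mult.commute)
  qed
  fix j :: 'n
  define Y where "Y = X (Poly_Mapping.single m 1) j"
  define Z where "Z = X (Poly_Mapping.single m 2) j"
  have two: "Poly_Mapping.single m 2 - Poly_Mapping.single m 1 = Poly_Mapping.single m (1::nat)"
    by (simp flip: single_diff)
  have Z: "p m * (2 * der Y q) = (\<Sum>l\<in>UNIV. der Z (p l) * der (D l) q)" for q
  proof -
    have "(\<Sum>l\<in>UNIV. p l * (der (D l) (der Z q) - der Z (der (D l) q))) =
        (\<Sum>l\<in>UNIV. if l = m then p m * (2 * der Y q) else 0)"
      by (intro sum.cong) (auto simp: Z_def D_X Y_def two lookup_single simp del: One_nat_def)
    then show ?thesis using bracket[of Z q] by simp
  qed
  have Y: "p m * der (D j) q = (\<Sum>l\<in>UNIV. der Y (p l) * der (D l) q)" for q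
  proof -
    have "(\<Sum>l\<in>UNIV. p l * (der (D l) (der Y q) - der Y (der (D l) q))) =
        (\<Sum>l\<in>UNIV. if l = m then p m * der (D j) q else 0)"
      by (intro sum.cong) (auto simp: D_X Y_def lookup_single X_0 simp del: One_nat_def)
    then show ?thesis using bracket[of Y q] by simp
  qed
  have Yprop: "p m * der Y (p t) = p t * der Y (p m)" for t
  proof -
    have "p m * 2 * (p m * der Y (p t)) = p m * (\<Sum>l\<in>UNIV. der Z (p l) * der (D l) (p t))"
      using Z[of "p t"] by (simp add: mult_ac)
    also have "\<dots> = (\<Sum>l\<in>UNIV. der Z (p l) * (p m * der (D l) (p t)))"
      by (simp add: sum_distrib_left mult_ac)
    also have "\<dots> = p t * (\<Sum>l\<in>UNIV. der Z (p l) * der (D l) (p m))"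
      unfolding ratio by (simp add: sum_distrib_left mult_ac)
    also have "\<dots> = p m * 2 * (p t * der Y (p m))"
      unfolding Z[symmetric] by (simp add: mult_ac)
    finally show ?thesis by (rule cpoly_mult_left_cancel) (simp add: m)
  qed
  have "der (D j) q = 0" for q
  proof -
    have "p m * (p m * der (D j) q) = (\<Sum>l\<in>UNIV. (p m * der Y (p l)) * der (D l) q)"
      unfolding Y by (simp add: sum_distrib_left mult_ac)
    also have "\<dots> = der Y (p m) * (\<Sum>l\<in>UNIV. p l * der (D l) q)"
      unfolding Yprop by (simp add: sum_distrib_left mult_ac)
    finally show ?thesis using m by (simp add: rel0)
  qed
  then have "D j = 0" by (intro der_eqI) (simp add: der_0)
  then show False using D_nonzero by blast
qed

lemma coefficients_eqI:
  assumes "\<And>q. (\<Sum>l\<in>UNIV. a l * der (D l) q) = (\<Sum>l\<in>UNIV. b l * der (D l) q)"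
  shows "a l = b l"
proof -
  have "(\<lambda>l. a l - b l) = (\<lambda>_. 0)"
    by (rule independent) (simp add: left_diff_distrib sum_subtractf assms)
  then show ?thesis by (metis eq_iff_diff_eq_0)
qed

text \<open>The \<open>n + 1\<close> derivations \<open>D\<^sub>1, \<dots>, D\<^sub>n, \<partial>\<^sub>t\<close> are dependent over the polynomials, and \<open>\<partial>\<^sub>t\<close> must occur
  in a relation. The product of its coefficients over all \<open>t\<close> is the denominator.\<close>

lemma common_denominator:
  "\<exists>d. d \<noteq> 0 \<and> (\<forall>V. \<exists>g. \<forall>q. d * der V q = (\<Sum>l\<in>UNIV. g l * der (D l) q))"
proof -
  have "\<exists>d h. d \<noteq> 0 \<and> d \<cdot>\<^sub>A partial t = (\<Sum>l\<in>UNIV. h l \<cdot>\<^sub>A D l)" for t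
  proof -
    define v where "v i s = (case i of None \<Rightarrow> if s = t then 1 else 0 | Some l \<Rightarrow> der (D l) (Var s))" for i s
    obtain x where x: "\<exists>i. x i \<noteq> 0" "\<And>s. (\<Sum>i\<in>UNIV. x i * v i s) = 0"
      using exists_linear_relation[of "UNIV :: 'n set" "UNIV :: 'n option set" v]
      by (auto simp: card_UNIV_option)
    have x': "x None * (if s = t then 1 else 0) + (\<Sum>l\<in>UNIV. x (Some l) * der (D l) (Var s)) = 0" for s
      using x(2)[of s] by (simp add: UNIV_option_conv sum.reindex v_def)
    have eq: "x None \<cdot>\<^sub>A partial t = (\<Sum>l\<in>UNIV. (- x (Some l)) \<cdot>\<^sub>A D l)"
      using x' by (intro der_eqI) (simp add: der_amult der_partial part_deriv_Var der_sum sum_negf eq_neg_iff_add_eq_0 eq_commute[of t])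
    have "x None \<noteq> 0"
    proof
      assume 0: "x None = 0"
      have "(\<Sum>l\<in>UNIV. - x (Some l) * der (D l) q) = 0" for q
        using arg_cong[OF eq, of "\<lambda>V. der V q"] by (simp add: der_sum der_amult 0)
      then have "(\<lambda>l. - x (Some l)) = (\<lambda>_. 0)" by (rule independent)
      then have "x (Some l) = 0" for l by (metis neg_equal_0_iff_equal)
      then show False using x(1) 0 by (metis option.exhaust)
    qed
    then show ?thesis using eq by (intro exI conjI)
  qed
  then obtain e h where e: "\<And>t. e t \<noteq> 0" and h: "\<And>t. e t \<cdot>\<^sub>A partial t = (\<Sum>l\<in>UNIV. h t l \<cdot>\<^sub>A D l)"
    by metis
  define d where "d = (\<Prod>t\<in>UNIV. e t)"
  have d: "d = e t * (\<Prod>s\<in>UNIV - {t}. e s)" for t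
    unfolding d_def by (rule prod.remove) auto
  have "(\<Prod>t\<in>I. e t) \<noteq> 0" if "finite I" for I using that by induction (simp_all add: e)
  then have "d \<noteq> 0" by (simp add: d_def)
  moreover have "\<exists>g. \<forall>q. d * der V q = (\<Sum>l\<in>UNIV. g l * der (D l) q)" for V
  proof (intro exI allI)
    fix q
    define c where "c t = (\<Prod>s\<in>UNIV - {t}. e s) * der V (Var t)" for t
    have hq: "e t * part_deriv t q = (\<Sum>l\<in>UNIV. h t l * der (D l) q)" for t
      using arg_cong[OF h[of t], of "\<lambda>V. der V q"] by (simp add: der_sum der_amult der_partial)
    have "d * der V q = (\<Sum>t\<in>UNIV. part_deriv t q * der V (Var t) * d)"
      by (subst der_expand) (simp add: sum_distrib_left mult_ac)
    also have "\<dots> = (\<Sum>t\<in>UNIV. c t * (e t * part_deriv t q))"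
    proof (rule sum.cong[OF refl])
      fix t
      show "part_deriv t q * der V (Var t) * d = c t * (e t * part_deriv t q)"
        by (subst d[of t]) (simp add: c_def mult_ac)
    qed
    also have "\<dots> = (\<Sum>t\<in>UNIV. \<Sum>l\<in>UNIV. c t * h t l * der (D l) q)"
      by (simp add: hq sum_distrib_left mult.assoc)
    also have "\<dots> = (\<Sum>l\<in>UNIV. (\<Sum>t\<in>UNIV. c t * h t l) * der (D l) q)"
      by (subst sum.swap) (simp add: sum_distrib_right)
    finally show "d * der V q =
        (\<Sum>l\<in>UNIV. (\<Sum>t\<in>UNIV. (\<Prod>s\<in>UNIV - {t}. e s) * der V (Var t) * h t l) * der (D l) q)"
      by (simp add: c_def)
  qed
  ultimately show ?thesis by blast
qed

text \<open>A fraction is killed by all \<open>D\<^sub>i\<close> only if it is killed by all \<open>\<partial>\<^sub>t\<close>, which are combinations of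
  the \<open>D\<^sub>i\<close> with fractions as coefficients.\<close>

lemma proportional_if_D_wronskian_0:
  assumes "e \<noteq> 0" "\<And>i. e * der (D i) r = r * der (D i) e"
  shows "\<exists>c. r = Const c * e"
proof (rule proportional_if_wronskian_0[OF assms(1)])
  fix t
  obtain d where d: "d \<noteq> 0" "\<And>V. \<exists>g. \<forall>q. d * der V q = (\<Sum>l\<in>UNIV. g l * der (D l) q)"
    using common_denominator by blast
  then obtain g where g: "\<And>q. d * part_deriv t q = (\<Sum>l\<in>UNIV. g l * der (D l) q)"
    by (metis der_partial)
  have "d * (e * part_deriv t r) = (\<Sum>l\<in>UNIV. g l * (e * der (D l) r))"
    using g[of r] by (simp add: mult.left_commute[of d e] sum_distrib_left mult_ac)
  also have "\<dots> = d * (r * part_deriv t e)"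
    unfolding assms(2) using g[of e] by (simp add: mult.left_commute[of d r] sum_distrib_left mult_ac)
  finally show "e * part_deriv t r = r * part_deriv t e"
    by (rule cpoly_mult_left_cancel) (rule d(1))
qed

text \<open>As the \<open>D\<^sub>l\<close> commute, \<open>[D\<^sub>i, V]\<close> has the coordinates \<open>D\<^sub>i(h\<^sub>l / d)\<close> if \<open>V\<close> has the coordinates \<open>h\<^sub>l / d\<close>.
  This is the quotient rule without denominators.\<close>

lemma coordinates_of_bracket:
  assumes "\<And>q. d * der V q = (\<Sum>l\<in>UNIV. h l * der (D l) q)"
  shows "d * (d * (der (D i) (der V q) - der V (der (D i) q))) =
    (\<Sum>l\<in>UNIV. (d * der (D i) (h l) - der (D i) d * h l) * der (D l) q)"
proof -
  have "der (D i) d * der V q + d * der (D i) (der V q) = der (D i) (d * der V q)"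
    by (simp add: der_mult)
  also have "\<dots> = (\<Sum>l\<in>UNIV. der (D i) (h l) * der (D l) q) + (\<Sum>l\<in>UNIV. h l * der (D l) (der (D i) q))"
    by (simp add: assms der_poly_sum der_mult sum.distrib D_D[of i])
  also have "(\<Sum>l\<in>UNIV. h l * der (D l) (der (D i) q)) = d * der V (der (D i) q)"
    by (simp add: assms)
  finally have "d * (der (D i) (der V q) - der V (der (D i) q)) =
      (\<Sum>l\<in>UNIV. der (D i) (h l) * der (D l) q) - der (D i) d * der V q"
    by (simp add: algebra_simps)
  then have "d * (d * (der (D i) (der V q) - der V (der (D i) q))) =
      d * (\<Sum>l\<in>UNIV. der (D i) (h l) * der (D l) q) - der (D i) d * (d * der V q)"
    by (simp add: right_diff_distrib mult_ac)
  then show ?thesis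
    by (simp add: assms sum_distrib_left left_diff_distrib sum_subtractf mult.assoc)
qed

text \<open>Let \<open>g\<^sub>l / d\<close> be the coordinates of \<open>E\<close>. From \<open>[D\<^sub>i, E] = D\<^sub>i\<close> follows \<open>D\<^sub>i(g\<^sub>l / d) = \<delta>\<^sub>i\<^sub>l\<close>.
  The last claim, \<open>X\<^sub>k\<^sub>j = (g / d)^k D\<^sub>j\<close>, is proved by induction on \<open>|k|\<close>: by the induction hypothesis
  both sides have the same brackets with all \<open>D\<^sub>i\<close>, so they differ by a combination \<open>C\<close> of the \<open>D\<^sub>l\<close>
  with constant coefficients. Both sides are eigenvectors of \<open>[E, _]\<close> for \<open>|k| - 1\<close>, but
  \<open>[E, C] = - C\<close>, so \<open>|k| C = 0\<close>.\<close>

lemma exists_fraction_tuple: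
  "\<exists>d g. d \<noteq> 0 \<and>
    (\<forall>i l. d * der (D i) (g l) = der (D i) d * g l + (if l = i then d * d else 0)) \<and>
    (\<forall>k j q. d ^ mdeg k * der (X k j) q = mpow g k * der (D j) q)"
proof -
  obtain d where d: "d \<noteq> 0" and coords: "\<And>V. \<exists>g. \<forall>q. d * der V q = (\<Sum>l\<in>UNIV. g l * der (D l) q)"
    using common_denominator by blast
  obtain g where gE: "\<And>q. d * der E q = (\<Sum>l\<in>UNIV. g l * der (D l) q)" using coords by blast
  have Dg: "d * der (D i) (g l) = der (D i) d * g l + (if l = i then d * d else 0)" for i l
  proof -
    have "(\<Sum>l\<in>UNIV. (d * der (D i) (g l) - der (D i) d * g l) * der (D l) q) =
        (\<Sum>l\<in>UNIV. (if l = i then d * d else 0) * der (D l) q)" for q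
    proof -
      have "(\<Sum>l\<in>UNIV. (if l = i then d * d else 0) * der (D l) q) =
          (\<Sum>l\<in>UNIV. if l = i then d * d * der (D l) q else 0)"
        by (intro sum.cong) auto
      then show ?thesis using coordinates_of_bracket[OF gE, of i q] by (simp add: E_D mult.assoc)
    qed
    from coefficients_eqI[OF this, of l] show ?thesis by (simp add: diff_eq_eq add.commute)
  qed
  have Dgk: "d * der (D i) (mpow g k) = of_nat (mdeg k) * der (D i) d * mpow g k +
      of_nat (Poly_Mapping.lookup k i) * (d * d) * mpow g (k - Poly_Mapping.single i 1)" for i k
  proof -
    let ?c = "\<lambda>l. of_nat (Poly_Mapping.lookup k l) * mpow g (k - Poly_Mapping.single l 1)"
    have "d * der (D i) (mpow g k) = (\<Sum>l\<in>UNIV. ?c l * (d * der (D i) (g l)))"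
      unfolding der_mpow by (simp add: sum_distrib_left mult_ac)
    also have "\<dots> = (\<Sum>l\<in>UNIV. (?c l * g l) * der (D i) d) + (\<Sum>l\<in>UNIV. if l = i then ?c l * (d * d) else 0)"
      unfolding Dg sum.distrib[symmetric] by (intro sum.cong) (auto simp: algebra_simps)
    also have "(\<Sum>l\<in>UNIV. (?c l * g l) * der (D i) d) = of_nat (mdeg k) * der (D i) d * mpow g k"
      unfolding mpow_minus_single mdeg_def by (simp add: sum_distrib_left sum_distrib_right mult_ac)
    finally show ?thesis by (simp add: mult_ac)
  qed
  have Egk: "d * der E (mpow g k) = of_nat (mdeg k) * (der E d + d) * mpow g k" for k
  proof -
    have "d * (d * der E (mpow g k)) = (\<Sum>i\<in>UNIV. g i * (d * der (D i) (mpow g k)))"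
      unfolding gE by (simp add: sum_distrib_left mult_ac)
    also have "\<dots> = (\<Sum>i\<in>UNIV. of_nat (mdeg k) * mpow g k * (g i * der (D i) d)) +
        (\<Sum>i\<in>UNIV. d * d * (of_nat (Poly_Mapping.lookup k i) * mpow g (k - Poly_Mapping.single i 1) * g i))"
      unfolding Dgk sum.distrib[symmetric] by (intro sum.cong) (auto simp: algebra_simps)
    also have "\<dots> = of_nat (mdeg k) * mpow g k * (d * der E d) + d * d * (of_nat (mdeg k) * mpow g k)"
    proof (intro arg_cong2[where f = "(+)"])
      show "(\<Sum>i\<in>UNIV. of_nat (mdeg k) * mpow g k * (g i * der (D i) d)) =
          of_nat (mdeg k) * mpow g k * (d * der E d)"
        unfolding gE by (simp only: sum_distrib_left)
      show "(\<Sum>i\<in>UNIV. d * d * (of_nat (Poly_Mapping.lookup k i) * mpow g (k - Poly_Mapping.single i 1) * g i)) =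
          d * d * (of_nat (mdeg k) * mpow g k)"
        unfolding mpow_minus_single mdeg_def by (simp add: sum_distrib_left sum_distrib_right)
    qed
    also have "\<dots> = d * (of_nat (mdeg k) * (der E d + d) * mpow g k)" by (simp add: algebra_simps)
    finally show ?thesis by (rule cpoly_mult_left_cancel) (rule d)
  qed
  have "\<forall>q. d ^ n * der (X k j) q = mpow g k * der (D j) q" if "mdeg k = n" for n k j
    using that
  proof (induction n arbitrary: k)
    case (0 k)
    then have "k = 0" by (intro poly_mapping_eqI) (simp add: mdeg_def)
    then show ?case by (simp add: X_0)
  next
    case (Suc m k)
    let ?X = "X k j"
    obtain h where h: "\<And>q. d * der ?X q = (\<Sum>l\<in>UNIV. h l * der (D l) q)" using coords by blast
    have IH: "of_nat (Poly_Mapping.lookup k i) * (d ^ m * der (X (k - Poly_Mapping.single i 1) j) q) =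
        of_nat (Poly_Mapping.lookup k i) * (mpow g (k - Poly_Mapping.single i 1) * der (D j) q)" for i q
    proof (cases "Poly_Mapping.lookup k i = 0")
      case False
      then have "k = k - Poly_Mapping.single i 1 + Poly_Mapping.single i 1"
        by (intro poly_mapping_eqI) (auto simp: lookup_add lookup_minus lookup_single when_def)
      then have "mdeg k = mdeg (k - Poly_Mapping.single i 1) + 1"
        using mdeg_add[of "k - Poly_Mapping.single i 1" "Poly_Mapping.single i 1"] by (simp only: mdeg_single)
      then show ?thesis using Suc.IH[of "k - Poly_Mapping.single i 1"] Suc.prems by simp
    qed simp
    have Dh: "d ^ m * (d * der (D i) (h l) - der (D i) d * h l) =
        (if l = j then of_nat (Poly_Mapping.lookup k i) * (d * d) * mpow g (k - Poly_Mapping.single i 1) else 0)"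
      (is "_ = (if l = j then ?a i else 0)") for i l
    proof -
      have "(\<Sum>l\<in>UNIV. d ^ m * (d * der (D i) (h l) - der (D i) d * h l) * der (D l) q) =
          (\<Sum>l\<in>UNIV. (if l = j then ?a i else 0) * der (D l) q)" for q
      proof -
        have "(\<Sum>l\<in>UNIV. d ^ m * (d * der (D i) (h l) - der (D i) d * h l) * der (D l) q) =
            d ^ m * (\<Sum>l\<in>UNIV. (d * der (D i) (h l) - der (D i) d * h l) * der (D l) q)"
          by (simp add: sum_distrib_left mult.assoc)
        also have "\<dots> = d * d * (of_nat (Poly_Mapping.lookup k i) * (d ^ m * der (X (k - Poly_Mapping.single i 1) j) q))"
          unfolding coordinates_of_bracket[OF h, symmetric] D_X by (simp add: mult_ac)
        also have "\<dots> = ?a i * der (D j) q" unfolding IH by (simp add: mult_ac)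
        also have "\<dots> = (\<Sum>l\<in>UNIV. if l = j then ?a i * der (D l) q else 0)" by simp
        also have "\<dots> = (\<Sum>l\<in>UNIV. (if l = j then ?a i else 0) * der (D l) q)"
          by (intro sum.cong) auto
        finally show ?thesis .
      qed
      then show ?thesis by (rule coefficients_eqI)
    qed
    \<comment> \<open>The fractions \<open>r\<^sub>l / d^(m + 1)\<close> are the coordinates of the difference of the two sides.\<close>
    define r where "r l = d ^ m * h l - (if l = j then mpow g k else 0)" for l
    have "\<exists>c. r l = Const c * d ^ Suc m" for l
    proof (rule proportional_if_D_wronskian_0)
      show "d ^ Suc m \<noteq> 0" using d by simp
      fix i
      have "d ^ Suc m * der (D i) (r l) = d ^ m * (d * der (D i) (d ^ m)) * h l +
          d ^ m * (d ^ m * (d * der (D i) (h l))) - d ^ m * (if l = j then d * der (D i) (mpow g k) else 0)"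
        by (simp add: r_def der_diff der_mult der_poly_0 algebra_simps)
      also have "d ^ m * (d * der (D i) (h l)) = d ^ m * (d * der (D i) (h l) - der (D i) d * h l) +
          d ^ m * (der (D i) d * h l)" by (simp add: algebra_simps)
      also have "d ^ m * (d * der (D i) (d ^ m)) * h l +
          d ^ m * (d ^ m * (d * der (D i) (h l) - der (D i) d * h l) + d ^ m * (der (D i) d * h l)) -
          d ^ m * (if l = j then d * der (D i) (mpow g k) else 0) = r l * (of_nat (Suc m) * d ^ m * der (D i) d)"
        unfolding Dh Dgk der_power Suc.prems by (simp add: r_def algebra_simps)
      finally show "d ^ Suc m * der (D i) (r l) = r l * der (D i) (d ^ Suc m)"
        by (simp only: der_power_Suc)
    qed
    then obtain c where c: "\<And>l. r l = Const (c l) * d ^ Suc m" by metis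
    define C where "C = (\<Sum>l\<in>UNIV. wscale (c l) (D l))"
    have C: "der C q = (\<Sum>l\<in>UNIV. Const (c l) * der (D l) q)" for q
      by (simp add: C_def der_sum der_wscale)
    have EC: "der E (der C q) = der C (der E q) - der C q" for q
      by (simp add: C der_poly_sum der_Const_mult E_D right_diff_distrib sum_subtractf)
    have eq: "d ^ Suc m * der (?X - C) q = mpow g k * der (D j) q" for q
    proof -
      have "d ^ Suc m * der ?X q = (\<Sum>l\<in>UNIV. (d ^ m * h l) * der (D l) q)"
        using arg_cong[OF h[of q], of "\<lambda>p. d ^ m * p"] by (simp add: sum_distrib_left mult_ac)
      also have "\<dots> = (\<Sum>l\<in>UNIV. (if l = j then mpow g k * der (D l) q else 0)) +
          (\<Sum>l\<in>UNIV. d ^ Suc m * (Const (c l) * der (D l) q))"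
      proof -
        have "d ^ m * h l = (if l = j then mpow g k else 0) + Const (c l) * d ^ Suc m" for l
          using c[of l] by (simp add: r_def algebra_simps)
        then show ?thesis unfolding sum.distrib[symmetric]
          by (intro sum.cong) (auto simp: algebra_simps)
      qed
      also have "\<dots> = mpow g k * der (D j) q + d ^ Suc m * der C q"
        unfolding C by (simp add: sum_distrib_left)
      finally show ?thesis by (simp add: der_minus algebra_simps)
    qed
    have "der C q = 0" for q
    proof -
      let ?Y = "?X - C"
      \<comment> \<open>Both sides of \<open>d^(m + 1) ?Y = g^k D\<^sub>j\<close> are bracketed with \<open>E\<close> and multiplied by \<open>d\<close>.\<close>
      have Y: "der E (der ?Y q) - der ?Y (der E q) = of_nat m * der ?X q + der C q"
        using E_X[of k j q] EC[of q] Suc.prems by (simp add: der_minus der_diff algebra_simps)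
      have "der E (d ^ Suc m) * der ?Y q + d ^ Suc m * der E (der ?Y q) =
          der E (mpow g k) * der (D j) q + mpow g k * der E (der (D j) q)"
        using arg_cong[OF eq[of q], of "der E"] by (simp only: der_mult)
      moreover have "d ^ Suc m * der ?Y (der E q) = mpow g k * der (D j) (der E q)" by (rule eq)
      ultimately have "der E (d ^ Suc m) * der ?Y q + d ^ Suc m * (of_nat m * der ?X q + der C q) =
          der E (mpow g k) * der (D j) q - mpow g k * der (D j) q"
        unfolding E_D Y[symmetric] by (simp add: algebra_simps)
      then have "d * (der E (d ^ Suc m) * der ?Y q + d ^ Suc m * (of_nat m * der ?X q + der C q)) =
          d * (der E (mpow g k) * der (D j) q - mpow g k * der (D j) q)" by simp
      then have "(d * der E (d ^ Suc m)) * der ?Y q + d * (d ^ Suc m * (of_nat m * der ?X q + der C q)) =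
          (d * der E (mpow g k)) * der (D j) q - d * (mpow g k * der (D j) q)"
        by (simp only: algebra_simps)
      then have "of_nat (Suc m) * der E d * (d ^ Suc m * der ?Y q) + d * (d ^ Suc m * (of_nat m * der ?X q + der C q)) =
          of_nat (Suc m) * (der E d + d) * (mpow g k * der (D j) q) - d * (mpow g k * der (D j) q)"
        unfolding der_power Egk Suc.prems by (simp only: mult_ac)
      then have "of_nat (Suc m) * der E d * (d ^ Suc m * der ?Y q) + d * (d ^ Suc m * (of_nat m * der ?X q + der C q)) =
          of_nat (Suc m) * (der E d + d) * (d ^ Suc m * der ?Y q) - d * (d ^ Suc m * der ?Y q)"
        unfolding eq .
      then have "d * d ^ Suc m * (of_nat (Suc m) * der C q) = 0"
        by (simp add: der_minus algebra_simps)
      moreover have "of_nat (Suc m) \<noteq> (0 :: 'n cpoly)" by (rule of_nat_neq_0)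
      ultimately show ?thesis using d by (auto simp del: of_nat_Suc)
    qed
    then show ?case using eq by (simp add: der_minus)
  qed
  then show ?thesis using d Dg by blast
qed

text \<open>The polynomials \<open>X\<^sub>k\<^sub>j(x\<^sub>s)\<close> for \<open>x^k = x\<^sub>i^m\<close> are \<open>(g\<^sub>i / d)^m D\<^sub>j(x\<^sub>s)\<close>. So all powers of \<open>g\<^sub>i / d\<close> have a
  common denominator, and \<open>f\<^sub>i = g\<^sub>i / d\<close> is a polynomial. The \<open>D\<^sub>i\<close> are dual to \<open>f\<close>.\<close>

theorem eq_sigma: "\<exists>f\<in>jacobi_tuples. \<phi> = sigma f"
proof -
  obtain d g where d: "d \<noteq> 0"
    and Dg: "\<And>i l. d * der (D i) (g l) = der (D i) d * g l + (if l = i then d * d else 0)"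
    and Xk: "\<And>k j q. d ^ mdeg k * der (X k j) q = mpow g k * der (D j) q"
    using exists_fraction_tuple by blast
  have "d dvd g i" for i
  proof -
    obtain s where s: "der (D i) (Var s) \<noteq> 0"
      using D_nonzero[of i] by (metis der_0 der_eqI)
    show ?thesis
    proof (rule dvd_if_powers_dvd[OF s d])
      fix m
      show "d ^ m dvd der (D i) (Var s) * g i ^ m"
        using Xk[of "Poly_Mapping.single i m" i "Var s"]
        by (metis dvdI mdeg_single mpow_single mult.commute)
    qed
  qed
  then obtain f where f: "\<And>i. g i = d * f i" unfolding dvd_def by metis
  have "g = (\<lambda>i. d * f i)" using f by blast
  have Df: "der (D i) (f l) = (if l = i then 1 else 0)" for i l
  proof -
    have "d * d * der (D i) (f l) = d * d * (if l = i then 1 else 0)"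
      using Dg[of i l] by (auto simp: f der_mult algebra_simps)
    then show ?thesis by (rule cpoly_mult_left_cancel) (use d in simp)
  qed
  have jt: "f \<in> jacobi_tuples" by (rule jacobi_tupleI[of D]) (simp add: Df)
  have theta: "theta f j = D j" for j by (rule theta_eqI[OF jt]) (simp add: Df)
  have "\<phi> (mpow Var k \<cdot>\<^sub>A partial j) = mpow f k \<cdot>\<^sub>A theta f j" for k j
  proof (rule der_eqI)
    fix i
    have "d ^ mdeg k * der (X k j) (Var i) = d ^ mdeg k * (mpow f k * der (D j) (Var i))"
      using Xk[of k j "Var i"] unfolding \<open>g = _\<close> mpow_scaled by (simp add: mult_ac)
    then have "der (X k j) (Var i) = mpow f k * der (D j) (Var i)"
      by (rule cpoly_mult_left_cancel) (use d in simp)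
    then show "der (\<phi> (mpow Var k \<cdot>\<^sub>A partial j)) (Var i) = der (mpow f k \<cdot>\<^sub>A theta f j) (Var i)"
      by (simp add: X_def der_amult theta)
  qed
  then have "\<phi> = sigma f" unfolding sigma_def by (rule lin_ext_unique[OF linear])
  then show ?thesis using jt by blast
qed

end

section \<open>Tame automorphisms in two variables\<close>

definition pair :: "'a \<Rightarrow> 'a \<Rightarrow> 2 \<Rightarrow> 'a"
  where "pair p q i = (if i = 1 then p else q)"

lemma pair_simps [simp]: "pair p q 1 = p" "pair p q 2 = q"
  by (simp_all add: pair_def)

lemma mpow_2: "mpow f k = f 1 ^ Poly_Mapping.lookup k 1 * f 2 ^ Poly_Mapping.lookup k (2 :: 2)"
  by (simp add: mpow_def UNIV_2)

lemma alg_autI: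
  assumes "\<And>i. poly_subst f (g i) = Var i" "\<And>i. poly_subst g (f i) = Var i"
  shows "poly_subst f \<in> alg_auts"
proof -
  have "poly_subst f (poly_subst g p) = p" "poly_subst g (poly_subst f p) = p" for p
    unfolding poly_subst_poly_subst assms by simp_all
  then have "bij (poly_subst f)" by (intro o_bij[of "poly_subst g"]) (auto simp: fun_eq_iff)
  then show ?thesis by (simp add: alg_auts_def poly_subst_add poly_subst_mult)
qed

lemma alg_autI_2:
  assumes "poly_subst f (g 1) = Var 1" "poly_subst f (g 2) = Var (2 :: 2)"
    "poly_subst g (f 1) = Var 1" "poly_subst g (f 2) = Var 2"
  shows "poly_subst f \<in> alg_auts"
  using assms forall_2[of "\<lambda>i. poly_subst f (g i) = Var i"] forall_2[of "\<lambda>i. poly_subst g (f i) = Var i"]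
  by (intro alg_autI[of f g]) auto

lemma theta_eqI_2:
  assumes "f \<in> jacobi_tuples" "der D (f 1) = (if j = 1 then 1 else 0)" "der D (f (2 :: 2)) = (if j = 2 then 1 else 0)"
  shows "theta f j = D"
  using assms forall_2[of "\<lambda>i. der D (f i) = (if i = j then 1 else 0)"]
  by (intro theta_eqI) (auto simp: eq_commute[of _ j])

lemma lin_ext_cong_2:
  assumes "\<And>k. g k 1 = h k 1" "\<And>k. g k 2 = h k (2 :: 2)"
  shows "lin_ext g = lin_ext h"
proof -
  have "\<forall>j. g k j = h k j" for k unfolding forall_2 using assms by blast
  then have "g = h" by (simp add: fun_eq_iff)
  then show ?thesis by simp
qed

lemma Const_inverse [simp]: "c \<noteq> 0 \<Longrightarrow> Const c * (Const (1 / c) * q) = q"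
  "c \<noteq> 0 \<Longrightarrow> Const (1 / c) * (Const c * q) = q"
  by (simp_all flip: mult.assoc Const_mult)

lemma zeta_poly_subst: "zeta (poly_subst f) = sigma f"
  by (simp add: zeta_def)

lemma s_map_eq: "s_map = sigma (pair (Var 2) (Var 1))"
    and swap_alg_aut: "poly_subst (pair (Var 2) (Var 1)) \<in> alg_auts"
proof -
  let ?f = "pair (Var 2) (Var 1) :: 2 \<Rightarrow> 2 cpoly"
  show aut: "poly_subst ?f \<in> alg_auts"
    by (rule alg_autI_2[of _ ?f]) simp_all
  have jt: "?f \<in> jacobi_tuples" using alg_aut_jacobi_tuple[OF aut] by simp
  have "theta ?f 1 = partial 2" "theta ?f 2 = partial 1"
    by (rule theta_eqI_2[OF jt]; simp add: der_partial part_deriv_Var)+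
  then show "s_map = sigma ?f"
    unfolding s_map_def sigma_def
    by (intro lin_ext_cong_2) (simp_all add: mpow_2 Let_def)
qed

lemma tau_map_eq:
  assumes "a \<noteq> 0"
  shows "tau_map a = sigma (pair (Const a * Var 1) (Var 2))"
    and "poly_subst (pair (Const a * Var 1) (Var 2)) \<in> alg_auts"
proof -
  let ?f = "pair (Const a * Var 1) (Var 2) :: 2 \<Rightarrow> 2 cpoly"
  show aut: "poly_subst ?f \<in> alg_auts"
    by (rule alg_autI_2[of _ "pair (Const (1 / a) * Var 1) (Var 2)"]) (use assms in \<open>simp_all add: poly_subst_mult\<close>)
  have jt: "?f \<in> jacobi_tuples" using alg_aut_jacobi_tuple[OF aut] by simp
  have theta: "theta ?f 1 = wscale (1 / a) (partial 1)" "theta ?f 2 = partial 2"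
    using assms Const_inverse(2)[of a 1]
    by (rule_tac [!] theta_eqI_2[OF jt]) (simp_all add: der_partial der_wscale part_deriv_Var part_deriv_mult
        part_deriv_Const)
  have "mpow ?f k \<cdot>\<^sub>A theta ?f 1 = wscale (a powi (int (Poly_Mapping.lookup k 1) - 1))
      ((Var 1 ^ Poly_Mapping.lookup k 1 * Var 2 ^ Poly_Mapping.lookup k 2) \<cdot>\<^sub>A partial 1)" for k
  proof (rule der_eqI)
    fix i
    have "Const (a powi (int (Poly_Mapping.lookup k 1) - 1)) =
        (Const a ^ Poly_Mapping.lookup k 1 * Const (1 / a) :: 2 cpoly)"
      using assms by (simp add: power_int_diff flip: Const_power Const_mult)
    then show "der (mpow ?f k \<cdot>\<^sub>A theta ?f 1) (Var i) = der (wscale (a powi (int (Poly_Mapping.lookup k 1) - 1))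
        ((Var 1 ^ Poly_Mapping.lookup k 1 * Var 2 ^ Poly_Mapping.lookup k 2) \<cdot>\<^sub>A partial 1)) (Var i)"
      by (simp add: theta mpow_2 der_amult der_wscale power_mult_distrib mult_ac)
  qed
  moreover have "mpow ?f k \<cdot>\<^sub>A theta ?f 2 = wscale (a ^ Poly_Mapping.lookup k 1)
      ((Var 1 ^ Poly_Mapping.lookup k 1 * Var 2 ^ Poly_Mapping.lookup k 2) \<cdot>\<^sub>A partial 2)" for k
    by (rule der_eqI) (simp add: theta mpow_2 der_amult der_wscale power_mult_distrib Const_power mult_ac)
  ultimately show "tau_map a = sigma ?f"
    unfolding tau_map_def sigma_def
    by (intro lin_ext_cong_2) (simp_all add: Let_def)
qed

lemma part_deriv_power: "part_deriv (i :: 'n::finite) (p ^ m) = of_nat m * p ^ (m - 1) * part_deriv i p"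
  using der_power_Suc[of "partial i" p] der_1[of "partial i"]
  by (cases m) (simp_all add: der_partial del: power_Suc of_nat_Suc)

lemma psi_map_eq: "psi_map p = sigma (pair (Var 1) (Var 2 + Var 1 ^ p))"
    and psi_alg_aut: "poly_subst (pair (Var 1) (Var 2 + Var 1 ^ p)) \<in> alg_auts"
proof -
  let ?f = "pair (Var 1) (Var 2 + Var 1 ^ p) :: 2 \<Rightarrow> 2 cpoly"
  show aut: "poly_subst ?f \<in> alg_auts"
    by (rule alg_autI_2[of _ "pair (Var 1) (Var 2 - Var 1 ^ p)"])
      (simp_all add: poly_subst_add poly_subst_diff poly_subst_power)
  have jt: "?f \<in> jacobi_tuples" using alg_aut_jacobi_tuple[OF aut] by simp
  have theta: "theta ?f 1 = partial 1 - (of_nat p * Var 1 ^ (p - 1)) \<cdot>\<^sub>A partial 2" "theta ?f 2 = partial 2"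
    by (rule theta_eqI_2[OF jt]; simp add: der_partial der_minus der_amult part_deriv_Var
        part_deriv_add part_deriv_power)+
  then show "psi_map p = sigma ?f"
    unfolding psi_map_def sigma_def
    by (intro lin_ext_cong_2) (simp_all add: mpow_2 Let_def)
qed

definition tame_witt :: "(2 witt \<Rightarrow> 2 witt) set"
  where "tame_witt = generate Aut_W ({s_map} \<union> {tau_map a | a. a \<noteq> 0} \<union> {psi_map p | p. True})"

text \<open>An automorphism is represented by its values \<open>p\<close> and \<open>q\<close> at \<open>x\<^sub>1\<close> and \<open>x\<^sub>2\<close>.\<close>

definition tame :: "2 cpoly \<Rightarrow> 2 cpoly \<Rightarrow> bool"
  where "tame p q \<longleftrightarrow> poly_subst (pair p q) \<in> alg_auts \<and> zeta (poly_subst (pair p q)) \<in> tame_witt"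

lemma tame_comp:
  assumes "tame p q" "tame r s"
  shows "tame (poly_subst (pair p q) r) (poly_subst (pair p q) s)"
proof -
  let ?\<tau> = "poly_subst (pair p q)" and ?\<rho> = "poly_subst (pair r s)"
  have pair: "(\<lambda>i. ?\<tau> (pair r s i)) = pair (?\<tau> r) (?\<tau> s)" by (auto simp: pair_def)
  have comp: "?\<tau> \<circ> ?\<rho> = poly_subst (pair (?\<tau> r) (?\<tau> s))"
    by (simp add: fun_eq_iff poly_subst_poly_subst pair)
  have "?\<tau> \<circ> ?\<rho> \<in> alg_auts"
    using assms group.subgroup_self[OF group_Aut_A] unfolding tame_def
    by (auto simp: alg_auts_def bij_comp)
  moreover have "zeta (?\<tau> \<circ> ?\<rho>) \<in> tame_witt"
    using assms generate.eng[of "zeta ?\<tau>" Aut_W _ "zeta ?\<rho>"]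
    by (simp add: tame_def tame_witt_def zeta_comp) (simp add: Aut_W_def)
  ultimately show ?thesis by (simp add: tame_def comp)
qed

lemma tame_swap: "tame (Var 2) (Var 1)"
  by (simp add: tame_def swap_alg_aut zeta_poly_subst tame_witt_def generate.incl flip: s_map_eq)

lemma tame_scale_1: "a \<noteq> 0 \<Longrightarrow> tame (Const a * Var 1) (Var 2)"
  using tau_map_eq[of a] by (auto simp: tame_def zeta_poly_subst tame_witt_def intro!: generate.incl)

lemma tame_psi: "tame (Var 1) (Var 2 + Var 1 ^ p)"
  unfolding tame_def zeta_poly_subst psi_map_eq[symmetric] tame_witt_def
  by (intro conjI psi_alg_aut generate.incl) blast

lemma tame_id: "tame (Var 1) (Var 2)"
  using tame_comp[OF tame_swap tame_swap] by simp

lemma tame_conj_swap: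
  assumes "tame p q"
  shows "tame (poly_subst (pair (Var 2) (Var 1)) q) (poly_subst (pair (Var 2) (Var 1)) p)"
  using tame_comp[OF tame_comp[OF tame_swap assms] tame_swap] by simp

lemma tame_scale_2: "a \<noteq> 0 \<Longrightarrow> tame (Var 1) (Const a * Var 2)"
  using tame_conj_swap[OF tame_scale_1[of a]] by (simp add: poly_subst_mult)

text \<open>Conjugation by a rescaling of \<open>x\<^sub>2\<close> brings in the coefficient \<open>c\<close>.\<close>

lemma tame_shear_monomial: "tame (Var 1) (Var 2 + Const c * Var 1 ^ p)"
proof (cases "c = 0")
  case False
  then show ?thesis
    using tame_comp[OF tame_comp[OF tame_scale_2[of "1 / c"] tame_psi[of p]] tame_scale_2[of c]]
    by (simp add: poly_subst_add poly_subst_mult poly_subst_power distrib_left)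
qed (simp add: tame_id)

lemma tame_shear:
  assumes "\<And>k. k \<in> Poly_Mapping.keys q \<Longrightarrow> Poly_Mapping.lookup k 2 = 0"
  shows "tame (Var 1) (Var 2 + q)"
proof -
  have sum: "tame (Var 1) (Var 2 + (\<Sum>k\<in>K. Const (Poly_Mapping.lookup q k) * Var 1 ^ Poly_Mapping.lookup k 1))"
    if "finite K" for K
    using that
  proof induction
    case empty
    then show ?case by (simp add: tame_id)
  next
    case (insert k K)
    then show ?case
      using tame_comp[OF insert.IH tame_shear_monomial[of "Poly_Mapping.lookup q k" "Poly_Mapping.lookup k 1"]]
      by (simp add: poly_subst_add poly_subst_mult poly_subst_power algebra_simps)
  qed
  have q: "q = (\<Sum>k\<in>Poly_Mapping.keys q. Const (Poly_Mapping.lookup q k) * Var 1 ^ Poly_Mapping.lookup k 1)"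
  proof -
    have "q = poly_subst Var q" by simp
    also have "\<dots> = (\<Sum>k\<in>Poly_Mapping.keys q. Const (Poly_Mapping.lookup q k) * Var 1 ^ Poly_Mapping.lookup k 1)"
      unfolding poly_subst_def by (intro sum.cong) (simp_all add: mpow_2 assms)
    finally show ?thesis .
  qed
  show ?thesis by (subst q) (rule sum, simp)
qed

lemma tame_triangular:
  assumes "a \<noteq> 0" "c \<noteq> 0" "\<And>k. k \<in> Poly_Mapping.keys q \<Longrightarrow> Poly_Mapping.lookup k 2 = 0"
  shows "tame (Const a * Var 1 + Const b) (Const c * Var 2 + q)"
proof -
  have "tame (Var 1) (Var 2 + Const (1 / c) * q)"
    by (rule tame_shear) (use assms in \<open>auto simp: in_keys_iff\<close>)
  moreover have "tame (Var 1 + Const b) (Var 2)"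
    using tame_conj_swap[OF tame_shear_monomial[of b 0]] by (simp add: poly_subst_add)
  ultimately have "tame (poly_subst (pair (Const a * Var 1) (Const c * Var 2 + q)) (Var 1 + Const b))
      (poly_subst (pair (Const a * Var 1) (Const c * Var 2 + q)) (Var 2))"
    using tame_comp[OF tame_comp[OF tame_comp[of "Var 1" "Var 2 + Const (1 / c) * q"
        "Var 1" "Const c * Var 2", OF _ tame_scale_2[OF assms(2)]] tame_scale_1[OF assms(1)]], of "Var 1 + Const b" "Var 2"]
      assms(2)
    by (simp add: poly_subst_mult distrib_left)
  then show ?thesis by (simp add: poly_subst_add)
qed

section \<open>Degrees in the second variable\<close>

definition deg2 :: "2 \<Rightarrow> nat"
  where "deg2 i = (if i = 1 then 0 else 1)"

lemma wt_2: "wt w k = of_nat (Poly_Mapping.lookup k 1) * w 1 + of_nat (Poly_Mapping.lookup k (2 :: 2)) * w 2"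
  by (simp add: wt_def sum_2)

lemma wt_deg2: "wt deg2 k = Poly_Mapping.lookup k 2"
  by (simp add: wt_2 deg2_def)

lemma weight_le_Var_part_deriv: "weight_le w d p \<Longrightarrow> weight_le w d (Var i * part_deriv i p)"
  by (auto simp: weight_le_def in_keys_iff lookup_Var_part_deriv)

lemma weight_le_Var_mult_D:
  assumes "weight_le w d (Var i * p)" "k \<in> Poly_Mapping.keys p"
  shows "wt w k + w i \<le> d"
proof -
  have "Poly_Mapping.lookup (Var i * p) (Poly_Mapping.single i 1 + k) = Poly_Mapping.lookup p k"
    unfolding Var_def lookup_single_mult by simp
  then have "Poly_Mapping.single i 1 + k \<in> Poly_Mapping.keys (Var i * p)"
    using assms(2) by (simp add: in_keys_iff)
  then have "wt w (Poly_Mapping.single i 1 + k) \<le> d" using assms(1) by (simp add: weight_le_def)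
  then show ?thesis by (simp add: wt_add wt_single add.commute del: One_nat_def)
qed

lemma weight_le_deg2_part_deriv_1: "weight_le deg2 d p \<Longrightarrow> weight_le deg2 d (part_deriv 1 p)"
  using weight_le_Var_mult_D[OF weight_le_Var_part_deriv[of deg2 d p 1]] by (auto simp: weight_le_def deg2_def)

lemma weight_part_power:
  assumes "weight_le w d p"
  shows "weight_part w (of_nat n * d) (p ^ n) = weight_part w d p ^ n"
proof (induction n)
  case 0
  show ?case
    by (rule poly_mapping_eqI) (auto simp: lookup_weight_part lookup_one when_def)
next
  case (Suc n)
  then show ?case
    using weight_part_mult[OF assms weight_le_power[OF assms, of n]] by (simp add: algebra_simps)
qed

lemma weight_le_pred:
  fixes w :: "'n::finite \<Rightarrow> nat"
  assumes "weight_le w d p" "weight_part w d p = 0"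
  shows "weight_le w (d - 1) p"
  unfolding weight_le_def
proof
  fix k assume k: "k \<in> Poly_Mapping.keys p"
  then have "wt w k \<le> d" using assms(1) by (simp add: weight_le_def)
  moreover have "wt w k \<noteq> d"
    using arg_cong[OF assms(2), of "\<lambda>q. Poly_Mapping.lookup q k"] k
    by (auto simp: lookup_weight_part in_keys_iff)
  ultimately show "wt w k \<le> d - 1" by simp
qed

lemma jacobian_2: "jacobian f = part_deriv 1 (f 1) * part_deriv 2 (f 2) - part_deriv 2 (f 1) * part_deriv 1 (f (2 :: 2))"
  by (simp add: jacobian_def jacobi_matrix_def det_2)

lemma Var_nonzero [simp]: "Var i \<noteq> (0 :: 'n cpoly)"
  using part_deriv_Var[of i i] by (auto simp: part_deriv_0)

lemma Var_part_deriv_weight_part_deg2: "Var 2 * part_deriv 2 (weight_part deg2 d p) = of_nat d * weight_part deg2 d p"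
proof (rule poly_mapping_eqI)
  fix k
  have "Poly_Mapping.lookup (of_nat d * weight_part deg2 d p) k = of_nat d * Poly_Mapping.lookup (weight_part deg2 d p) k"
    by (metis Const_of_nat lookup_Const_mult)
  then show "Poly_Mapping.lookup (Var 2 * part_deriv 2 (weight_part deg2 d p)) k =
      Poly_Mapping.lookup (of_nat d * weight_part deg2 d p) k"
    by (simp add: lookup_Var_part_deriv lookup_weight_part wt_deg2)
qed

text \<open>Multiplied by \<open>x\<^sub>1 x\<^sub>2\<close>, the Jacobi determinant involves only the operators \<open>x\<^sub>i \<partial>\<^sub>i\<close>, which preserve
  the degree in \<open>x\<^sub>2\<close>. Its part of degree \<open>n + m\<close> vanishes, since \<open>c x\<^sub>1 x\<^sub>2\<close> has degree \<open>1 < n + m\<close>.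
  On leading forms, \<open>x\<^sub>2 \<partial>\<^sub>2\<close> is the multiplication by the degree.\<close>

lemma leading_form_relation:
  assumes J: "part_deriv 1 X * part_deriv 2 Y - part_deriv 2 X * part_deriv 1 Y = Const c"
    and X: "weight_le deg2 n X" and Y: "weight_le deg2 m Y" and "n > 0" "m > 0"
  shows "of_nat m * weight_part deg2 m Y * part_deriv 1 (weight_part deg2 n X) = of_nat n * weight_part deg2 n X * part_deriv 1 (weight_part deg2 m Y)"
proof -
  let ?X = "weight_part deg2 n X" and ?Y = "weight_part deg2 m Y"
  note b = weight_le_Var_part_deriv
  have "(Var 1 * part_deriv 1 X) * (Var 2 * part_deriv 2 Y) - (Var 2 * part_deriv 2 X) * (Var 1 * part_deriv 1 Y) =
      Const c * (Var 1 * Var 2)"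
    using arg_cong[OF J, of "\<lambda>p. Var 1 * Var 2 * p"] by (simp add: algebra_simps)
  from arg_cong[OF this, of "weight_part deg2 (n + m)"]
  have "(Var 1 * part_deriv 1 ?X) * (Var 2 * part_deriv 2 ?Y) - (Var 2 * part_deriv 2 ?X) * (Var 1 * part_deriv 1 ?Y) =
      weight_part deg2 (n + m) (Const c * (Var 1 * Var 2))"
    unfolding weight_part_diff weight_part_mult[OF b[OF X] b[OF Y]] weight_part_Var_part_deriv .
  also have "\<dots> = 0"
  proof (rule weight_part_above)
    show "weight_le deg2 1 (Const c * (Var 1 * Var 2))"
      by (rule weight_le_Const_mult)
        (auto simp: Var_def mult_single weight_le_def wt_deg2 lookup_add lookup_single)
    show "1 < n + m" using \<open>n > 0\<close> \<open>m > 0\<close> by simp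
  qed
  finally have "Var 1 * (of_nat m * ?Y * part_deriv 1 ?X) = Var 1 * (of_nat n * ?X * part_deriv 1 ?Y)"
    unfolding Var_part_deriv_weight_part_deg2 by (simp add: algebra_simps)
  then show ?thesis by (rule cpoly_mult_left_cancel) simp
qed

text \<open>For \<open>m = k n\<close> the relation between the leading forms says that the one of \<open>Y\<close> and the \<open>k\<close>-th
  power of the one of \<open>X\<close> have vanishing Wronskians, so they are proportional.\<close>

lemma lower_degree_step:
  assumes J: "part_deriv 1 X * part_deriv 2 Y - part_deriv 2 X * part_deriv 1 Y = Const c"
    and X: "weight_le deg2 n X" and Y: "weight_le deg2 m Y" and "n > 0" "m > 0" and dvd: "n dvd m"
    and nz: "weight_part deg2 n X \<noteq> 0"
  shows "\<exists>a k. weight_le deg2 (m - 1) (Y - Const a * X ^ k)"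
proof -
  let ?X = "weight_part deg2 n X" and ?Y = "weight_part deg2 m Y"
  obtain k where k: "m = k * n" using dvd by (metis dvdE mult.commute)
  have k0: "k > 0" using k \<open>m > 0\<close> by (cases k) auto
  have top: "weight_part deg2 m (X ^ k) = ?X ^ k" using weight_part_power[OF X, of k] by (simp add: k)
  have rel: "of_nat n * (of_nat k * ?Y * part_deriv 1 ?X) = of_nat n * (?X * part_deriv 1 ?Y)"
    using leading_form_relation[OF J X Y \<open>n > 0\<close> \<open>m > 0\<close>] by (simp add: k mult_ac)
  then have rel: "of_nat k * ?Y * part_deriv 1 ?X = ?X * part_deriv 1 ?Y"
    by (rule cpoly_mult_left_cancel) (use \<open>n > 0\<close> in simp)
  have pow: "?X * part_deriv i (?X ^ k) = of_nat k * ?X ^ k * part_deriv i ?X" for i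
    using der_power[of ?X "partial i" k] by (simp add: der_partial)
  have "?X ^ k * part_deriv i ?Y = ?Y * part_deriv i (?X ^ k)" for i
  proof -
    have 1: "?X * (?X ^ k * part_deriv 1 ?Y) = ?X * (?Y * part_deriv 1 (?X ^ k))"
    proof -
      have "?X * (?X ^ k * part_deriv 1 ?Y) = ?X ^ k * (?X * part_deriv 1 ?Y)" by (simp add: mult_ac)
      also have "\<dots> = ?Y * (of_nat k * ?X ^ k * part_deriv 1 ?X)" unfolding rel[symmetric] by (simp add: mult_ac)
      also have "\<dots> = ?X * (?Y * part_deriv 1 (?X ^ k))" unfolding pow[symmetric] by (simp add: mult_ac)
      finally show ?thesis .
    qed
    have 2: "Var 2 * (?X ^ k * part_deriv 2 ?Y) = Var 2 * (?Y * part_deriv 2 (?X ^ k))"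
    proof -
      have "Var 2 * (?X ^ k * part_deriv 2 ?Y) = of_nat m * ?Y * ?X ^ k"
        using Var_part_deriv_weight_part_deg2[of m Y] by (simp add: mult_ac)
      also have "\<dots> = ?Y * (Var 2 * part_deriv 2 (?X ^ k))"
        using Var_part_deriv_weight_part_deg2[of m "X ^ k"] by (simp add: top mult_ac)
      finally show ?thesis by (simp add: mult_ac)
    qed
    have "?X ^ k * part_deriv 1 ?Y = ?Y * part_deriv 1 (?X ^ k)"
      using 1 by (rule cpoly_mult_left_cancel) (rule nz)
    moreover have "?X ^ k * part_deriv 2 ?Y = ?Y * part_deriv 2 (?X ^ k)"
      using 2 by (rule cpoly_mult_left_cancel) simp
    ultimately show ?thesis using exhaust_2[of i] by auto
  qed
  then obtain a where a: "?Y = Const a * ?X ^ k"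
    using proportional_if_wronskian_0[of "?X ^ k" ?Y] nz by auto
  have "weight_le deg2 m (Y - Const a * X ^ k)"
    using weight_le_power[OF X, of k] by (intro weight_le_diff Y weight_le_Const_mult) (simp add: k)
  moreover have "weight_part deg2 m (Y - Const a * X ^ k) = 0"
    by (simp add: weight_part_diff weight_part_Const_mult top a)
  ultimately show ?thesis using weight_le_pred by blast
qed

section \<open>Divisibility of the degrees\<close>

text \<open>Distinct numbers of one residue class modulo \<open>L\<close> have distinct quotients by \<open>L\<close>.\<close>

lemma card_congruent_bound:
  fixes B :: "nat set"
  assumes "finite B" "\<And>b c. b \<in> B \<Longrightarrow> c \<in> B \<Longrightarrow> b mod L = c mod L" "\<And>b. b \<in> B \<Longrightarrow> b \<le> d" "B \<noteq> {}"
  shows "(card B - 1) * L \<le> d"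
proof -
  have "inj_on (\<lambda>b. b div L) B"
    by (rule inj_onI) (metis assms(2) div_mult_mod_eq)
  moreover have "(\<lambda>b. b div L) ` B \<subseteq> {..d div L}" using assms(3) by (auto intro: div_le_mono)
  ultimately have "card B \<le> card {..d div L}" by (intro card_inj_on_le) auto
  then have "card B - 1 \<le> d div L" by simp
  then have "(card B - 1) * L \<le> d div L * L" by (rule mult_le_mono1)
  also have "\<dots> \<le> d" by (simp add: div_times_less_eq_dividend)
  finally show ?thesis .
qed

text \<open>Suppose that neither degree divides the other. Let \<open>\<tau> G = x\<^sub>1\<close>, give \<open>x\<^sub>1\<close> and \<open>x\<^sub>2\<close> the weights
  \<open>n\<close> and \<open>m\<close>, and let \<open>\<delta>\<close> be the weight of \<open>G\<close>, attained by \<open>T + 1\<close> of its monomials.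

  Such a monomial is determined by its exponent \<open>b\<close> of \<open>x\<^sub>2\<close>. The operators \<open>x\<^sub>2 \<partial>\<^sub>2 - b\<close> for \<open>T\<close> of these
  exponents turn \<open>G\<close> into a polynomial \<open>H\<close> with only one monomial of weight \<open>\<delta>\<close>, so nothing cancels in
  the part of \<open>\<tau> H\<close> of degree \<open>\<delta>\<close> in \<open>x\<^sub>2\<close>. Since the Jacobi determinant is constant,
  \<open>\<tau> (\<partial>\<^sub>2 p)\<close> is up to a constant the Jacobi determinant of \<open>\<tau> x\<^sub>1\<close> and \<open>\<tau> p\<close>. Hence each of the operators
  raises the degree of the image by at most \<open>n + m - 1\<close>. As \<open>\<tau> G = x\<^sub>1\<close> has degree 0, this gives
  \<open>\<delta> \<le> T (n + m - 1)\<close>.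

  On the other hand, the numbers \<open>m b\<close> are bounded by \<open>\<delta>\<close> and congruent modulo \<open>lcm n m\<close>, whence
  \<open>T lcm n m \<le> \<delta>\<close>. As \<open>lcm n m\<close> is at least \<open>2 n\<close> and \<open>2 m\<close>, it is at least \<open>n + m\<close>. So \<open>T = 0\<close> and
  \<open>\<delta> = 0\<close>, and \<open>G\<close> is constant, a contradiction.\<close>

lemma degrees_dvd:
  fixes \<tau> :: "2 cpoly \<Rightarrow> 2 cpoly"
  assumes aut: "\<tau> \<in> alg_auts"
    and X: "weight_le deg2 n (\<tau> (Var 1))" "weight_part deg2 n (\<tau> (Var 1)) \<noteq> 0"
    and Y: "weight_le deg2 m (\<tau> (Var 2))" "weight_part deg2 m (\<tau> (Var 2)) \<noteq> 0"
    and nm: "n > 0" "m > 0"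
  shows "n dvd m \<or> m dvd n"
proof (rule ccontr)
  assume neg: "\<not> ?thesis"
  let ?X = "\<tau> (Var 1)" and ?Y = "\<tau> (Var 2)"
  define f where "f = (\<lambda>i. \<tau> (Var i))"
  have jt: "f \<in> jacobi_tuples" unfolding f_def by (rule alg_aut_jacobi_tuple[OF aut])
  have \<tau>: "\<tau> p = poly_subst f p" for p
    unfolding f_def by (rule fun_cong[OF alg_aut_eq_poly_subst[OF aut]])
  obtain c where c: "c \<noteq> 0" "part_deriv 1 ?X * part_deriv 2 ?Y - part_deriv 2 ?X * part_deriv 1 ?Y = Const c"
    using jt jacobian_2[of f] by (auto simp: jacobi_tuples_def f_def)
  obtain G where G: "\<tau> G = Var 1" using aut by (auto simp: alg_auts_def dest!: bij_is_surj) (metis surjD)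
  define dw where "dw i = (if i = 1 then n else m)" for i :: 2
  have wt_dw: "wt dw k = Poly_Mapping.lookup k 1 * n + Poly_Mapping.lookup k 2 * m" for k
    by (simp add: wt_2 dw_def)
  have "G \<noteq> 0" using G \<tau> by auto
  then obtain k0 where k0: "k0 \<in> Poly_Mapping.keys G" "weight_le dw (wt dw k0) G" by (rule exists_leading_exponent)
  define \<delta> where "\<delta> = wt dw k0"
  have chain: "part_deriv i (\<tau> p) = \<tau> (part_deriv 1 p) * part_deriv i ?X + \<tau> (part_deriv 2 p) * part_deriv i ?Y" for i p
    using der_poly_subst[of "partial i" f p] by (simp add: \<tau> der_partial sum_2)
  \<comment> \<open>The effect of one operator on the degree of the image.\<close>
  have op: "weight_le deg2 (d + (n + m - 1)) (\<tau> (Var 2 * part_deriv 2 p - Const a * p))"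
    if p: "weight_le deg2 d (\<tau> p)" for d p a
  proof -
    have "Const c * (Var 2 * \<tau> (part_deriv 2 p)) =
        part_deriv 1 ?X * (Var 2 * part_deriv 2 (\<tau> p)) - (Var 2 * part_deriv 2 ?X) * part_deriv 1 (\<tau> p)"
      unfolding chain[of _ p] c(2)[symmetric] by (simp add: algebra_simps)
    moreover have "weight_le deg2 (n + d) \<dots>"
      using X(1) p by (intro weight_le_diff weight_le_mult weight_le_Var_part_deriv weight_le_deg2_part_deriv_1)
    ultimately have "weight_le deg2 (n + d) (Const c * (Var 2 * \<tau> (part_deriv 2 p)))" by simp
    from weight_le_Const_mult[OF this, of "1 / c"] have "weight_le deg2 (n + d) (Var 2 * \<tau> (part_deriv 2 p))"
      using c(1) by simp
    note bound = weight_le_Var_mult_D[OF this]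
    have "weight_le deg2 (n + d - 1) (\<tau> (part_deriv 2 p))"
      unfolding weight_le_def
    proof
      fix k assume "k \<in> Poly_Mapping.keys (\<tau> (part_deriv 2 p))"
      from bound[OF this] show "wt deg2 k \<le> n + d - 1" by (simp add: deg2_def)
    qed
    from weight_le_mult[OF Y(1) this] have "weight_le deg2 (d + (n + m - 1)) (?Y * \<tau> (part_deriv 2 p))"
      by (rule weight_le_mono) (use nm in simp)
    moreover have "weight_le deg2 (d + (n + m - 1)) (Const a * \<tau> p)"
      by (rule weight_le_mono[OF weight_le_Const_mult[OF p]]) simp
    moreover have "\<tau> (Var 2 * part_deriv 2 p - Const a * p) = ?Y * \<tau> (part_deriv 2 p) - Const a * \<tau> p"
      by (simp add: \<tau> poly_subst_diff poly_subst_mult)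
    ultimately show ?thesis by (simp only: weight_le_diff)
  qed
  have iter: "\<exists>H. (\<forall>k. Poly_Mapping.lookup H k =
        (\<Prod>b\<in>B. of_nat (Poly_Mapping.lookup k 2) - of_nat b) * Poly_Mapping.lookup G k) \<and>
      weight_le deg2 (card B * (n + m - 1)) (\<tau> H)" if "finite B" for B :: "nat set"
    using that
  proof induction
    case empty
    have "weight_le deg2 0 (\<tau> G)" by (simp add: G Var_def weight_le_def wt_deg2 lookup_single)
    then show ?case by (intro exI[of _ G]) simp
  next
    case (insert b B)
    then obtain H where H: "\<And>k. Poly_Mapping.lookup H k =
        (\<Prod>b\<in>B. of_nat (Poly_Mapping.lookup k 2) - of_nat b) * Poly_Mapping.lookup G k"
      "weight_le deg2 (card B * (n + m - 1)) (\<tau> H)" by blast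
    have "weight_le deg2 (card (insert b B) * (n + m - 1)) (\<tau> (Var 2 * part_deriv 2 H - Const (of_nat b) * H))"
      using op[OF H(2), of "of_nat b"] insert.hyps by (simp add: add.commute)
    then show ?case
      using insert.hyps
      by (intro exI[of _ "Var 2 * part_deriv 2 H - Const (of_nat b) * H"])
        (auto simp: lookup_minus lookup_Var_part_deriv H(1) left_diff_distrib)
  qed
  define S where "S = {k \<in> Poly_Mapping.keys G. wt dw k = \<delta>}"
  have finS: "finite S" "k0 \<in> S" using k0(1) by (simp_all add: S_def \<delta>_def)
  define B' where "B' = (\<lambda>k. Poly_Mapping.lookup k 2) ` S"
  define B where "B = B' - {Poly_Mapping.lookup k0 2}"
  have B: "finite B'" "Poly_Mapping.lookup k0 2 \<in> B'" using finS by (auto simp: B'_def)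
  have cardB: "card B = card B' - 1" using B by (simp add: B_def)
  obtain H where H: "\<And>k. Poly_Mapping.lookup H k =
        (\<Prod>b\<in>B. of_nat (Poly_Mapping.lookup k 2) - of_nat b) * Poly_Mapping.lookup G k"
      "weight_le deg2 (card B * (n + m - 1)) (\<tau> H)"
    using iter[of B] B by (auto simp: B_def)
  have H0: "Poly_Mapping.lookup H k0 \<noteq> 0"
    using k0(1) B(1) by (simp add: H(1) in_keys_iff B_def)
  \<comment> \<open>The monomial \<open>k0\<close> is isolated in weight \<open>\<delta>\<close>.\<close>
  have Hother: "wt dw k < \<delta>" if "k \<in> Poly_Mapping.keys H" "k \<noteq> k0" for k
  proof -
    have k: "k \<in> Poly_Mapping.keys G" "(\<Prod>b\<in>B. of_nat (Poly_Mapping.lookup k 2) - of_nat b) \<noteq> (0 :: complex)"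
      using that(1) by (simp_all add: in_keys_iff H(1))
    have "wt dw k \<noteq> \<delta>"
    proof
      assume eq: "wt dw k = \<delta>"
      then have "Poly_Mapping.lookup k 2 \<in> B'" using k(1) by (auto simp: B'_def S_def)
      moreover have "Poly_Mapping.lookup k 2 \<notin> B" using k(2) B(1) by (auto simp: B_def)
      ultimately have 2: "Poly_Mapping.lookup k 2 = Poly_Mapping.lookup k0 2" by (simp add: B_def)
      then have "Poly_Mapping.lookup k 1 = Poly_Mapping.lookup k0 1"
        using eq nm(1) by (simp add: \<delta>_def wt_dw)
      with 2 have "\<forall>i. Poly_Mapping.lookup k i = Poly_Mapping.lookup k0 i" by (simp add: forall_2)
      then have "k = k0" by (intro poly_mapping_eqI) simp
      then show False using that(2) by simp
    qed
    moreover have "wt dw k \<le> \<delta>" using k(1) k0(2) by (simp add: weight_le_def \<delta>_def)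
    ultimately show ?thesis by simp
  qed
  have monomial: "weight_le deg2 (wt dw k) (mpow f k) \<and>
      weight_part deg2 (wt dw k) (mpow f k) = weight_part deg2 n ?X ^ Poly_Mapping.lookup k 1 * weight_part deg2 m ?Y ^ Poly_Mapping.lookup k 2" for k
    using weight_le_mult[OF weight_le_power[OF X(1), of "Poly_Mapping.lookup k 1"] weight_le_power[OF Y(1), of "Poly_Mapping.lookup k 2"]]
      weight_part_mult[OF weight_le_power[OF X(1), of "Poly_Mapping.lookup k 1"] weight_le_power[OF Y(1), of "Poly_Mapping.lookup k 2"]]
    unfolding weight_part_power[OF X(1)] weight_part_power[OF Y(1)] by (simp add: wt_dw mpow_2 f_def)
  have "weight_part deg2 \<delta> (\<tau> H) = Const (Poly_Mapping.lookup H k0) * weight_part deg2 \<delta> (mpow f k0)"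
  proof -
    have "weight_part deg2 \<delta> (\<tau> H) = (\<Sum>k\<in>Poly_Mapping.keys H. Const (Poly_Mapping.lookup H k) * weight_part deg2 \<delta> (mpow f k))"
      by (simp add: \<tau> poly_subst_def weight_part_sum weight_part_Const_mult)
    also have "\<dots> = (\<Sum>k\<in>Poly_Mapping.keys H. if k = k0 then Const (Poly_Mapping.lookup H k0) * weight_part deg2 \<delta> (mpow f k0) else 0)"
    proof (rule sum.cong[OF refl])
      fix k assume "k \<in> Poly_Mapping.keys H"
      then show "Const (Poly_Mapping.lookup H k) * weight_part deg2 \<delta> (mpow f k) =
          (if k = k0 then Const (Poly_Mapping.lookup H k0) * weight_part deg2 \<delta> (mpow f k0) else 0)"
        using Hother[of k] weight_part_above[of deg2 "wt dw k" "mpow f k" \<delta>] monomial[of k] by simp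
    qed
    finally show ?thesis using H0 by (simp add: in_keys_iff)
  qed
  also have "\<dots> \<noteq> 0" using H0 X(2) Y(2) monomial[of k0] by (simp add: \<delta>_def)
  finally have "weight_part deg2 \<delta> (\<tau> H) \<noteq> 0" .
  then have upper: "\<delta> \<le> card B * (n + m - 1)"
    using weight_part_above[OF H(2), of \<delta>] by (meson not_less)
  define L where "L = lcm n m"
  have "card B * L \<le> \<delta>"
  proof -
    have "(card ((*) m ` B') - 1) * L \<le> \<delta>"
    proof (rule card_congruent_bound)
      fix b c assume "b \<in> (*) m ` B'" "c \<in> (*) m ` B'"
      then obtain k l where kl: "k \<in> S" "l \<in> S" "b = m * Poly_Mapping.lookup k 2" "c = m * Poly_Mapping.lookup l 2"
        by (auto simp: B'_def)
      have eq: "Poly_Mapping.lookup k 1 * n + b = Poly_Mapping.lookup l 1 * n + c"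
        using kl by (simp add: S_def wt_dw mult.commute)
      have "int b - int c = int n * (int (Poly_Mapping.lookup l 1) - int (Poly_Mapping.lookup k 1))"
        using arg_cong[OF eq, of int] by (simp add: algebra_simps)
      then have "int n dvd int b - int c" by simp
      moreover have "int m dvd int b - int c" by (simp add: kl)
      ultimately have "int L dvd int b - int c" by (simp add: L_def flip: lcm_int_int_eq)
      then show "b mod L = c mod L" by (metis mod_eq_dvd_iff of_nat_eq_iff of_nat_mod)
    next
      fix b assume "b \<in> (*) m ` B'"
      then show "b \<le> \<delta>" by (auto simp: B'_def S_def wt_dw mult.commute)
    qed (use B in auto)
    moreover have "card ((*) m ` B') = card B'" using nm(2) by (intro card_image) (auto simp: inj_on_def)
    ultimately show ?thesis by (simp add: cardB)
  qed
  moreover have "n + m \<le> L"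
  proof -
    have L0: "L > 0" using nm by (simp add: L_def lcm_pos_nat)
    have two: "2 * a \<le> L" if "a dvd L" "L \<noteq> a" for a
    proof -
      obtain t where t: "L = a * t" using \<open>a dvd L\<close> by (rule dvdE)
      then have "t \<noteq> 0" "t \<noteq> 1" using L0 that(2) by auto
      then have "2 \<le> t" by simp
      then show ?thesis using t by simp
    qed
    have "n dvd L" "m dvd L" by (simp_all add: L_def)
    moreover have "L \<noteq> n" "L \<noteq> m" using neg \<open>n dvd L\<close> \<open>m dvd L\<close> by auto
    ultimately show ?thesis using two[of n] two[of m] by simp
  qed
  ultimately have "card B * (n + m) \<le> card B * (n + m - 1)"
    using upper by (meson le_trans mult_le_mono2)
  then have "card B = 0" using nm by (simp add: mult_le_cancel1) linarith
  then have "\<delta> = 0" using upper by simp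
  have "k = 0" if "k \<in> Poly_Mapping.keys G" for k
  proof -
    have "wt dw k = 0" using that k0(2) \<open>\<delta> = 0\<close> by (simp add: weight_le_def \<delta>_def)
    then have "\<forall>i. Poly_Mapping.lookup k i = 0" using nm by (simp add: wt_dw forall_2)
    then show ?thesis by (intro poly_mapping_eqI) simp
  qed
  then have "G = Const (Poly_Mapping.lookup G 0)"
    by (intro poly_mapping_eqI) (auto simp: Const_def lookup_single when_def in_keys_iff)
  then have "\<tau> G = Const (Poly_Mapping.lookup G 0)" unfolding \<tau> by (metis poly_subst_Const)
  then have "(Var 1 :: 2 cpoly) = Const (Poly_Mapping.lookup G 0)" using G by simp
  from arg_cong[OF this, of "part_deriv 1"] show False by (simp add: part_deriv_Var part_deriv_Const)
qed

section \<open>Tameness of all automorphisms\<close>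

text \<open>If \<open>\<tau> x\<^sub>1\<close> does not involve \<open>x\<^sub>2\<close>, the Jacobi determinant is the product of \<open>\<partial>\<^sub>1 (\<tau> x\<^sub>1)\<close> and
  \<open>\<partial>\<^sub>2 (\<tau> x\<^sub>2)\<close>, so both are constants and \<open>\<tau>\<close> is triangular.\<close>

lemma tame_if_degree_0:
  fixes \<tau> :: "2 cpoly \<Rightarrow> 2 cpoly"
  assumes aut: "\<tau> \<in> alg_auts" and X: "weight_le deg2 0 (\<tau> (Var 1))"
  shows "tame (\<tau> (Var 1)) (\<tau> (Var 2))"
proof -
  let ?X = "\<tau> (Var 1)" and ?Y = "\<tau> (Var 2)"
  obtain c where c: "c \<noteq> 0" "part_deriv 1 ?X * part_deriv 2 ?Y - part_deriv 2 ?X * part_deriv 1 ?Y = Const c"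
    using alg_aut_jacobi_tuple[OF aut] jacobian_2[of "\<lambda>i. \<tau> (Var i)"] by (auto simp: jacobi_tuples_def)
  have "Var 2 * part_deriv 2 ?X = 0"
    using X by (intro poly_mapping_eqI) (auto simp: lookup_Var_part_deriv weight_le_def wt_deg2 in_keys_iff)
  then have X2: "part_deriv 2 ?X = 0" by simp
  then have prod: "part_deriv 1 ?X * part_deriv 2 ?Y = Const c" using c(2) by simp
  have "part_deriv 1 ?X * (part_deriv 2 ?Y * Const (1 / c)) = 1"
    unfolding mult.assoc[symmetric] prod using c(1) by (simp flip: Const_mult)
  then obtain a where a: "a \<noteq> 0" "part_deriv 1 ?X = Const a" using cpoly_unit_imp_Const by blast
  have Y2: "part_deriv 2 ?Y = Const (c / a)"
  proof (rule cpoly_mult_left_cancel)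
    show "part_deriv 1 ?X * part_deriv 2 ?Y = part_deriv 1 ?X * Const (c / a)"
      unfolding prod using a by (simp flip: Const_mult)
    show "part_deriv 1 ?X \<noteq> 0" using a by simp
  qed
  define p where "p = ?X - Const a * Var 1"
  have "\<forall>i. part_deriv i p = 0"
    unfolding forall_2 by (simp add: p_def part_deriv_diff part_deriv_mult part_deriv_Const part_deriv_Var a X2)
  then have "p = Const (Poly_Mapping.lookup p 0)" by (intro all_part_deriv_0_imp_Const) simp
  then obtain b where b: "?X = Const a * Var 1 + Const b" unfolding p_def by (metis diff_eq_eq add.commute)
  define q where "q = ?Y - Const (c / a) * Var 2"
  have "part_deriv 2 q = 0"
    by (simp add: q_def part_deriv_diff part_deriv_mult part_deriv_Const part_deriv_Var Y2)
  then have "Poly_Mapping.lookup k 2 = 0" if "k \<in> Poly_Mapping.keys q" for k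
    using lookup_Var_part_deriv[of 2 q k] that by (simp add: in_keys_iff)
  then have "tame (Const a * Var 1 + Const b) (Const (c / a) * Var 2 + q)"
    using a c by (intro tame_triangular) auto
  then show ?thesis by (simp add: b q_def)
qed

lemma alg_aut_comp: "\<tau> \<in> alg_auts \<Longrightarrow> \<rho> \<in> alg_auts \<Longrightarrow> \<tau> \<circ> \<rho> \<in> alg_auts"
  by (auto simp: alg_auts_def bij_comp)

text \<open>The substitution \<open>\<rho>\<close> by \<open>p, q\<close> has the inverse given by \<open>r, s\<close>, and \<open>\<tau> = (\<tau> \<circ> \<rho>) \<circ> \<rho>\<^sup>-\<^sup>1\<close>.\<close>

lemma tame_comp_aut:
  assumes aut: "\<tau> \<in> alg_auts" and t: "tame (\<tau> p) (\<tau> q)" and r: "tame r s"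
    and pq: "poly_subst (pair p q) r = Var 1" "poly_subst (pair p q) s = Var 2"
  shows "tame (\<tau> (Var 1)) (\<tau> (Var 2))"
proof -
  define f where "f = (\<lambda>i. \<tau> (Var i))"
  have \<tau>: "\<tau> p = poly_subst f p" for p
    unfolding f_def by (rule fun_cong[OF alg_aut_eq_poly_subst[OF aut]])
  have "pair (\<tau> p) (\<tau> q) = (\<lambda>i. poly_subst f (pair p q i))" by (auto simp: pair_def \<tau>)
  then have "poly_subst (pair (\<tau> p) (\<tau> q)) u = \<tau> (poly_subst (pair p q) u)" for u
    by (simp add: \<tau> poly_subst_poly_subst)
  then show ?thesis using tame_comp[OF t r] by (simp add: pq)
qed

text \<open>Jung's theorem, by induction on the sum of the degrees in \<open>x\<^sub>2\<close> of the two values. These degrees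
  are represented by upper bounds, and a bound that is not attained is lowered. Otherwise one
  degree divides the other, and an elementary automorphism lowers the larger one.\<close>

theorem alg_aut_tame:
  assumes "\<tau> \<in> alg_auts"
  shows "tame (\<tau> (Var 1)) (\<tau> (Var 2))"
proof -
  have ex: "\<exists>d. weight_le deg2 d p" for p :: "2 cpoly"
    using exists_leading_exponent[of p deg2] weight_le_0 by metis
  have "tame (\<tau> (Var 1)) (\<tau> (Var 2))"
    if "\<tau> \<in> alg_auts" "weight_le deg2 n (\<tau> (Var 1))" "weight_le deg2 m (\<tau> (Var 2))" for n m \<tau>
    using that
  proof (induction "n + m" arbitrary: n m \<tau> rule: less_induct)
    case less
    let ?X = "\<tau> (Var 1)" and ?Y = "\<tau> (Var 2)"
    note aut = less.prems(1) and X = less.prems(2) and Y = less.prems(3)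
    have hom: "\<tau> (p + q) = \<tau> p + \<tau> q" "\<tau> (p * q) = \<tau> p * \<tau> q" "\<tau> (Const a) = Const a" for p q a
      using aut by (simp_all add: alg_auts_def)
    have hom_pow: "\<tau> (p ^ k) = \<tau> p ^ k" for p k
      using hom(3)[of 1] by (induction k) (simp_all add: hom)
    have hom_diff: "\<tau> (p - q) = \<tau> p - \<tau> q" for p q
      using hom(1)[of "p - q" q] by simp
    obtain c where J: "part_deriv 1 ?X * part_deriv 2 ?Y - part_deriv 2 ?X * part_deriv 1 ?Y = Const c"
      using alg_aut_jacobi_tuple[OF aut] jacobian_2[of "\<lambda>i. \<tau> (Var i)"] by (auto simp: jacobi_tuples_def)
    consider "n = 0" | "m = 0" | "n > 0" "m > 0" "weight_part deg2 n ?X = 0" | "n > 0" "m > 0" "weight_part deg2 m ?Y = 0"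
      | "n > 0" "m > 0" "weight_part deg2 n ?X \<noteq> 0" "weight_part deg2 m ?Y \<noteq> 0" by blast
    then show ?case
    proof cases
      case 1
      then show ?thesis using tame_if_degree_0[OF aut] X by simp
    next
      case 2
      have "tame (\<tau> (Var 2)) (\<tau> (Var 1))"
        using tame_if_degree_0[OF alg_aut_comp[OF aut swap_alg_aut]] Y 2 by simp
      then show ?thesis by (rule tame_comp_aut[OF aut _ tame_swap]) simp_all
    next
      case 3
      then have "weight_le deg2 (n - 1) ?X" using weight_le_pred[OF X] by simp
      then show ?thesis using less.hyps[of "n - 1" m] 3 aut Y by simp
    next
      case 4
      then have "weight_le deg2 (m - 1) ?Y" using weight_le_pred[OF Y] by simp
      then show ?thesis using less.hyps[of n "m - 1"] 4 aut X by simp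
    next
      case 5
      from degrees_dvd[OF aut X 5(3) Y 5(4) 5(1,2)] show ?thesis
      proof
        assume "n dvd m"
        then obtain a k where ak: "weight_le deg2 (m - 1) (?Y - Const a * ?X ^ k)"
          using lower_degree_step[OF J X Y 5(1,2)] 5(3) by blast
        let ?\<rho> = "poly_subst (pair (Var 1) (Var 2 - Const a * Var 1 ^ k))"
        have "?\<rho> \<in> alg_auts"
          by (rule alg_autI_2[of _ "pair (Var 1) (Var 2 + Const a * Var 1 ^ k)"])
            (simp_all add: poly_subst_add poly_subst_diff poly_subst_mult poly_subst_power)
        then have "\<tau> \<circ> ?\<rho> \<in> alg_auts" by (rule alg_aut_comp[OF aut])
        then have "tame ((\<tau> \<circ> ?\<rho>) (Var 1)) ((\<tau> \<circ> ?\<rho>) (Var 2))"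
          by (rule less.hyps[of n "m - 1", rotated]) (use X ak 5 in \<open>simp_all add: hom hom_diff hom_pow\<close>)
        then have "tame (\<tau> (Var 1)) (\<tau> (Var 2 - Const a * Var 1 ^ k))" by simp
        then show ?thesis
          by (rule tame_comp_aut[OF aut _ tame_shear_monomial[of a k]])
            (simp_all add: poly_subst_add poly_subst_mult poly_subst_power)
      next
        assume "m dvd n"
        have J': "part_deriv 1 ?Y * part_deriv 2 ?X - part_deriv 2 ?Y * part_deriv 1 ?X = Const (- c)"
          unfolding Const_minus J[symmetric] by (simp add: algebra_simps)
        obtain a k where ak: "weight_le deg2 (n - 1) (?X - Const a * ?Y ^ k)"
          using lower_degree_step[OF J' Y X 5(2,1) \<open>m dvd n\<close>] 5(4) by blast
        let ?\<rho> = "poly_subst (pair (Var 1 - Const a * Var 2 ^ k) (Var 2))"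
        have "?\<rho> \<in> alg_auts"
          by (rule alg_autI_2[of _ "pair (Var 1 + Const a * Var 2 ^ k) (Var 2)"])
            (simp_all add: poly_subst_add poly_subst_diff poly_subst_mult poly_subst_power)
        then have "\<tau> \<circ> ?\<rho> \<in> alg_auts" by (rule alg_aut_comp[OF aut])
        then have "tame ((\<tau> \<circ> ?\<rho>) (Var 1)) ((\<tau> \<circ> ?\<rho>) (Var 2))"
          by (rule less.hyps[of "n - 1" m, rotated]) (use Y ak 5 in \<open>simp_all add: hom hom_diff hom_pow\<close>)
        then have t: "tame (\<tau> (Var 1 - Const a * Var 2 ^ k)) (\<tau> (Var 2))" by simp
        have "tame (Var 1 + Const a * Var 2 ^ k) (Var 2)"
          using tame_conj_swap[OF tame_shear_monomial[of a k]]
          by (simp add: poly_subst_add poly_subst_mult poly_subst_power)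
        then show ?thesis
          by (rule tame_comp_aut[OF aut t])
            (simp_all add: poly_subst_add poly_subst_mult poly_subst_power)
      qed
    qed
  qed
  then show ?thesis using assms ex by blast
qed

section \<open>Endomorphism semigroups and automorphism groups\<close>

lemma lie_end_eq_sigma:
  assumes "\<phi> \<in> lie_ends" "\<phi> \<noteq> (\<lambda>_. 0)"
  shows "\<exists>f\<in>jacobi_tuples. \<phi> = sigma f"
proof -
  interpret nonzero_lie_end \<phi> by unfold_locales (rule assms)+
  show ?thesis by (rule eq_sigma)
qed

lemma lie_aut_nonzero:
  fixes \<phi> :: "'n::finite witt \<Rightarrow> 'n witt"
  assumes "\<phi> \<in> lie_auts"
  shows "\<phi> \<noteq> (\<lambda>_. 0)"
proof
  assume 0: "\<phi> = (\<lambda>_. 0)"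
  have "partial i = (0 :: 'n witt)" for i
    using assms 0 by (auto simp: lie_auts_def bij_def inj_def)
  then have "part_deriv undefined (Var undefined :: 'n cpoly) = 0"
    by (metis der_partial der_0)
  then show False by (simp add: part_deriv_Var)
qed

lemma lie_aut_eq_zeta:
  assumes "\<phi> \<in> lie_auts"
  shows "\<exists>\<tau>\<in>alg_auts. \<phi> = zeta \<tau>"
proof -
  obtain f where f: "f \<in> jacobi_tuples" "\<phi> = sigma f"
    using lie_end_eq_sigma[of \<phi>] lie_aut_nonzero[OF assms] assms by (auto simp: lie_auts_def)
  then have "surj (poly_subst f)" using assms bij_sigma_iff by (auto simp: lie_auts_def)
  then show ?thesis
    using poly_subst_alg_aut[OF f(1)] f(2) by (intro bexI[of _ "poly_subst f"]) (simp_all add: zeta_def)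
qed

lemma sigma_iso: "sigma \<in> iso JT End_W_nonzero"
proof (rule isoI)
  show "sigma \<in> hom JT End_W_nonzero"
    by (rule homI) (simp_all add: JT_def End_W_nonzero_def sigma_lie_end sigma_nonzero sigma_comp)
  show "bij_betw sigma (carrier JT) (carrier End_W_nonzero)"
    unfolding bij_betw_def
  proof
    show "inj_on sigma (carrier JT)" by (simp add: JT_def inj_on_sigma)
    show "sigma ` carrier JT = carrier End_W_nonzero"
      using lie_end_eq_sigma by (auto simp: JT_def End_W_nonzero_def sigma_lie_end sigma_nonzero)
  qed
qed

lemma zeta_iso: "zeta \<in> iso Aut_A Aut_W"
proof (rule isoI)
  show "zeta \<in> hom Aut_A Aut_W"
    by (rule homI) (simp_all add: Aut_A_def Aut_W_def zeta_lie_aut zeta_comp)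
  show "bij_betw zeta (carrier Aut_A) (carrier Aut_W)"
    unfolding bij_betw_def
  proof
    show "inj_on zeta (carrier Aut_A)" by (simp add: Aut_A_def inj_on_zeta)
    show "zeta ` carrier Aut_A = carrier Aut_W"
      using lie_aut_eq_zeta by (auto simp: Aut_A_def Aut_W_def zeta_lie_aut)
  qed
qed

lemma jacobi_conjecture_iff_witt_conjecture:
  "(\<forall>f \<in> (jacobi_tuples :: ('n::finite \<Rightarrow> 'n cpoly) set). subalgebra hull range f = UNIV)
    \<longleftrightarrow> (\<forall>\<phi> \<in> (lie_ends :: ('n witt \<Rightarrow> 'n witt) set). \<phi> \<noteq> (\<lambda>_. 0) \<longrightarrow> \<phi> \<in> lie_auts)"
proof -
  have "subalgebra hull range f = UNIV \<longleftrightarrow> sigma f \<in> lie_auts" if "f \<in> jacobi_tuples" for f :: "'n \<Rightarrow> 'n cpoly"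
    using that by (simp add: subalgebra_hull_range bij_sigma_iff lie_auts_def sigma_lie_end)
  then show ?thesis
    using lie_end_eq_sigma sigma_lie_end sigma_nonzero by metis
qed

text \<open>Both sides are images under \<open>\<zeta>\<close>: the generators come from the exchange of the variables, from
  rescalings of \<open>x\<^sub>1\<close> and from the elementary automorphisms \<open>x\<^sub>2 \<mapsto> x\<^sub>2 + x\<^sub>1^p\<close>.\<close>

lemma generate_Aut_W_2: "tame_witt = carrier Aut_W"
proof
  have "{s_map} \<union> {tau_map a | a. a \<noteq> 0} \<union> {psi_map p | p. True} \<subseteq> carrier Aut_W"
    using zeta_lie_aut[OF swap_alg_aut] zeta_lie_aut[OF tau_map_eq(2)] zeta_lie_aut[OF psi_alg_aut]
    by (auto simp: Aut_W_def zeta_poly_subst s_map_eq tau_map_eq(1) psi_map_eq)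
  then show "tame_witt \<subseteq> carrier Aut_W"
    unfolding tame_witt_def by (rule group.generate_incl[OF group_Aut_W])
next
  show "carrier Aut_W \<subseteq> tame_witt"
  proof
    fix \<phi> :: "2 witt \<Rightarrow> 2 witt" assume "\<phi> \<in> carrier Aut_W"
    then obtain \<tau> where \<tau>: "\<tau> \<in> alg_auts" "\<phi> = zeta \<tau>"
      using lie_aut_eq_zeta by (auto simp: Aut_W_def)
    have eq: "(\<lambda>i. \<tau> (Var i)) = pair (\<tau> (Var 1)) (\<tau> (Var 2))"
    proof
      fix i
      show "\<tau> (Var i) = pair (\<tau> (Var 1)) (\<tau> (Var 2)) i"
        using exhaust_2[of i] by (elim disjE) simp_all
    qed
    have "zeta \<tau> = zeta (poly_subst (pair (\<tau> (Var 1)) (\<tau> (Var 2))))"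
      unfolding zeta_poly_subst unfolding zeta_def by (rule arg_cong[OF eq])
    then show "\<phi> \<in> tame_witt" using alg_aut_tame[OF \<tau>(1)] \<tau>(2) by (simp add: tame_def)
  qed
qed

theorem theorem1p1:
  shows "((\<forall>f \<in> (jacobi_tuples :: ('n::finite \<Rightarrow> 'n cpoly) set). subalgebra hull range f = UNIV)
        \<longleftrightarrow> (\<forall>\<phi> \<in> (lie_ends :: ('n witt \<Rightarrow> 'n witt) set). \<phi> \<noteq> (\<lambda>_. 0) \<longrightarrow> \<phi> \<in> lie_auts))
    \<and> sigma \<in> iso (JT :: ('n \<Rightarrow> 'n cpoly) monoid) End_W_nonzero
    \<and> zeta \<in> iso (Aut_A :: ('n cpoly \<Rightarrow> 'n cpoly) monoid) Aut_W
    \<and> generate Aut_W ({s_map} \<union> {tau_map a | a. a \<noteq> 0} \<union> {psi_map p | p. True})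
        = carrier (Aut_W :: (2 witt \<Rightarrow> 2 witt) monoid)"
  using jacobi_conjecture_iff_witt_conjecture sigma_iso zeta_iso generate_Aut_W_2[unfolded tame_witt_def]
  by blast

end
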